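(* Let $g\not\equiv0$ be an integrable function on $[0,1]$, positive on $(0,1]$, satisfying $\int_0^1\frac{g(s)}{s}\,ds<\infty$. Then: (i) if $t=O(g(t))$ as $t\to0$, then the closure of $\mathcal{SF}$ in $A^2_{(g)}$ equals $\mathcal{SF}$; (ii) if $g(t)=o(t)$ as $t\to0$, then the closure of $\mathcal{SF}$ in $A^2_{(g)}$ equals $A^2_{(g)}$.
   Context: $\mathbb D$ is the open unit disk of $\mathbb C$, $\mathbb T$ is the unit circle, and $m_2$ is normalized planar Lebesgue measure, $dm_2(z)=\pi^{-1}\,dx\,dy$. The weighted Bergman space $A^2_{(g)}$ consists of all $f$ holomorphic in $\mathbb D$ with $$\|f\|_{(g)}^2=\kappa_g\int_{\mathbb D}|f(z)|^2\,g(1-|z|^2)\,dm_2(z)<\infty,\qquad \kappa_g=\Bigl(\int_0^1 g(t)\,dt\Bigr)^{-1}.$$ $\mathcal{SF}$ is the set of all functions $\sum_{0\le k<N}\frac1{z-a_k}$ with $N\ge1$ an integer and $a_k\in\mathbb T$, $0\le k<N$ (not necessarily distinct). The condition $\int_0^1 g(s)s^{-1}ds<\infty$ guarantees $\mathcal{SF}\subset A^2_{(g)}$. *)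

theory Defs
  imports "HOL-Complex_Analysis.Complex_Analysis" "HOL-Library.Landau_Symbols"
begin

definition m2 :: "complex measure" where
  "m2 = density lebesgue (\<lambda>z. ennreal (1 / pi))"

definition kappa :: "(real \<Rightarrow> real) \<Rightarrow> real" where
  "kappa g = inverse (LINT t:{0..1}|lebesgue. g t)"

text \<open>Functions on the unit disk are represented extensionally: they take the value
  \<^term>\<open>undefined\<close> off \<^term>\<open>ball (0::complex) 1\<close>, so that equality of HOL functions is equality
  on the disk.\<close>

definition bergman :: "(real \<Rightarrow> real) \<Rightarrow> (complex \<Rightarrow> complex) set" where
  "bergman g = {f \<in> extensional (ball 0 1).
     f holomorphic_on ball 0 1 \<and>
     set_integrable m2 (ball 0 1) (\<lambda>z. (cmod (f z))\<^sup>2 * g (1 - (cmod z)\<^sup>2))}"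

definition bergman_norm :: "(real \<Rightarrow> real) \<Rightarrow> (complex \<Rightarrow> complex) \<Rightarrow> real" where
  "bergman_norm g f =
     sqrt (kappa g * (LINT z:ball 0 1|m2. (cmod (f z))\<^sup>2 * g (1 - (cmod z)\<^sup>2)))"

definition bergman_dist :: "(real \<Rightarrow> real) \<Rightarrow> (complex \<Rightarrow> complex) \<Rightarrow> (complex \<Rightarrow> complex) \<Rightarrow> real" where
  "bergman_dist g f h = bergman_norm g (\<lambda>z. f z - h z)"

definition bergman_topology :: "(real \<Rightarrow> real) \<Rightarrow> (complex \<Rightarrow> complex) topology" where
  "bergman_topology g = Metric_space.mtopology (bergman g) (bergman_dist g)"

definition simplest_fractions :: "(complex \<Rightarrow> complex) set" where
  "simplest_fractions =
     {(\<lambda>z\<in>ball 0 1. \<Sum>k<N. 1 / (z - a k)) | (N::nat) (a::nat \<Rightarrow> complex).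
        N \<ge> 1 \<and> (\<forall>k<N. a k \<in> sphere 0 1)}"

text \<open>The rest of this theory checks that \<^const>\<open>bergman_dist\<close> is a metric on \<^const>\<open>bergman\<close>
  for the weights of interest, so that \<^const>\<open>bergman_topology\<close> is its metric topology.\<close>

lemma space_m2 [simp]: "space m2 = UNIV"
  and sets_m2 [simp, measurable_cong]: "sets m2 = sets lebesgue"
  by (simp_all add: m2_def)

lemma AE_m2: "(AE z in m2. P z) \<longleftrightarrow> (AE z in lebesgue. P z)"
  unfolding m2_def by (subst AE_density) auto

lemma continuous_on_ball_measurable_m2:
  fixes f :: "complex \<Rightarrow> 'b::{real_normed_vector, second_countable_topology}"
  assumes "continuous_on (ball 0 1) f"
  shows "(\<lambda>z. indicator (ball 0 1) z *\<^sub>R f z) \<in> borel_measurable m2"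
proof -
  have "(\<lambda>z. indicator (ball 0 1) z *\<^sub>R f z) \<in> borel_measurable borel"
    by (rule borel_measurable_continuous_on_indicator) (use assms in auto)
  then have "(\<lambda>z. indicator (ball 0 1) z *\<^sub>R f z) \<in> borel_measurable lebesgue"
    using measurable_completion [of _ lborel] by simp
  then show ?thesis
    by (simp add: m2_def)
qed

lemma weighted_square_measurable:
  assumes f: "f \<in> bergman g" and u: "continuous_on (ball 0 1) u"
    and z0: "z0 \<in> ball 0 1" "f z0 \<noteq> 0"
  shows "(\<lambda>z. indicator (ball 0 1) z *\<^sub>R ((cmod (u z))\<^sup>2 * g (1 - (cmod z)\<^sup>2))) \<in> borel_measurable m2"
proof -
  define D where "D = ball (0::complex) 1"
  have hol: "f holomorphic_on D" using f by (auto simp: bergman_def D_def)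
  have cnt: "countable {z\<in>D. f z = 0}"
  proof (cases "f constant_on D")
    case True
    then have "{z\<in>D. f z = 0} = {}"
      using z0 by (auto simp: constant_on_def D_def)
    then show ?thesis by (metis countable_empty)
  next
    case False
    have "open D" "connected D" by (auto simp: D_def)
    moreover obtain C where "\<And>n::nat. compact (C n)" "\<Union>(range C) = D"
      using open_Union_compact_subsets [OF \<open>open D\<close>] by metis
    then have "fsigma D"
      using fsigma.intros [of C] by (simp add: compact_imp_closed)
    ultimately show ?thesis
      using hol False holomorphic_countable_zeros by blast
  qed
  have [measurable]: "(\<lambda>z. indicator D z *\<^sub>R ((cmod (f z))\<^sup>2 * g (1 - (cmod z)\<^sup>2))) \<in> borel_measurable m2"
    using f unfolding bergman_def set_integrable_def D_def by auto
  have [measurable]: "(\<lambda>z. indicator D z *\<^sub>R f z) \<in> borel_measurable m2"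
    "(\<lambda>z. indicator D z *\<^sub>R u z) \<in> borel_measurable m2"
    using continuous_on_ball_measurable_m2 u holomorphic_on_imp_continuous_on [OF hol]
    by (auto simp: D_def)
  have "(\<lambda>z. (indicator D z *\<^sub>R ((cmod (f z))\<^sup>2 * g (1 - (cmod z)\<^sup>2)))
           * (cmod (indicator D z *\<^sub>R u z))\<^sup>2 / (cmod (indicator D z *\<^sub>R f z))\<^sup>2) \<in> borel_measurable m2"
    by measurable
  then have "(\<lambda>z. indicator D z *\<^sub>R ((cmod (u z))\<^sup>2 * g (1 - (cmod z)\<^sup>2))) \<in> borel_measurable m2"
  proof (rule measurable_discrete_difference [where X = "{z\<in>D. f z = 0}"])
    show "countable {z\<in>D. f z = 0}" by (fact cnt)
    show "{z} \<in> sets m2" for z by simp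
  qed (auto simp: indicator_def split: if_splits)
  then show ?thesis by (simp add: D_def)
qed

context
  fixes g :: "real \<Rightarrow> real"
  assumes g_int: "set_integrable lebesgue {0..1} g"
    and g_pos: "\<And>t. t \<in> {0<..1} \<Longrightarrow> g t > 0"
begin

lemma weight_pos: "z \<in> ball 0 1 \<Longrightarrow> g (1 - (cmod z)\<^sup>2) > 0"
  by (rule g_pos) (auto simp: power_less_one_iff)

lemma kappa_pos: "kappa g > 0"
proof -
  let ?F = "\<lambda>t. indicator {0..1} t *\<^sub>R g t"
  have int: "integrable lebesgue ?F" using g_int by (simp add: set_integrable_def)
  have "AE t in lebesgue. t \<noteq> (0::real)"
    by (intro AE_I [where N = "{0}"]) auto
  then have nn: "AE t in lebesgue. ?F t \<ge> 0"
    by eventually_elim (use g_pos in \<open>auto simp: indicator_def less_imp_le\<close>)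
  have "(LINT t|lebesgue. ?F t) \<noteq> 0"
  proof
    assume "(LINT t|lebesgue. ?F t) = 0"
    then have "AE t in lebesgue. ?F t = 0"
      using integral_nonneg_eq_0_iff_AE [OF int nn] by simp
    then have "AE t in lebesgue. t \<notin> {0<..<1::real}"
      by eventually_elim (use g_pos in \<open>force simp: indicator_def split: if_splits\<close>)
    then have "negligible {0<..<1::real}"
      by (simp add: negligible_iff_null_sets AE_iff_null_sets)
    then show False
      using open_not_negligible [of "{0<..<1::real}"] by auto
  qed
  moreover have "(LINT t|lebesgue. ?F t) \<ge> 0"
    using nn by (rule integral_nonneg_AE)
  ultimately show ?thesis
    by (simp add: kappa_def set_lebesgue_integral_def)
qed

lemma bergman_integral_nonneg:
  "(LINT z:ball 0 1|m2. (cmod (f z))\<^sup>2 * g (1 - (cmod z)\<^sup>2)) \<ge> 0"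
  unfolding set_lebesgue_integral_def
  by (rule integral_nonneg_AE) (use weight_pos in \<open>auto simp: indicator_def less_imp_le\<close>)

lemma bergman_diff_integrable:
  assumes f: "f \<in> bergman g" and h: "h \<in> bergman g"
  shows "set_integrable m2 (ball 0 1) (\<lambda>z. (cmod (f z - h z))\<^sup>2 * g (1 - (cmod z)\<^sup>2))"
proof (cases "\<exists>z0\<in>ball 0 1. f z0 \<noteq> 0")
  case False
  then have "set_integrable m2 (ball 0 1) (\<lambda>z. (cmod (f z - h z))\<^sup>2 * g (1 - (cmod z)\<^sup>2)) \<longleftrightarrow>
      set_integrable m2 (ball 0 1) (\<lambda>z. (cmod (h z))\<^sup>2 * g (1 - (cmod z)\<^sup>2))"
    by (intro set_integrable_cong) auto
  then show ?thesis using h by (simp add: bergman_def)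
next
  case True
  then obtain z0 where z0: "z0 \<in> ball 0 1" "f z0 \<noteq> 0" by blast
  let ?w = "\<lambda>z. g (1 - (cmod z)\<^sup>2)"
  have cont: "continuous_on (ball 0 1) (\<lambda>z. f z - h z)"
    using f h by (auto simp: bergman_def intro!: holomorphic_on_imp_continuous_on holomorphic_on_diff)
  have "integrable m2 (\<lambda>z. 2 * (indicator (ball 0 1) z *\<^sub>R ((cmod (f z))\<^sup>2 * ?w z))
                       + 2 * (indicator (ball 0 1) z *\<^sub>R ((cmod (h z))\<^sup>2 * ?w z)))"
    using f h unfolding bergman_def set_integrable_def
    by (intro Bochner_Integration.integrable_add integrable_mult_right) auto
  moreover have "norm (indicator (ball 0 1) z *\<^sub>R ((cmod (f z - h z))\<^sup>2 * ?w z))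
      \<le> norm (2 * (indicator (ball 0 1) z *\<^sub>R ((cmod (f z))\<^sup>2 * ?w z))
                       + 2 * (indicator (ball 0 1) z *\<^sub>R ((cmod (h z))\<^sup>2 * ?w z)))" for z
  proof (cases "z \<in> ball 0 1")
    case z: True
    have "cmod (f z - h z) \<le> cmod (f z) + cmod (h z)" by (rule norm_triangle_ineq4)
    then have "(cmod (f z - h z))\<^sup>2 \<le> (cmod (f z) + cmod (h z))\<^sup>2" by (rule power_mono) simp
    also have "\<dots> \<le> 2 * (cmod (f z))\<^sup>2 + 2 * (cmod (h z))\<^sup>2"
      using zero_le_power2 [of "cmod (f z) - cmod (h z)"]
      by (simp add: power2_eq_square algebra_simps)
    finally have "(cmod (f z - h z))\<^sup>2 * ?w z \<le> (2 * (cmod (f z))\<^sup>2 + 2 * (cmod (h z))\<^sup>2) * ?w z"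
      using weight_pos [OF z] by (intro mult_right_mono) auto
    moreover have "0 \<le> (cmod (f z - h z))\<^sup>2 * ?w z"
      using weight_pos [OF z] by simp
    ultimately show ?thesis
      using z by (simp add: algebra_simps)
  qed simp
  ultimately show ?thesis
    unfolding set_integrable_def
    by (intro Bochner_Integration.integrable_bound [OF _ weighted_square_measurable [OF f cont z0]]) auto
qed

lemma bergman_dist_triangle:
  assumes f: "f \<in> bergman g" and k: "k \<in> bergman g" and h: "h \<in> bergman g"
  shows "bergman_dist g f h \<le> bergman_dist g f k + bergman_dist g k h"
proof (rule field_le_epsilon)
  fix e :: real assume e: "e > 0"
  define I where "I u = (LINT z:ball 0 1|m2. (cmod (u z))\<^sup>2 * g (1 - (cmod z)\<^sup>2))"
    for u :: "complex \<Rightarrow> complex"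
  define a where "a = bergman_dist g f k"
  define b where "b = bergman_dist g k h"
  define p where "p = a + e / 2"
  define q where "q = b + e / 2"
  have dist: "bergman_dist g u v = sqrt (kappa g * I (\<lambda>z. u z - v z))" for u v
    by (simp add: bergman_dist_def bergman_norm_def I_def)
  have I_nn: "I u \<ge> 0" for u
    unfolding I_def by (rule bergman_integral_nonneg)
  have ab: "a \<ge> 0" "b \<ge> 0"
    unfolding a_def b_def dist using kappa_pos I_nn by auto
  have sq: "a\<^sup>2 = kappa g * I (\<lambda>z. f z - k z)" "b\<^sup>2 = kappa g * I (\<lambda>z. k z - h z)"
    unfolding a_def b_def dist using kappa_pos I_nn by auto
  have pq: "p > 0" "q > 0" "a \<le> p" "b \<le> q"
    using ab e by (auto simp: p_def q_def)
  have conv: "(x + y)\<^sup>2 \<le> (p + q) / p * x\<^sup>2 + (p + q) / q * y\<^sup>2" for x y :: real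
  proof -
    have "(p + q) / p * x\<^sup>2 + (p + q) / q * y\<^sup>2 - (x + y)\<^sup>2 = (q * x - p * y)\<^sup>2 / (p * q)"
      using pq by (simp add: field_simps power2_eq_square)
    also have "\<dots> \<ge> 0" using pq by simp
    finally show ?thesis by linarith
  qed
  have "I (\<lambda>z. f z - h z) \<le> (LINT z:ball 0 1|m2.
      (p + q) / p * ((cmod (f z - k z))\<^sup>2 * g (1 - (cmod z)\<^sup>2))
      + (p + q) / q * ((cmod (k z - h z))\<^sup>2 * g (1 - (cmod z)\<^sup>2)))"
    unfolding I_def
  proof (rule set_integral_mono)
    show "set_integrable m2 (ball 0 1) (\<lambda>z. (cmod (f z - h z))\<^sup>2 * g (1 - (cmod z)\<^sup>2))"
      by (rule bergman_diff_integrable [OF f h])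
    show "set_integrable m2 (ball 0 1) (\<lambda>z.
      (p + q) / p * ((cmod (f z - k z))\<^sup>2 * g (1 - (cmod z)\<^sup>2))
      + (p + q) / q * ((cmod (k z - h z))\<^sup>2 * g (1 - (cmod z)\<^sup>2)))"
      using bergman_diff_integrable [OF f k] bergman_diff_integrable [OF k h]
      by (intro set_integral_add set_integrable_mult_right) auto
    fix z :: complex assume z: "z \<in> ball 0 1"
    have "cmod (f z - h z) \<le> cmod (f z - k z) + cmod (k z - h z)"
      using norm_triangle_ineq [of "f z - k z" "k z - h z"] by simp
    then have "(cmod (f z - h z))\<^sup>2 \<le> (cmod (f z - k z) + cmod (k z - h z))\<^sup>2"
      by (rule power_mono) simp
    also note conv
    finally have "(cmod (f z - h z))\<^sup>2 * g (1 - (cmod z)\<^sup>2) \<le>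
       ((p + q) / p * (cmod (f z - k z))\<^sup>2 + (p + q) / q * (cmod (k z - h z))\<^sup>2) * g (1 - (cmod z)\<^sup>2)"
      using weight_pos [OF z] by (intro mult_right_mono) auto
    then show "(cmod (f z - h z))\<^sup>2 * g (1 - (cmod z)\<^sup>2) \<le>
      (p + q) / p * ((cmod (f z - k z))\<^sup>2 * g (1 - (cmod z)\<^sup>2))
      + (p + q) / q * ((cmod (k z - h z))\<^sup>2 * g (1 - (cmod z)\<^sup>2))"
      by (simp only: distrib_right mult.assoc)
  qed
  also have "\<dots> = (p + q) / p * I (\<lambda>z. f z - k z) + (p + q) / q * I (\<lambda>z. k z - h z)"
    unfolding I_def
    using bergman_diff_integrable [OF f k] bergman_diff_integrable [OF k h]
    by (subst set_integral_add) (auto simp del: times_divide_eq_left)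
  finally have "kappa g * I (\<lambda>z. f z - h z)
      \<le> kappa g * ((p + q) / p * I (\<lambda>z. f z - k z) + (p + q) / q * I (\<lambda>z. k z - h z))"
    using kappa_pos by (intro mult_left_mono) auto
  also have "\<dots> = (p + q) / p * a\<^sup>2 + (p + q) / q * b\<^sup>2"
    by (simp add: sq algebra_simps)
  also have "\<dots> \<le> (p + q) / p * p\<^sup>2 + (p + q) / q * q\<^sup>2"
    using pq ab by (intro add_mono mult_left_mono power_mono) auto
  also have "(p + q) / p * p\<^sup>2 + (p + q) / q * q\<^sup>2 = (p + q) * p + (p + q) * q"
    using pq by (simp add: power2_eq_square)
  also have "\<dots> = (p + q)\<^sup>2"
    by (simp add: power2_eq_square ring_distribs)
  finally have "bergman_dist g f h \<le> sqrt ((p + q)\<^sup>2)"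
    unfolding dist by (rule real_sqrt_le_mono)
  also have "\<dots> = a + b + e"
    using pq by (simp add: p_def q_def)
  finally show "bergman_dist g f h \<le> bergman_dist g f k + bergman_dist g k h + e"
    by (simp add: a_def b_def)
qed

lemma bergman_dist_eq_0_imp_eq:
  assumes f: "f \<in> bergman g" and h: "h \<in> bergman g" and 0: "bergman_dist g f h = 0"
  shows "f = h"
proof (rule extensionalityI [of f "ball 0 1" h])
  show "f \<in> extensional (ball 0 1)" "h \<in> extensional (ball 0 1)"
    using f h by (auto simp: bergman_def)
  let ?F = "\<lambda>z. indicator (ball 0 1) z *\<^sub>R ((cmod (f z - h z))\<^sup>2 * g (1 - (cmod z)\<^sup>2))"
  have int: "integrable m2 ?F"
    using bergman_diff_integrable [OF f h] by (simp add: set_integrable_def)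
  have nn: "AE z in m2. ?F z \<ge> 0"
    using weight_pos by (auto simp: indicator_def less_imp_le)
  have "(LINT z|m2. ?F z) = 0"
    using 0 kappa_pos
    by (simp add: bergman_dist_def bergman_norm_def set_lebesgue_integral_def)
  then have "AE z in m2. ?F z = 0"
    using integral_nonneg_eq_0_iff_AE [OF int nn] by simp
  then have ae: "AE z in lebesgue. z \<notin> {z \<in> ball 0 1. f z - h z \<in> - {0}}"
    unfolding AE_m2
    by eventually_elim (use weight_pos in \<open>force simp: indicator_def split: if_splits\<close>)
  have cont: "continuous_on (ball 0 1) (\<lambda>z. f z - h z)"
    using f h by (auto simp: bergman_def intro!: holomorphic_on_imp_continuous_on holomorphic_on_diff)
  have "{z \<in> ball 0 1. f z - h z \<in> - {0}} = ball 0 1 \<inter> (\<lambda>z. f z - h z) -` (- {0})"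
    by blast
  then have op: "open {z \<in> ball 0 1. f z - h z \<in> - {0}}"
    using continuous_open_preimage [OF cont, of "- {0}"] by (metis open_ball open_Compl closed_singleton)
  then have "negligible {z \<in> ball 0 1. f z - h z \<in> - {0}}"
    using ae by (simp add: negligible_iff_null_sets AE_iff_null_sets)
  then have "{z \<in> ball 0 1. f z - h z \<in> - {0}} = {}"
    using open_not_negligible [OF op] by blast
  then show "f z = h z" if "z \<in> ball 0 1" for z
    using that by auto
qed

lemma Metric_space_bergman: "Metric_space (bergman g) (bergman_dist g)"
proof
  show "0 \<le> bergman_dist g f h" for f h
    unfolding bergman_dist_def bergman_norm_def
    using kappa_pos bergman_integral_nonneg by simp
  show "bergman_dist g f h = bergman_dist g h f" for f h
    unfolding bergman_dist_def bergman_norm_def by (simp add: norm_minus_commute)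
  show "bergman_dist g f h = 0 \<longleftrightarrow> f = h" if "f \<in> bergman g" "h \<in> bergman g" for f h
    using bergman_dist_eq_0_imp_eq [OF that]
    by (auto simp: bergman_dist_def bergman_norm_def)
  show "bergman_dist g f h \<le> bergman_dist g f k + bergman_dist g k h"
    if "f \<in> bergman g" "k \<in> bergman g" "h \<in> bergman g" for f k h
    using bergman_dist_triangle that .
qed

end

end

theory Submission
  imports Defs
begin

text \<open>In terms of Taylor coefficients, the squared norm of f is (up to the constant
  \<^term>\<open>kappa g\<close>) the sum of \<open>|a\<^sub>m|\<^sup>2 w\<^sub>m\<close>, where \<open>w\<^sub>m\<close> is the m-th moment of \<open>g(t)\<close> against
  \<open>(1 - t)\<^sup>m\<close>. The coefficients of a simplest fraction are the negatives of the conjugate power sums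
  of its poles.

  (i) Here \<open>w\<^sub>m\<close> is at least of order \<open>m\<^sup>-\<^sup>2\<close>. For N points on the circle, the power sums of order less
  than 2N have total square at least \<open>N\<^sup>2/2\<close>, so the part of the norm carried by coefficients of order
  up to 2N is bounded below. If fractions with N tending to infinity converged in norm, low order
  coefficients would stay bounded and high order ones would carry little norm, a contradiction. Hence
  N is bounded along an approximating sequence and compactness of the circle applies.

  (ii) Here \<open>w\<^sub>m = o(m\<^sup>-\<^sup>2)\<close>. For the fractions \<open>\<gamma>\<^sub>j = 1/(z - \<omega>\<^sup>j)\<close> at the M-th roots of unity, the squared
  norms of the M consecutive differences have sum tending to 0, and so does the norm of the sum of all
  \<open>\<gamma>\<^sub>j\<close>. A Taylor polynomial is, up to a small error, a combination of the \<open>\<gamma>\<^sub>j\<close> with real weights of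
  total 0. Writing it as a combination of the differences, one can round the coefficients to integers
  with a small error. This gives integer multiplicities bounded independently of M, which become
  positive after adding a constant multiple of the sum of all \<open>\<gamma>\<^sub>j\<close>.\<close>

subsection \<open>Lebesgue measure on the complex plane\<close>

text \<open>It suffices to compare both measures on open boxes. This opens integrals over the plane
  to Fubini.\<close>

lemma lborel_complex_conv_prod:
  "(lborel :: complex measure) = distr (lborel \<Otimes>\<^sub>M lborel) borel (\<lambda>(x, y). Complex x y)"
proof (rule lborel_eqI)
  have meas: "(\<lambda>(x, y). Complex x y) \<in> borel_measurable (lborel \<Otimes>\<^sub>M lborel)"
    by (simp add: Complex_eq case_prod_beta)
  fix l u :: complex
  assume le: "\<And>b. b \<in> Basis \<Longrightarrow> l \<bullet> b \<le> u \<bullet> b"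
  then have le': "Re l \<le> Re u" "Im l \<le> Im u"
    by (metis Basis_complex_def insertCI complex_inner_1_right complex_inner_i_right)+
  have "(\<lambda>(x, y). Complex x y) -` box l u = {Re l<..<Re u} \<times> {Im l<..<Im u}"
    by (auto simp: box_def Basis_complex_def)
  then have "emeasure (distr (lborel \<Otimes>\<^sub>M lborel) borel (\<lambda>(x, y). Complex x y)) (box l u)
      = emeasure (lborel \<Otimes>\<^sub>M lborel) ({Re l<..<Re u} \<times> {Im l<..<Im u})"
    by (subst emeasure_distr [OF meas]) (auto simp: space_pair_measure)
  also have "\<dots> = ennreal (\<Prod>b\<in>Basis. (u - l) \<bullet> b)"
    using le' by (simp add: lborel.emeasure_pair_measure_Times Basis_complex_def ennreal_mult)
  finally show "emeasure (distr (lborel \<Otimes>\<^sub>M lborel) borel (\<lambda>(x, y). Complex x y)) (box l u)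
      = (\<Prod>b\<in>Basis. (u - l) \<bullet> b)" .
qed simp

text \<open>Both orders are recorded: a horizontal shear is a translation for fixed y, a vertical
  one for fixed x.\<close>

lemma nn_integral_lborel_complex:
  assumes [measurable]: "f \<in> borel_measurable borel"
  shows "(\<integral>\<^sup>+z. f z \<partial>lborel) = (\<integral>\<^sup>+x. \<integral>\<^sup>+y. f (Complex x y) \<partial>lborel \<partial>lborel)"
    and "(\<integral>\<^sup>+z. f z \<partial>lborel) = (\<integral>\<^sup>+y. \<integral>\<^sup>+x. f (Complex x y) \<partial>lborel \<partial>lborel)"
proof -
  have [measurable]: "(\<lambda>(x, y). Complex x y) \<in> borel_measurable (lborel \<Otimes>\<^sub>M lborel)"
    by (simp add: Complex_eq case_prod_beta)
  have m: "(\<lambda>(x, y). f (Complex x y)) \<in> borel_measurable (lborel \<Otimes>\<^sub>M lborel)"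
  proof -
    have "(\<lambda>p. f ((\<lambda>(x, y). Complex x y) p)) \<in> borel_measurable (lborel \<Otimes>\<^sub>M lborel)"
      by measurable
    then show ?thesis by (simp add: case_prod_beta)
  qed
  have "(\<integral>\<^sup>+z. f z \<partial>lborel) = (\<integral>\<^sup>+p. f (Complex (fst p) (snd p)) \<partial>(lborel \<Otimes>\<^sub>M lborel))"
    by (subst lborel_complex_conv_prod, subst nn_integral_distr) (simp_all add: case_prod_beta)
  also have "\<dots> = (\<integral>\<^sup>+x. \<integral>\<^sup>+y. f (Complex x y) \<partial>lborel \<partial>lborel)"
    using lborel.nn_integral_fst [of "\<lambda>(x, y). f (Complex x y)" lborel] m
    by (simp add: case_prod_unfold)
  finally show *: "(\<integral>\<^sup>+z. f z \<partial>lborel) = (\<integral>\<^sup>+x. \<integral>\<^sup>+y. f (Complex x y) \<partial>lborel \<partial>lborel)" .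
  show "(\<integral>\<^sup>+z. f z \<partial>lborel) = (\<integral>\<^sup>+y. \<integral>\<^sup>+x. f (Complex x y) \<partial>lborel \<partial>lborel)"
    unfolding * using lborel_pair.Fubini' [of "\<lambda>x y. f (Complex x y)"] m by simp
qed

lemma nn_integral_lborel_translate:
  assumes [measurable]: "f \<in> borel_measurable borel"
  shows "(\<integral>\<^sup>+x. f (x + c) \<partial>lborel) = (\<integral>\<^sup>+x. f (x::real) \<partial>lborel)"
  using nn_integral_real_affine [of f 1 c] by (simp add: add.commute)

text \<open>On each line parallel to the shear direction the map is a translation of the inner
  variable.\<close>

lemma nn_integral_shear:
  assumes [measurable]: "f \<in> borel_measurable borel"
  shows "(\<integral>\<^sup>+z. f (z + of_real (a * Im z)) \<partial>lborel) = (\<integral>\<^sup>+z. f z \<partial>lborel)"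
    and "(\<integral>\<^sup>+z. f (z + \<i> * of_real (a * Re z)) \<partial>lborel) = (\<integral>\<^sup>+z. f z \<partial>lborel)"
proof -
  have [measurable]: "(\<lambda>x. f (Complex x y)) \<in> borel_measurable borel" for y
    by (simp add: Complex_eq)
  have [measurable]: "(\<lambda>y. f (Complex x y)) \<in> borel_measurable borel" for x
    by (simp add: Complex_eq)
  have 1: "Complex x y + of_real (a * y) = Complex (x + a * y) y"
    "Complex x y + \<i> * of_real (a * x) = Complex x (y + a * x)" for x y
    by (simp_all add: complex_eq_iff)
  show "(\<integral>\<^sup>+z. f (z + of_real (a * Im z)) \<partial>lborel) = (\<integral>\<^sup>+z. f z \<partial>lborel)"
    using nn_integral_lborel_translate [of "\<lambda>x. f (Complex x y)" "a * y" for y]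
    by (simp add: nn_integral_lborel_complex(2) 1 del: of_real_mult)
  show "(\<integral>\<^sup>+z. f (z + \<i> * of_real (a * Re z)) \<partial>lborel) = (\<integral>\<^sup>+z. f z \<partial>lborel)"
    using nn_integral_lborel_translate [of "\<lambda>y. f (Complex x y)" "a * x" for x]
    by (simp add: nn_integral_lborel_complex(1) 1 del: of_real_mult)
qed

text \<open>A rotation by an angle other than \<pi> is a product of three shears, each of which preserves
  Lebesgue measure by Fubini and translation invariance.\<close>

lemma nn_integral_lborel_rotate:
  assumes [measurable]: "f \<in> borel_measurable borel" and c: "cmod c = 1" "c \<noteq> -1"
  shows "(\<integral>\<^sup>+z. f (c * z) \<partial>lborel) = (\<integral>\<^sup>+z. f z \<partial>lborel)"
proof -
  define x y where "x = Re c" and "y = Im c"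
  have xy: "x\<^sup>2 + y\<^sup>2 = 1"
    using c(1) by (simp add: x_def y_def cmod_def)
  have x: "1 + x \<noteq> 0"
  proof
    assume "1 + x = 0"
    with xy have "x = -1" "y = 0" by (auto simp: add_eq_0_iff)
    then show False using c(2) by (simp add: complex_eq_iff x_def y_def)
  qed
  \<comment> \<open>For c = cis \<theta> this is -tan(\<theta>/2), the factor of both horizontal
    shears; the vertical shear has factor sin \<theta>.\<close>
  define a where "a = - y / (1 + x)"
  define S where "S = (\<lambda>z. z + complex_of_real (a * Im z))"
  define T where "T = (\<lambda>z. z + \<i> * complex_of_real (y * Re z))"
  have [measurable]: "S \<in> borel_measurable borel" "T \<in> borel_measurable borel"
    by (simp_all add: S_def T_def)
  have ay: "a * y = x - 1"
    using xy x by (simp add: a_def field_simps power2_eq_square)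
  have "a * (1 + x) = - y"
    using x by (simp add: a_def)
  then have axy: "a + a * x = - y"
    by (simp add: distrib_left)
  have STS: "S (T (S z)) = c * z" for z
  proof (rule complex_eqI)
    have "Re (S (T (S z))) = (1 + a * y) * Re z + (a + (a * y) * a + a) * Im z"
      by (simp add: S_def T_def algebra_simps)
    also have "\<dots> = x * Re z + (a + a * x) * Im z"
      unfolding ay by (simp add: algebra_simps)
    finally show "Re (S (T (S z))) = Re (c * z)"
      unfolding axy by (simp add: x_def y_def)
    have "Im (S (T (S z))) = y * Re z + (1 + a * y) * Im z"
      by (simp add: S_def T_def algebra_simps)
    then show "Im (S (T (S z))) = Im (c * z)"
      unfolding ay by (simp add: x_def y_def)
  qed
  have "(\<integral>\<^sup>+z. f z \<partial>lborel) = (\<integral>\<^sup>+z. f (S z) \<partial>lborel)"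
    unfolding S_def by (rule nn_integral_shear(1) [symmetric]) simp
  also have "\<dots> = (\<integral>\<^sup>+z. f (S (T z)) \<partial>lborel)"
    unfolding T_def by (rule nn_integral_shear(2) [symmetric, of "\<lambda>z. f (S z)"]) simp
  also have "\<dots> = (\<integral>\<^sup>+z. f (S (T (S z))) \<partial>lborel)"
    using nn_integral_shear(1) [of "\<lambda>z. f (S (T z))" a] by (simp add: S_def)
  finally show ?thesis by (simp add: STS)
qed

text \<open>The image of normalized area on the disk under z -> 1 - |z|^2 is Lebesgue measure on
  [0,1]: for x in [0,1) the condition 1 - |z|^2 > x describes a disk of normalized area 1 -
  x.\<close>

lemma nn_integral_disk_radial:
  assumes [measurable]: "u \<in> borel_measurable borel"
  shows "(\<integral>\<^sup>+z. ennreal (indicator (ball 0 1) z / pi) * u (1 - (cmod z)\<^sup>2) \<partial>lborel)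
       = (\<integral>\<^sup>+t. indicator {0..1} t * u t \<partial>lborel)"
proof -
  let ?D = "density lborel (\<lambda>z::complex. ennreal (indicator (ball 0 1) z / pi))"
  let ?\<phi> = "\<lambda>z::complex. 1 - (cmod z)\<^sup>2"
  have [measurable, simp]: "(\<lambda>z. indicator (ball 0 1) z / pi) \<in> borel_measurable (borel :: complex measure)"
    by (intro borel_measurable_divide borel_measurable_indicator) auto
  have eq: "distr ?D borel ?\<phi> = density lborel (indicator {0..1})"
  proof (rule measure_eqI_lessThan)
    fix x :: real
    \<comment> \<open>\<open>max x 0\<close> covers negative x, where the preimage is the whole
      disk. For x >= 1 the radius is not positive, as \<open>sqrt\<close> of a negative real is
      negative, and the ball is empty.\<close>
    have "?\<phi> -` {x<..} \<inter> ball 0 1 = ball 0 (sqrt (1 - max x 0))"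
    proof (cases "x < 1")
      case True
      have "(cmod z)\<^sup>2 < 1 - max x 0 \<longleftrightarrow> cmod z < sqrt (1 - max x 0)" for z
        by (metis norm_ge_zero real_less_lsqrt real_less_rsqrt real_sqrt_less_iff real_sqrt_unique)
      moreover have "cmod z < 1 \<longleftrightarrow> (cmod z)\<^sup>2 < 1" for z
        by (simp add: power_less_one_iff abs_square_less_1)
      ultimately have "z \<in> ?\<phi> -` {x<..} \<inter> ball 0 1 \<longleftrightarrow> cmod z < sqrt (1 - max x 0)" for z
        by (smt (verit) Int_iff greaterThan_iff mem_ball_0 vimage_eq)
      then show ?thesis
        by (intro set_eqI) (simp only: mem_ball_0)
    next
      case False
      then have "sqrt (1 - max x 0) \<le> 0" by simp
      moreover have "\<not> (x < ?\<phi> z)" for z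
        using False by (smt (verit) zero_le_power2)
      ultimately show ?thesis
        by (smt (verit) Int_iff ball_eq_empty empty_iff greaterThan_iff subsetI subset_antisym vimage_eq)
    qed
    then have *: "indicator (?\<phi> -` {x<..}) z * indicator (ball 0 1) z
       = (indicator (ball 0 (sqrt (1 - max x 0))) z :: ennreal)" for z
      by (metis indicator_inter_arith)
    have [measurable]: "?\<phi> -` {x<..} \<in> sets borel"
      by (intro borel_open open_vimage) (auto intro!: continuous_intros)
    have "emeasure (distr ?D borel ?\<phi>) {x<..} = emeasure ?D (?\<phi> -` {x<..})"
      by (subst emeasure_distr) auto
    also have "\<dots> = (\<integral>\<^sup>+z. ennreal (indicator (ball 0 1) z / pi) * indicator (?\<phi> -` {x<..}) z \<partial>lborel)"
      by (rule emeasure_density) simp_all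
    also have "\<dots> = (\<integral>\<^sup>+z. ennreal (1 / pi) * indicator (ball (0::complex) (sqrt (1 - max x 0))) z \<partial>lborel)"
    proof (rule nn_integral_cong)
      fix z :: complex
      show "ennreal (indicator (ball 0 1) z / pi) * indicator (?\<phi> -` {x<..}) z
          = ennreal (1 / pi) * indicator (ball 0 (sqrt (1 - max x 0))) z"
        unfolding * [of z, symmetric] by (simp add: indicator_def)
    qed
    also have "\<dots> = ennreal (1 / pi) * emeasure lborel (ball (0::complex) (sqrt (1 - max x 0)))"
      by (subst nn_integral_cmult_indicator) auto
    also have "\<dots> = ennreal (max 0 (1 - max x 0))"
    proof (cases "x < 1")
      case True
      then show ?thesis
        by (subst emeasure_ball) (auto simp: unit_ball_vol_2 ennreal_mult [symmetric] max_def)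
    next
      case False
      then have empty: "ball (0::complex) (sqrt (1 - max x 0)) = {}" by simp
      show ?thesis unfolding empty using False by (auto simp: max_def ennreal_neg)
    qed
    finally have 1: "emeasure (distr ?D borel ?\<phi>) {x<..} = ennreal (max 0 (1 - max x 0))" .
    then show "emeasure (distr ?D borel ?\<phi>) {x<..} < \<infinity>"
      by simp
    have "emeasure (density lborel (indicator {0..1})) {x<..}
        = emeasure lborel ({0..1} \<inter> {x<..})"
      by (simp add: emeasure_density nn_integral_indicator flip: indicator_inter_arith)
    also have "\<dots> = ennreal (max 0 (1 - max x 0))"
    proof -
      have "{0..1} \<inter> {x<..} = (if x < 0 then {0..1} else if x \<le> 1 then {x<..1} else {})"
        by auto
      then show ?thesis by (auto simp: max_def)
    qed
    finally show "emeasure (distr ?D borel ?\<phi>) {x<..}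
        = emeasure (density lborel (indicator {0..1})) {x<..}"
      using 1 by simp
  qed auto
  have "(\<integral>\<^sup>+z. ennreal (indicator (ball 0 1) z / pi) * u (?\<phi> z) \<partial>lborel) = (\<integral>\<^sup>+t. u t \<partial>distr ?D borel ?\<phi>)"
    by (subst nn_integral_distr, (simp_all)[2], subst nn_integral_density) auto
  also have "\<dots> = (\<integral>\<^sup>+t. indicator {0..1} t * u t \<partial>lborel)"
    unfolding eq by (subst nn_integral_density) auto
  finally show ?thesis .
qed

subsection \<open>Parseval's identity for radial measures\<close>

text \<open>The rotation by -1 is left out because the factorization into shears does not reach it;
  orthogonality uses only angles up to pi/2.\<close>

definition rotation_invariant :: "complex measure \<Rightarrow> bool" where
  "rotation_invariant \<nu> \<longleftrightarrow> sets \<nu> = sets borel \<and>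
     (\<forall>c. cmod c = 1 \<and> c \<noteq> -1 \<longrightarrow> distr \<nu> borel (\<lambda>z. c * z) = \<nu>)"

lemma rotation_invariant_radial:
  assumes [measurable]: "w \<in> borel_measurable borel"
  shows "rotation_invariant (density lborel (\<lambda>z. w (cmod z)))"
  unfolding rotation_invariant_def
proof (intro conjI allI impI)
  fix c assume c: "cmod c = 1 \<and> c \<noteq> -1"
  show "distr (density lborel (\<lambda>z. w (cmod z))) borel (\<lambda>z. c * z) = density lborel (\<lambda>z. w (cmod z))"
  proof (rule measure_eqI)
    fix A assume "A \<in> sets (distr (density lborel (\<lambda>z. w (cmod z))) borel (\<lambda>z. c * z))"
    then have [measurable]: "A \<in> sets borel" by simp
    have [measurable]: "(\<lambda>z. c * z) -` A \<in> sets borel"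
      by (rule measurable_sets_borel [of _ borel]) auto
    have "emeasure (distr (density lborel (\<lambda>z. w (cmod z))) borel (\<lambda>z. c * z)) A
        = (\<integral>\<^sup>+z. w (cmod z) * indicator ((\<lambda>z. c * z) -` A) z \<partial>lborel)"
      by (simp add: emeasure_distr emeasure_density)
    also have "\<dots> = (\<integral>\<^sup>+z. w (cmod (c * z)) * indicator A (c * z) \<partial>lborel)"
      using c by (simp add: norm_mult indicator_def)
    also have "\<dots> = (\<integral>\<^sup>+z. w (cmod z) * indicator A z \<partial>lborel)"
      using c by (intro nn_integral_lborel_rotate [of "\<lambda>z. w (cmod z) * indicator A z"]) auto
    finally show "emeasure (distr (density lborel (\<lambda>z. w (cmod z))) borel (\<lambda>z. c * z)) A
        = emeasure (density lborel (\<lambda>z. w (cmod z))) A"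
      by (simp add: emeasure_density)
  qed simp
qed simp

text \<open>Rotation by t = pi / (2(k - l)) multiplies the integrand by cis((k - l)t), which is the
  imaginary unit. The integral I thus satisfies I = \<i> I and vanishes.\<close>

lemma rotation_invariant_orthogonal:
  assumes \<nu>: "rotation_invariant \<nu>" and "k \<noteq> l"
  shows "(\<integral>z. z ^ k * cnj z ^ l \<partial>\<nu>) = 0"
proof -
  define I where "I = (\<integral>z. z ^ k * cnj z ^ l \<partial>\<nu>)"
  define t where "t = pi / (2 * (real k - real l))"
  have "2 * (real k - real l) \<noteq> 0" using \<open>k \<noteq> l\<close> by simp
  then have "t * (2 * (real k - real l)) = pi"
    by (simp add: t_def)
  then have tkl: "real k * t - real l * t = pi / 2"
    by (simp add: algebra_simps)
  have "\<bar>2 * (real k - real l)\<bar> \<ge> 2" using \<open>k \<noteq> l\<close> by (cases "k < l") auto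
  then have "\<bar>t\<bar> \<le> pi / 2"
    unfolding t_def abs_divide using pi_gt_zero by (intro frac_le) auto
  then have "Re (cis t) \<ge> 0"
    by (auto intro: cos_ge_zero)
  then have ne: "cis t \<noteq> -1"
    by (metis Re_complex_of_real not_one_le_zero le_minus_one_simps(3) of_real_1 of_real_minus)
  have [measurable_cong]: "sets \<nu> = sets borel" and dist: "distr \<nu> borel (\<lambda>z. cis t * z) = \<nu>"
    using \<nu> ne by (auto simp: rotation_invariant_def)
  have [measurable]: "cnj \<in> borel_measurable borel"
    by (intro borel_measurable_continuous_onI continuous_intros)
  have "I = (\<integral>z. z ^ k * cnj z ^ l \<partial>distr \<nu> borel (\<lambda>z. cis t * z))"
    by (simp add: dist I_def)
  also have "\<dots> = (\<integral>z. (cis t * z) ^ k * cnj (cis t * z) ^ l \<partial>\<nu>)"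
    by (subst integral_distr) auto
  also have "\<dots> = (\<integral>z. (cis t ^ k * cnj (cis t) ^ l) * (z ^ k * cnj z ^ l) \<partial>\<nu>)"
    by (simp add: power_mult_distrib mult_ac)
  also have "cis t ^ k * cnj (cis t) ^ l = \<i>"
    unfolding cis_cnj Complex.DeMoivre cis_mult by (simp add: tkl)
  finally have "I = \<i> * I" by (simp add: I_def)
  then have "(1 - \<i>) * I = 0" by (simp add: algebra_simps)
  moreover have "1 - \<i> \<noteq> 0" by (simp add: complex_eq_iff)
  ultimately show ?thesis by (simp add: I_def)
qed

lemma integrable_bounded_disk:
  fixes u :: "complex \<Rightarrow> 'b :: {banach, second_countable_topology}"
  assumes "finite_measure \<nu>" "AE z in \<nu>. norm (u z) \<le> B" "u \<in> borel_measurable \<nu>"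
  shows "integrable \<nu> u"
  using assms by (intro finite_measure.integrable_const_bound)

text \<open>After expanding the square, the mixed terms drop out by orthogonality.\<close>

lemma parseval_polynomial:
  assumes \<nu>: "rotation_invariant \<nu>" "finite_measure \<nu>" "AE z in \<nu>. cmod z \<le> 1"
  shows "(\<integral>z. (cmod (\<Sum>k<n. a k * z ^ k))\<^sup>2 \<partial>\<nu>) = (\<Sum>k<n. (cmod (a k))\<^sup>2 * (\<integral>z. cmod z ^ (2 * k) \<partial>\<nu>))"
proof -
  have [measurable_cong]: "sets \<nu> = sets borel"
    using \<nu> by (auto simp: rotation_invariant_def)
  have [measurable]: "cnj \<in> borel_measurable borel"
    by (intro borel_measurable_continuous_onI continuous_intros)
  have int: "integrable \<nu> (\<lambda>z. z ^ k * cnj z ^ l)" for k l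
    by (rule integrable_bounded_disk [OF \<nu>(2), where B = 1])
      (use \<nu>(3) in \<open>auto elim!: eventually_mono simp: norm_mult norm_power intro!: mult_le_one power_le_one\<close>)
  have "complex_of_real (\<integral>z. (cmod (\<Sum>k<n. a k * z ^ k))\<^sup>2 \<partial>\<nu>)
      = (\<integral>z. complex_of_real ((cmod (\<Sum>k<n. a k * z ^ k))\<^sup>2) \<partial>\<nu>)"
    by (rule integral_complex_of_real [symmetric])
  also have "\<dots> = (\<integral>z. (\<Sum>k<n. \<Sum>l<n. (a k * cnj (a l)) * (z ^ k * cnj z ^ l)) \<partial>\<nu>)"
    by (intro Bochner_Integration.integral_cong)
      (simp_all only: complex_norm_square cnj_sum complex_cnj_mult complex_cnj_power sum_product mult_ac)
  also have "\<dots> = (\<Sum>k<n. \<Sum>l<n. (a k * cnj (a l)) * (\<integral>z. z ^ k * cnj z ^ l \<partial>\<nu>))"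
    using int by (simp add: Bochner_Integration.integral_sum Bochner_Integration.integrable_sum)
  also have "\<dots> = (\<Sum>k<n. \<Sum>l<n. if l = k then (a k * cnj (a k)) * (\<integral>z. z ^ k * cnj z ^ k \<partial>\<nu>) else 0)"
    using rotation_invariant_orthogonal [OF \<nu>(1)] by (intro sum.cong) auto
  also have "\<dots> = (\<Sum>k<n. (a k * cnj (a k)) * (\<integral>z. z ^ k * cnj z ^ k \<partial>\<nu>))"
    by (simp add: sum.delta)
  also have "\<dots> = (\<Sum>k<n. complex_of_real ((cmod (a k))\<^sup>2 * (\<integral>z. cmod z ^ (2 * k) \<partial>\<nu>)))"
  proof (rule sum.cong)
    fix k
    have "z ^ k * cnj z ^ k = complex_of_real (cmod z ^ (2 * k))" for z
      using complex_norm_square [of "z ^ k"]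
      by (simp add: norm_power mult.commute [of 2] power_mult)
    then have "(\<integral>z. z ^ k * cnj z ^ k \<partial>\<nu>) = complex_of_real (\<integral>z. cmod z ^ (2 * k) \<partial>\<nu>)"
      by (simp del: of_real_power)
    then show "a k * cnj (a k) * (\<integral>z. z ^ k * cnj z ^ k \<partial>\<nu>)
        = complex_of_real ((cmod (a k))\<^sup>2 * (\<integral>z. cmod z ^ (2 * k) \<partial>\<nu>))"
      using complex_norm_square [of "a k"] by simp
  qed simp
  also have "\<dots> = complex_of_real (\<Sum>k<n. (cmod (a k))\<^sup>2 * (\<integral>z. cmod z ^ (2 * k) \<partial>\<nu>))"
    by simp
  finally show ?thesis by (simp only: of_real_eq_iff)
qed

text \<open>On a disk of radius r < 1 the partial sums are bounded uniformly, so dominated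
  convergence carries the polynomial identity to F.\<close>

lemma parseval_compact_disk:
  assumes \<nu>: "rotation_invariant \<nu>" "finite_measure \<nu>" "AE z in \<nu>. cmod z \<le> r" and r: "0 \<le> r" "r < 1"
    and [measurable]: "F \<in> borel_measurable borel"
    and F: "\<And>z. cmod z < 1 \<Longrightarrow> (\<lambda>k. a k * z ^ k) sums F z"
  shows "(\<integral>\<^sup>+z. ennreal ((cmod (F z))\<^sup>2) \<partial>\<nu>) = (\<Sum>k. \<integral>\<^sup>+z. ennreal ((cmod (a k))\<^sup>2 * cmod z ^ (2 * k)) \<partial>\<nu>)"
proof -
  have [measurable_cong]: "sets \<nu> = sets borel"
    using \<nu> by (auto simp: rotation_invariant_def)
  have summ: "summable (\<lambda>k. cmod (a k) * r ^ k)"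
  proof -
    \<comment> \<open>Convergence at a point strictly between r and 1 yields absolute convergence at
      r.\<close>
    have "cmod (of_real ((1 + r) / 2)) < 1"
      unfolding norm_of_real using r by simp
    then have "summable (\<lambda>k. a k * of_real ((1 + r) / 2) ^ k)"
      using F sums_summable by blast
    then have "summable (\<lambda>k. norm (a k * of_real r ^ k))"
      by (rule powser_insidea, unfold norm_of_real) (use r in auto)
    then show ?thesis using r by (simp add: norm_mult norm_power)
  qed
  define B where "B = (\<Sum>k. cmod (a k) * r ^ k)"
  have bnd: "cmod (\<Sum>k<n. a k * z ^ k) \<le> B" if "cmod z \<le> r" for z n
  proof -
    have "cmod (\<Sum>k<n. a k * z ^ k) \<le> (\<Sum>k<n. cmod (a k) * r ^ k)"
      using that by (intro sum_norm_le) (auto simp: norm_mult norm_power intro!: mult_left_mono power_mono)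
    also have "\<dots> \<le> B"
      unfolding B_def using r by (intro sum_le_suminf summ) auto
    finally show ?thesis .
  qed
  have ae1: "AE z in \<nu>. cmod z \<le> 1"
    using \<nu>(3) r by (auto elim!: eventually_mono)
  have "(\<lambda>n. \<integral>z. (cmod (\<Sum>k<n. a k * z ^ k))\<^sup>2 \<partial>\<nu>) \<longlonglongrightarrow> (\<integral>z. (cmod (F z))\<^sup>2 \<partial>\<nu>)"
  proof (rule integral_dominated_convergence [where w = "\<lambda>_. B\<^sup>2"])
    show "integrable \<nu> (\<lambda>_. B\<^sup>2)"
      by (rule integrable_bounded_disk [OF \<nu>(2), where B = "B\<^sup>2"]) auto
    show "AE z in \<nu>. (\<lambda>n. (cmod (\<Sum>k<n. a k * z ^ k))\<^sup>2) \<longlonglongrightarrow> (cmod (F z))\<^sup>2"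
      using \<nu>(3)
    proof eventually_elim
      case (elim z)
      then have "(\<lambda>n. \<Sum>k<n. a k * z ^ k) \<longlonglongrightarrow> F z"
        using F r by (simp add: sums_def)
      then show ?case by (intro tendsto_intros)
    qed
    show "AE z in \<nu>. norm ((cmod (\<Sum>k<n. a k * z ^ k))\<^sup>2) \<le> B\<^sup>2" for n
      using \<nu>(3) by eventually_elim (use bnd in \<open>auto intro!: power_mono\<close>)
  qed auto
  then have sums: "(\<lambda>k. (cmod (a k))\<^sup>2 * (\<integral>z. cmod z ^ (2 * k) \<partial>\<nu>)) sums (\<integral>z. (cmod (F z))\<^sup>2 \<partial>\<nu>)"
    by (simp add: parseval_polynomial [OF \<nu>(1,2) ae1] sums_def)
  have "integrable \<nu> (\<lambda>z. (cmod (F z))\<^sup>2)"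
  proof (rule integrable_bounded_disk [OF \<nu>(2)])
    show "AE z in \<nu>. norm ((cmod (F z))\<^sup>2) \<le> B\<^sup>2"
      using \<nu>(3)
    proof eventually_elim
      case (elim z)
      then have "(\<lambda>n. \<Sum>k<n. a k * z ^ k) \<longlonglongrightarrow> F z"
        using F r by (simp add: sums_def)
      then have "cmod (F z) \<le> B"
        by (rule Lim_norm_ubound [rotated, OF _ always_eventually]) (use bnd elim in auto)
      then show ?case by (auto intro!: power_mono)
    qed
  qed simp
  then have "(\<integral>\<^sup>+z. ennreal ((cmod (F z))\<^sup>2) \<partial>\<nu>) = ennreal (\<integral>z. (cmod (F z))\<^sup>2 \<partial>\<nu>)"
    by (rule nn_integral_eq_integral) auto
  also have "\<dots> = (\<Sum>k. ennreal ((cmod (a k))\<^sup>2 * (\<integral>z. cmod z ^ (2 * k) \<partial>\<nu>)))"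
    using sums by (intro suminf_ennreal_eq [symmetric]) auto
  also have "\<dots> = (\<Sum>k. \<integral>\<^sup>+z. ennreal ((cmod (a k))\<^sup>2 * cmod z ^ (2 * k)) \<partial>\<nu>)"
  proof (rule suminf_cong)
    fix k
    have "integrable \<nu> (\<lambda>z. cmod z ^ (2 * k))"
      by (rule integrable_bounded_disk [OF \<nu>(2), where B = 1])
        (use ae1 in \<open>auto elim!: eventually_mono intro!: power_le_one\<close>)
    then show "ennreal ((cmod (a k))\<^sup>2 * (\<integral>z. cmod z ^ (2 * k) \<partial>\<nu>))
        = (\<integral>\<^sup>+z. ennreal ((cmod (a k))\<^sup>2 * cmod z ^ (2 * k)) \<partial>\<nu>)"
      by (subst nn_integral_eq_integral) (auto intro!: integrable_mult_right)
  qed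
  finally show ?thesis .
qed

text \<open>Monotone convergence along an increasing sequence of closed disks. The factor v stays
  separate so that the same statement serves both sides of Parseval's identity.\<close>

lemma nn_integral_exhaust_disk:
  fixes v w :: "complex \<Rightarrow> ennreal"
  assumes [measurable]: "w \<in> borel_measurable borel" "v \<in> borel_measurable borel"
  shows "(\<integral>\<^sup>+z. v z * (indicator (ball 0 1) z * w z) \<partial>lborel)
    = (SUP n. \<integral>\<^sup>+z. v z * (indicator (cball 0 (1 - 1 / real (Suc n))) z * w z) \<partial>lborel)"
    (is "_ = (SUP n. \<integral>\<^sup>+z. ?f n z \<partial>lborel)")
proof -
  have mono: "incseq (\<lambda>n. indicator (cball 0 (1 - 1 / real (Suc n))) z :: ennreal)" for z :: complex
  proof (rule incseq_SucI)
    fix n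
    have "1 - 1 / real (Suc n) \<le> 1 - 1 / real (Suc (Suc n))"
      by (simp add: frac_le)
    then show "indicator (cball 0 (1 - 1 / real (Suc n))) z
        \<le> (indicator (cball 0 (1 - 1 / real (Suc (Suc n)))) z :: ennreal)"
      by (auto simp: indicator_def simp del: of_nat_Suc)
  qed
  have sup: "(SUP n. indicator (cball 0 (1 - 1 / real (Suc n))) z) = (indicator (ball 0 1) z :: ennreal)" for z :: complex
  proof (cases "cmod z < 1")
    case True
    then obtain n where n: "1 / real (Suc n) < 1 - cmod z"
      by (metis diff_gt_0_iff_gt inverse_eq_divide reals_Archimedean)
    have "(SUP n. indicator (cball 0 (1 - 1 / real (Suc n))) z) = (1 :: ennreal)"
    proof (rule antisym)
      show "(SUP n. indicator (cball 0 (1 - 1 / real (Suc n))) z) \<le> (1 :: ennreal)"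
        by (intro SUP_least) (auto simp: indicator_def)
      show "(1 :: ennreal) \<le> (SUP n. indicator (cball 0 (1 - 1 / real (Suc n))) z)"
        by (rule SUP_upper2 [of n]) (use n in auto)
    qed
    then show ?thesis using True by simp
  next
    case False
    have "1 / real (Suc n) > 0" for n by simp
    then have "indicator (cball 0 (1 - 1 / real (Suc n))) z = (0 :: ennreal)" for n
      using False by (smt (verit) indicator_simps(2) mem_cball_0)
    then show ?thesis using False by simp
  qed
  have "(\<integral>\<^sup>+z. v z * (indicator (ball 0 1) z * w z) \<partial>lborel) = (\<integral>\<^sup>+z. (SUP n. ?f n z) \<partial>lborel)"
    by (simp add: SUP_mult_left_ennreal [symmetric] SUP_mult_right_ennreal [symmetric] sup del: of_nat_Suc)
  also have "\<dots> = (SUP n. \<integral>\<^sup>+z. ?f n z \<partial>lborel)"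
  proof (rule nn_integral_monotone_convergence_SUP)
    show "incseq ?f"
      using mono by (auto simp: incseq_def le_fun_def intro!: mult_left_mono mult_right_mono)
    show "?f n \<in> borel_measurable lborel" for n
      by (intro borel_measurable_times_ennreal borel_measurable_indicator) auto
  qed
  finally show ?thesis .
qed

text \<open>The identity holds on each smaller closed disk and passes to the supremum. With
  \<open>ennreal\<close> integrals both sides may be infinite, which later makes finiteness of the
  norm equivalent to summability.\<close>

lemma parseval_disk:
  fixes w :: "real \<Rightarrow> ennreal"
  assumes [measurable]: "w \<in> borel_measurable borel" "F \<in> borel_measurable borel"
    and fin: "(\<integral>\<^sup>+z. indicator (ball (0::complex) 1) z * w (cmod z) \<partial>lborel) < \<infinity>"
    and F: "\<And>z. cmod z < 1 \<Longrightarrow> (\<lambda>k. a k * z ^ k) sums F z"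
  shows "(\<integral>\<^sup>+z. ennreal ((cmod (F z))\<^sup>2) * (indicator (ball 0 1) z * w (cmod z)) \<partial>lborel)
    = (\<Sum>k. \<integral>\<^sup>+z. ennreal ((cmod (a k))\<^sup>2 * cmod z ^ (2 * k)) * (indicator (ball 0 1) z * w (cmod z)) \<partial>lborel)"
proof -
  have eq: "(\<integral>\<^sup>+z. ennreal ((cmod (F z))\<^sup>2) * (indicator (cball 0 r) z * w (cmod z)) \<partial>lborel)
    = (\<integral>\<^sup>+z. (\<Sum>k. ennreal ((cmod (a k))\<^sup>2 * cmod z ^ (2 * k))) * (indicator (cball 0 r) z * w (cmod z)) \<partial>lborel)"
    if r: "0 \<le> r" "r < 1" for r
  proof -
    \<comment> \<open>This form shows the density as a function of \<open>cmod z\<close>, as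
      \<open>rotation_invariant_radial\<close> requires; the next fact restates it with
      \<open>cball\<close>, the form used in the exhaustion.\<close>
    define \<nu> where "\<nu> = density lborel (\<lambda>z::complex. indicator {..r} (cmod z) * w (cmod z))"
    have \<nu>: "\<nu> = density lborel (\<lambda>z. indicator (cball 0 r) z * w (cmod z))"
      unfolding \<nu>_def by (intro density_cong) (auto simp: indicator_def)
    have [simp, measurable]: "(\<lambda>z. indicator (cball 0 r) z * w (cmod z)) \<in> borel_measurable borel"
      by (intro borel_measurable_times_ennreal borel_measurable_indicator) auto
    have "rotation_invariant \<nu>"
      unfolding \<nu>_def by (rule rotation_invariant_radial [of "\<lambda>x. indicator {..r} x * w x"]) simp
    moreover have "finite_measure \<nu>"
    proof
      have "emeasure \<nu> (space \<nu>) = (\<integral>\<^sup>+z. indicator (cball 0 r) z * w (cmod z) \<partial>lborel)"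
        by (simp add: \<nu> emeasure_density)
      also have "\<dots> \<le> (\<integral>\<^sup>+z. indicator (ball 0 1) z * w (cmod z) \<partial>lborel)"
        using r by (intro nn_integral_mono mult_right_mono) (auto simp: indicator_def)
      finally show "emeasure \<nu> (space \<nu>) \<noteq> \<infinity>" using fin by auto
    qed
    moreover have "AE z in \<nu>. cmod z \<le> r"
      unfolding \<nu> by (subst AE_density) (auto simp: indicator_def)
    ultimately have "(\<integral>\<^sup>+z. ennreal ((cmod (F z))\<^sup>2) \<partial>\<nu>) = (\<Sum>k. \<integral>\<^sup>+z. ennreal ((cmod (a k))\<^sup>2 * cmod z ^ (2 * k)) \<partial>\<nu>)"
      using r F by (intro parseval_compact_disk [where r = r]) auto
    also have "\<dots> = (\<integral>\<^sup>+z. (\<Sum>k. ennreal ((cmod (a k))\<^sup>2 * cmod z ^ (2 * k))) \<partial>\<nu>)"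
      by (rule nn_integral_suminf [symmetric]) (simp add: \<nu>_def)
    finally show ?thesis
      unfolding \<nu> by (subst (asm) (1 2) nn_integral_density) (simp, simp, simp, simp only: mult.commute)
  qed
  have "(\<integral>\<^sup>+z. ennreal ((cmod (F z))\<^sup>2) * (indicator (ball 0 1) z * w (cmod z)) \<partial>lborel)
    = (\<integral>\<^sup>+z. (\<Sum>k. ennreal ((cmod (a k))\<^sup>2 * cmod z ^ (2 * k))) * (indicator (ball 0 1) z * w (cmod z)) \<partial>lborel)"
  proof -
    have m1: "(\<lambda>z::complex. w (cmod z)) \<in> borel_measurable borel"
      and m2: "(\<lambda>z. ennreal ((cmod (F z))\<^sup>2)) \<in> borel_measurable borel"
      and m3: "(\<lambda>z::complex. \<Sum>k. ennreal ((cmod (a k))\<^sup>2 * cmod z ^ (2 * k))) \<in> borel_measurable borel"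
      by measurable
    have "(SUP n. \<integral>\<^sup>+z. ennreal ((cmod (F z))\<^sup>2) * (indicator (cball 0 (1 - 1 / real (Suc n))) z * w (cmod z)) \<partial>lborel)
      = (SUP n. \<integral>\<^sup>+z. (\<Sum>k. ennreal ((cmod (a k))\<^sup>2 * cmod z ^ (2 * k))) * (indicator (cball 0 (1 - 1 / real (Suc n))) z * w (cmod z)) \<partial>lborel)"
      by (intro SUP_cong eq) auto
    then show ?thesis
      by (simp only: nn_integral_exhaust_disk [OF m1 m2] nn_integral_exhaust_disk [OF m1 m3])
  qed
  also have "\<dots> = (\<integral>\<^sup>+z. (\<Sum>k. ennreal ((cmod (a k))\<^sup>2 * cmod z ^ (2 * k)) * (indicator (ball 0 1) z * w (cmod z))) \<partial>lborel)"
    by simp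
  also have "\<dots> = (\<Sum>k. \<integral>\<^sup>+z. ennreal ((cmod (a k))\<^sup>2 * cmod z ^ (2 * k)) * (indicator (ball 0 1) z * w (cmod z)) \<partial>lborel)"
    by (intro nn_integral_suminf borel_measurable_times_ennreal borel_measurable_indicator) auto
  finally show ?thesis .
qed

subsection \<open>The Bergman norm and Taylor coefficients\<close>

locale bergman_weight =
  fixes g :: "real \<Rightarrow> real"
  assumes g_int: "set_integrable lebesgue {0..1} g"
    and g_pos: "\<And>t. t \<in> {0<..1} \<Longrightarrow> g t > 0"
    and g_div: "set_integrable lebesgue {0..1} (\<lambda>s. g s / s)"
begin

text \<open>This is the integral of |z|^(2k) g(1 - |z|^2) over the disk against normalized area,
  after the substitution t = 1 - |z|^2.\<close>

definition moment :: "nat \<Rightarrow> real" where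
  "moment k = (LINT t:{0..1}|lebesgue. (1 - t) ^ k * g t)"

text \<open>Positivity is assumed on (0,1] only; the point 0 is a null set.\<close>

lemma AE_unit_pos: "AE t in lebesgue. t \<in> {0..1} \<longrightarrow> g t > 0"
proof -
  have "AE t in lebesgue. t \<noteq> (0::real)"
    by (intro AE_I [where N = "{0}"]) auto
  then show ?thesis
    by eventually_elim (use g_pos in auto)
qed

lemma moment_integrable: "set_integrable lebesgue {0..1} (\<lambda>t. (1 - t) ^ k * g t)"
proof (rule set_integrable_bound [OF g_int])
  have [measurable]: "(\<lambda>t. indicator {0..1} t *\<^sub>R g t) \<in> borel_measurable lebesgue"
    using g_int by (auto simp: set_integrable_def)
  have "(\<lambda>t::real. (1 - t) ^ k) \<in> borel_measurable lebesgue"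
    by (intro measurable_completion) simp
  then have "(\<lambda>t. (1 - t) ^ k * (indicator {0..1} t *\<^sub>R g t)) \<in> borel_measurable lebesgue"
    by measurable
  then show "set_borel_measurable lebesgue {0..1} (\<lambda>t. (1 - t) ^ k * g t)"
    by (simp add: set_borel_measurable_def mult_ac)
  show "AE t in lebesgue. t \<in> {0..1} \<longrightarrow> norm ((1 - t) ^ k * g t) \<le> norm (g t)"
    by (intro AE_I2) (auto simp: abs_mult intro!: mult_left_le_one_le power_le_one)
qed

lemma moment_nonneg: "moment k \<ge> 0"
  unfolding moment_def set_lebesgue_integral_def
  by (intro integral_nonneg_AE, use AE_unit_pos in eventually_elim) (auto simp: indicator_def less_imp_le)

text \<open>Parseval's identity for the radial density g(1 - |z|^2)/pi. As g is only Lebesgue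
  measurable, a Borel function h that agrees with it off a Borel null set N takes its place.\<close>

lemma bergman_integral_series:
  assumes f: "\<And>z. cmod z < 1 \<Longrightarrow> (\<lambda>k. a k * z ^ k) sums f z" and cont: "continuous_on (ball 0 1) f"
  shows "(\<lambda>z. indicator (ball 0 1) z *\<^sub>R ((cmod (f z))\<^sup>2 * g (1 - (cmod z)\<^sup>2))) \<in> borel_measurable m2"
    and "(\<integral>\<^sup>+z. ennreal (indicator (ball 0 1) z *\<^sub>R ((cmod (f z))\<^sup>2 * g (1 - (cmod z)\<^sup>2))) \<partial>m2)
      = (\<Sum>k. ennreal ((cmod (a k))\<^sup>2 * moment k))"
proof -
  have "(\<lambda>t. indicator {0..1} t *\<^sub>R g t) \<in> borel_measurable lebesgue"
    using g_int by (auto simp: set_integrable_def)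
  then obtain h where [measurable]: "h \<in> borel_measurable lborel" and "AE t in lborel. indicator {0..1} t *\<^sub>R g t = h t"
    using completion_ex_borel_measurable_real by blast
  then obtain N where "{t \<in> space lborel. indicator {0..1} t *\<^sub>R g t \<noteq> h t} \<subseteq> N" "N \<in> sets lborel" and N0: "emeasure lborel N = 0"
    by (auto elim: AE_E)
  then have N: "\<And>t. t \<notin> N \<Longrightarrow> indicator {0..1} t *\<^sub>R g t = h t" and [measurable]: "N \<in> sets borel"
    by auto
  have h: "g t = h t" if "t \<notin> N" "t \<in> {0..1}" for t
    using N [OF that(1)] that(2) by simp
  have AE_h: "AE t in lborel. t \<in> {0..1} \<longrightarrow> g t = h t"
    by (intro AE_I [where N = N]) (use h N0 in auto)
  have [measurable]: "(\<lambda>z. indicator (ball 0 1) z / pi :: real) \<in> borel_measurable (borel :: complex measure)"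
    by (intro borel_measurable_divide borel_measurable_indicator) auto
  \<comment> \<open>The preimage of N under z -> 1 - |z|^2 is null in the disk, so g may be
    exchanged for h inside area integrals too.\<close>
  have "(\<integral>\<^sup>+z. ennreal (indicator (ball (0::complex) 1) z / pi) * indicator N (1 - (cmod z)\<^sup>2) \<partial>lborel)
       = (\<integral>\<^sup>+t. indicator {0..1} t * indicator N t \<partial>lborel)"
    by (rule nn_integral_disk_radial) simp
  also have "\<dots> \<le> (\<integral>\<^sup>+t. indicator N t \<partial>lborel)"
    by (intro nn_integral_mono) (auto simp: indicator_def)
  also have "\<dots> = 0" using N0 by simp
  finally have "(\<integral>\<^sup>+z. ennreal (indicator (ball (0::complex) 1) z / pi) * indicator N (1 - (cmod z)\<^sup>2) \<partial>lborel) = 0"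
    by simp
  then have "AE z in lborel. ennreal (indicator (ball (0::complex) 1) z / pi) * indicator N (1 - (cmod z)\<^sup>2) = 0"
    by (subst (asm) nn_integral_0_iff_AE) auto
  then have "AE z in lborel. cmod z < 1 \<longrightarrow> 1 - (cmod z)\<^sup>2 \<notin> N"
    by eventually_elim (auto simp: indicator_def split: if_splits)
  then have AE_hz: "AE z in lborel. cmod z < 1 \<longrightarrow> g (1 - (cmod z)\<^sup>2) = h (1 - (cmod z)\<^sup>2)"
    by eventually_elim (auto intro!: h simp: power_le_one)
  define F where "F z = indicator (ball 0 1) z *\<^sub>R f z" for z
  have [measurable]: "F \<in> borel_measurable borel"
    unfolding F_def by (rule borel_measurable_continuous_on_indicator) (use cont in auto)
  define w where "w x = ennreal (1 / pi) * ennreal (h (1 - x\<^sup>2))" for x :: real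
  have [measurable]: "w \<in> borel_measurable borel"
    unfolding w_def by measurable
  let ?G = "\<lambda>z. indicator (ball 0 1) z *\<^sub>R ((cmod (f z))\<^sup>2 * g (1 - (cmod z)\<^sup>2))"
  let ?H = "\<lambda>z. (cmod (F z))\<^sup>2 * h (1 - (cmod z)\<^sup>2)"
  have GH: "AE z in lebesgue. ?G z = ?H z"
    by (intro AE_completion, use AE_hz in eventually_elim) (auto simp: F_def indicator_def)
  have H: "?H \<in> borel_measurable lebesgue"
    by (intro measurable_completion) simp
  have G: "?G \<in> borel_measurable lebesgue"
    by (rule borel_measurable_AE [OF H]) (use GH in \<open>auto elim!: eventually_mono\<close>)
  then show "?G \<in> borel_measurable m2"
    by (simp add: m2_def)
  \<comment> \<open>In t = 1 - |z|^2 the factor |z|^(2k) becomes (1 - t)^k. The case c = 1, k = 0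
    also supplies the finite total mass for \<open>parseval_disk\<close>.\<close>
  have mom: "(\<integral>\<^sup>+z. ennreal ((cmod c)\<^sup>2 * cmod z ^ (2 * k)) * (indicator (ball 0 1) z * w (cmod z)) \<partial>lborel)
     = ennreal ((cmod c)\<^sup>2 * moment k)" for c k
  proof -
    have "(\<integral>\<^sup>+z. ennreal ((cmod c)\<^sup>2 * cmod z ^ (2 * k)) * (indicator (ball 0 1) z * w (cmod z)) \<partial>lborel)
       = (\<integral>\<^sup>+z. ennreal (indicator (ball (0::complex) 1) z / pi) * ennreal ((cmod c)\<^sup>2 * (1 - (1 - (cmod z)\<^sup>2)) ^ k * h (1 - (cmod z)\<^sup>2)) \<partial>lborel)"
    proof (rule nn_integral_cong)
      fix z :: complex
      show "ennreal ((cmod c)\<^sup>2 * cmod z ^ (2 * k)) * (indicator (ball 0 1) z * w (cmod z))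
       = ennreal (indicator (ball (0::complex) 1) z / pi) * ennreal ((cmod c)\<^sup>2 * (1 - (1 - (cmod z)\<^sup>2)) ^ k * h (1 - (cmod z)\<^sup>2))"
        by (cases "cmod z < 1") (simp_all add: w_def ennreal_mult' mult_ac flip: power_mult)
    qed
    also have "\<dots> = (\<integral>\<^sup>+t. indicator {0..1} t * ennreal ((cmod c)\<^sup>2 * (1 - t) ^ k * h t) \<partial>lborel)"
      by (rule nn_integral_disk_radial) simp
    also have "\<dots> = (\<integral>\<^sup>+t. ennreal ((cmod c)\<^sup>2 * (indicator {0..1} t *\<^sub>R ((1 - t) ^ k * g t))) \<partial>lborel)"
      by (intro nn_integral_cong_AE, use AE_h in eventually_elim) (auto simp: indicator_def mult_ac)
    also have "\<dots> = (\<integral>\<^sup>+t. ennreal ((cmod c)\<^sup>2 * (indicator {0..1} t *\<^sub>R ((1 - t) ^ k * g t))) \<partial>lebesgue)"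
      by (rule nn_integral_completion [symmetric])
    also have "\<dots> = ennreal (\<integral>t. (cmod c)\<^sup>2 * (indicator {0..1} t *\<^sub>R ((1 - t) ^ k * g t)) \<partial>lebesgue)"
    proof (rule nn_integral_eq_integral)
      show "integrable lebesgue (\<lambda>t. (cmod c)\<^sup>2 * (indicator {0..1} t *\<^sub>R ((1 - t) ^ k * g t)))"
        using moment_integrable [of k] by (simp add: set_integrable_def)
      show "AE t in lebesgue. 0 \<le> (cmod c)\<^sup>2 * (indicator {0..1} t *\<^sub>R ((1 - t) ^ k * g t))"
        using AE_unit_pos by eventually_elim (auto simp: indicator_def less_imp_le)
    qed
    also have "\<dots> = ennreal ((cmod c)\<^sup>2 * moment k)"
      by (simp add: moment_def set_lebesgue_integral_def)
    finally show ?thesis .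
  qed
  have "(\<integral>\<^sup>+z. ennreal (?G z) \<partial>m2) = (\<integral>\<^sup>+z. ennreal (1 / pi) * ennreal (?G z) \<partial>lebesgue)"
    unfolding m2_def by (rule nn_integral_density) (use G in auto)
  also have "\<dots> = (\<integral>\<^sup>+z. ennreal (1 / pi) * ennreal (?G z) \<partial>lborel)"
    by (rule nn_integral_completion)
  also have "\<dots> = (\<integral>\<^sup>+z. ennreal ((cmod (F z))\<^sup>2) * (indicator (ball 0 1) z * w (cmod z)) \<partial>lborel)"
    by (intro nn_integral_cong_AE, use AE_hz in eventually_elim)
      (auto simp: F_def w_def indicator_def ennreal_mult' mult_ac)
  also have "\<dots> = (\<Sum>k. \<integral>\<^sup>+z. ennreal ((cmod (a k))\<^sup>2 * cmod z ^ (2 * k)) * (indicator (ball 0 1) z * w (cmod z)) \<partial>lborel)"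
  proof (rule parseval_disk)
    show "(\<integral>\<^sup>+z. indicator (ball (0::complex) 1) z * w (cmod z) \<partial>lborel) < \<infinity>"
      using mom [of 1 0] by simp
    show "(\<lambda>k. a k * z ^ k) sums F z" if "cmod z < 1" for z
      using f [OF that] that by (simp add: F_def)
  qed simp_all
  also have "\<dots> = (\<Sum>k. ennreal ((cmod (a k))\<^sup>2 * moment k))"
    by (simp only: mom)
  finally show "(\<integral>\<^sup>+z. ennreal (?G z) \<partial>m2) = (\<Sum>k. ennreal ((cmod (a k))\<^sup>2 * moment k))" .
qed

text \<open>From here on, membership in the space and the norm are read off Taylor
  coefficients.\<close>

lemma bergman_norm_series:
  assumes f: "\<And>z. cmod z < 1 \<Longrightarrow> (\<lambda>k. a k * z ^ k) sums f z" and cont: "continuous_on (ball 0 1) f"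
  shows "set_integrable m2 (ball 0 1) (\<lambda>z. (cmod (f z))\<^sup>2 * g (1 - (cmod z)\<^sup>2)) \<longleftrightarrow> summable (\<lambda>k. (cmod (a k))\<^sup>2 * moment k)"
    and "summable (\<lambda>k. (cmod (a k))\<^sup>2 * moment k) \<Longrightarrow> bergman_norm g f = sqrt (kappa g * (\<Sum>k. (cmod (a k))\<^sup>2 * moment k))"
proof -
  let ?G = "\<lambda>z. indicator (ball 0 1) z *\<^sub>R ((cmod (f z))\<^sup>2 * g (1 - (cmod z)\<^sup>2))"
  note ser = bergman_integral_series [OF f cont]
  have nn: "?G z \<ge> 0" for z
    using weight_pos [OF g_int g_pos, of z] by (cases "z \<in> ball 0 1") (auto simp: less_imp_le)
  have Wn: "0 \<le> (cmod (a k))\<^sup>2 * moment k" for k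
    using moment_nonneg by simp
  have "integrable m2 ?G \<longleftrightarrow> (\<integral>\<^sup>+z. ennreal (?G z) \<partial>m2) < \<infinity>"
    using ser(1) nn by (simp add: integrable_iff_bounded)
  also have "\<dots> \<longleftrightarrow> summable (\<lambda>k. (cmod (a k))\<^sup>2 * moment k)"
  proof
    show "summable (\<lambda>k. (cmod (a k))\<^sup>2 * moment k)" if "(\<integral>\<^sup>+z. ennreal (?G z) \<partial>m2) < \<infinity>"
      by (rule summable_suminf_not_top [OF Wn]) (use that ser(2) in auto)
    show "(\<integral>\<^sup>+z. ennreal (?G z) \<partial>m2) < \<infinity>" if "summable (\<lambda>k. (cmod (a k))\<^sup>2 * moment k)"
      using trans [OF ser(2) suminf_ennreal2 [OF Wn that]] by (simp only: ennreal_less_top infinity_ennreal_def)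
  qed
  finally show "set_integrable m2 (ball 0 1) (\<lambda>z. (cmod (f z))\<^sup>2 * g (1 - (cmod z)\<^sup>2)) \<longleftrightarrow> summable (\<lambda>k. (cmod (a k))\<^sup>2 * moment k)"
    by (simp add: set_integrable_def)
  assume summ: "summable (\<lambda>k. (cmod (a k))\<^sup>2 * moment k)"
  have "(\<integral>z. ?G z \<partial>m2) = enn2real (\<integral>\<^sup>+z. ennreal (?G z) \<partial>m2)"
    using ser(1) nn by (intro integral_eq_nn_integral) auto
  also have "\<dots> = (\<Sum>k. (cmod (a k))\<^sup>2 * moment k)"
    using arg_cong [OF trans [OF ser(2) suminf_ennreal2 [OF Wn summ]], of enn2real]
      suminf_nonneg [OF summ Wn] by (simp only: enn2real_ennreal)
  finally show "bergman_norm g f = sqrt (kappa g * (\<Sum>k. (cmod (a k))\<^sup>2 * moment k))"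
    by (simp add: bergman_norm_def set_lebesgue_integral_def)
qed

end

section \<open>Taylor coefficients on the disk, in particular those of simplest fractions\<close>

definition taylor_coeffs :: "(nat \<Rightarrow> complex) \<Rightarrow> (complex \<Rightarrow> complex) \<Rightarrow> bool" where
  "taylor_coeffs a f \<longleftrightarrow> (\<forall>z. cmod z < 1 \<longrightarrow> (\<lambda>k. a k * z ^ k) sums f z)"

lemma taylor_coeffs_holomorphic: "taylor_coeffs a f \<Longrightarrow> f holomorphic_on ball 0 1"
  using power_series_holomorphic [of 0 1 a f] by (auto simp: taylor_coeffs_def)

lemma holomorphic_taylor_coeffs: "f holomorphic_on ball 0 1 \<Longrightarrow> \<exists>a. taylor_coeffs a f"
  using holomorphic_power_series [of f 0 1] by (auto simp: taylor_coeffs_def intro!: exI [of _ "\<lambda>n. (deriv ^^ n) f 0 / fact n"])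

lemma taylor_coeffs_diff: "taylor_coeffs a f \<Longrightarrow> taylor_coeffs b h \<Longrightarrow> taylor_coeffs (\<lambda>k. a k - b k) (\<lambda>z. f z - h z)"
  by (auto simp: taylor_coeffs_def left_diff_distrib intro!: sums_diff)

lemma taylor_coeffs_sum:
  "(\<And>i. i \<in> I \<Longrightarrow> taylor_coeffs (a i) (f i)) \<Longrightarrow> taylor_coeffs (\<lambda>k. \<Sum>i\<in>I. a i k) (\<lambda>z. \<Sum>i\<in>I. f i z)"
  by (auto simp: taylor_coeffs_def sum_distrib_right intro!: sums_sum)

text \<open>Since b times its conjugate is 1, the fraction equals - \<open>cnj b\<close> / (1 -
  \<open>cnj b\<close> z), the sum of a geometric series.\<close>

lemma taylor_coeffs_simple_fraction:
  assumes "cmod b = 1"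
  shows "taylor_coeffs (\<lambda>k. - (cnj b ^ Suc k)) (\<lambda>z. 1 / (z - b))"
  unfolding taylor_coeffs_def
proof (intro allI impI)
  fix z assume z: "cmod z < 1"
  have b: "b * cnj b = 1" using assms complex_norm_square [of b] by simp
  have "cmod (cnj b * z) < 1" using z assms by (simp add: norm_mult)
  then have "(\<lambda>k. - cnj b * (cnj b * z) ^ k) sums (- cnj b * (1 / (1 - cnj b * z)))"
    by (intro sums_mult geometric_sums)
  moreover have "- cnj b * (1 / (1 - cnj b * z)) = 1 / (z - b)"
  proof -
    have "z \<noteq> b" using z assms by auto
    moreover have "b * (1 - cnj b * z) = b - z"
      using b by (simp add: algebra_simps)
    ultimately have "1 - cnj b * z \<noteq> 0" by auto
    then show ?thesis
      using b \<open>z \<noteq> b\<close> by (simp add: field_simps)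
  qed
  ultimately show "(\<lambda>k. - (cnj b ^ Suc k) * z ^ k) sums (1 / (z - b))"
    by (simp add: power_mult_distrib mult_ac)
qed

text \<open>Mind the shift: index m carries the power sum of order m + 1.\<close>

definition fraction_coeffs :: "nat \<Rightarrow> (nat \<Rightarrow> complex) \<Rightarrow> nat \<Rightarrow> complex" where
  "fraction_coeffs N b m = (\<Sum>k<N. - (cnj (b k) ^ Suc m))"

lemma taylor_coeffs_fractions:
  assumes "\<And>k. k < N \<Longrightarrow> cmod (b k) = 1"
  shows "taylor_coeffs (fraction_coeffs N b) (\<lambda>z\<in>ball 0 1. \<Sum>k<N. 1 / (z - b k))"
proof -
  have "taylor_coeffs (\<lambda>m. \<Sum>k<N. - (cnj (b k) ^ Suc m)) (\<lambda>z. \<Sum>k<N. 1 / (z - b k))"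
    by (rule taylor_coeffs_sum) (use assms taylor_coeffs_simple_fraction in auto)
  then show ?thesis
    by (auto simp: taylor_coeffs_def fraction_coeffs_def [abs_def])
qed

lemma norm_fraction_coeffs_le:
  assumes "\<And>k. k < N \<Longrightarrow> cmod (b k) = 1"
  shows "cmod (fraction_coeffs N b m) \<le> N"
proof -
  have "cmod (fraction_coeffs N b m) \<le> (\<Sum>k<N. 1)"
    unfolding fraction_coeffs_def
    by (rule sum_norm_le) (use assms in \<open>simp add: norm_power norm_mult\<close>)
  then show ?thesis by simp
qed

lemma mem_simplest_fractions_iff:
  "f \<in> simplest_fractions \<longleftrightarrow>
    (\<exists>(N::nat) b. N \<ge> 1 \<and> (\<forall>k<N. cmod (b k) = 1) \<and> f = (\<lambda>z\<in>ball 0 1. \<Sum>k<N. 1 / (z - b k)))"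
  unfolding simplest_fractions_def by auto

section \<open>The norm as a quadratic form on coefficient sequences\<close>

context bergman_weight
begin

text \<open>The sum of (1 - t)^k over k is at most 1/t, so partial sums are bounded by the integral
  of g(t)/t. Bounded coefficients, such as those of simplest fractions, therefore have finite
  energy.\<close>

lemma summable_moment: "summable moment"
proof -
  have "(\<Sum>k<n. moment k) \<le> (LINT t:{0..1}|lebesgue. g t / t)" for n
  proof -
    have "(\<Sum>k<n. moment k) = (LINT t:{0..1}|lebesgue. (\<Sum>k<n. (1 - t) ^ k * g t))"
      unfolding moment_def set_lebesgue_integral_def scaleR_sum_right
      by (rule Bochner_Integration.integral_sum [symmetric])
        (use moment_integrable in \<open>auto simp: set_integrable_def\<close>)
    also have "\<dots> \<le> (LINT t:{0..1}|lebesgue. g t / t)"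
      unfolding set_lebesgue_integral_def
    proof (rule integral_mono_AE)
      show "integrable lebesgue (\<lambda>t. indicator {0..1} t *\<^sub>R (\<Sum>k<n. (1 - t) ^ k * g t))"
        unfolding scaleR_sum_right
        by (rule Bochner_Integration.integrable_sum) (use moment_integrable in \<open>auto simp: set_integrable_def\<close>)
      show "integrable lebesgue (\<lambda>t. indicator {0..1} t *\<^sub>R (g t / t))"
        using g_div by (simp add: set_integrable_def)
      have "AE t in lebesgue. t \<noteq> (0::real)"
        by (intro AE_I [where N = "{0}"]) auto
      then show "AE t in lebesgue. indicator {0..1} t *\<^sub>R (\<Sum>k<n. (1 - t) ^ k * g t) \<le> indicator {0..1} t *\<^sub>R (g t / t)"
      proof eventually_elim
        case (elim t)
        show ?case
        proof (cases "t \<in> {0..1}")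
          case True
          with elim have t: "0 < t" "t \<le> 1" by auto
          have "(\<Sum>k<n. (1 - t) ^ k) = (1 - (1 - t) ^ n) / t"
            using t by (simp add: sum_gp_strict)
          also have "\<dots> \<le> 1 / t"
            using t by (intro divide_right_mono) auto
          finally have "(\<Sum>k<n. (1 - t) ^ k) * g t \<le> 1 / t * g t"
            using g_pos [of t] t by (intro mult_right_mono) auto
          then show ?thesis using True by (simp add: sum_distrib_right)
        qed simp
      qed
    qed
    finally show ?thesis .
  qed
  then show ?thesis
    using moment_nonneg by (intro summableI_nonneg_bounded)
qed

text \<open>The squared norm without the factor \<open>kappa g\<close>. The value of
  \<open>suminf\<close> is meaningful only for convergent series, hence the separate predicate
  \<open>finite_energy\<close>.\<close>

definition energy :: "(nat \<Rightarrow> complex) \<Rightarrow> real" where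
  "energy a = (\<Sum>k. (cmod (a k))\<^sup>2 * moment k)"

definition finite_energy :: "(nat \<Rightarrow> complex) \<Rightarrow> bool" where
  "finite_energy a \<longleftrightarrow> summable (\<lambda>k. (cmod (a k))\<^sup>2 * moment k)"

lemma finite_energy_bounded:
  assumes "\<And>k. cmod (a k) \<le> B"
  shows "finite_energy a"
  unfolding finite_energy_def
proof (rule summable_comparison_test')
  show "summable (\<lambda>k. B\<^sup>2 * moment k)" by (intro summable_mult summable_moment)
  show "norm ((cmod (a k))\<^sup>2 * moment k) \<le> B\<^sup>2 * moment k" for k
    using assms [of k] moment_nonneg [of k] by (auto simp: abs_mult intro!: mult_right_mono power_mono)
qed

lemma energy_nonneg: "finite_energy a \<Longrightarrow> energy a \<ge> 0"
  unfolding energy_def finite_energy_def by (rule suminf_nonneg) (use moment_nonneg in auto)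

text \<open>The bound (x + y)^2 <= 2 x^2 + 2 y^2 stands in for the triangle inequality; its factors
  2 explain the fractions of e chosen in the density proof.\<close>

lemma energy_add:
  assumes a: "finite_energy a" and b: "finite_energy b"
  shows "finite_energy (\<lambda>k. a k + b k)" "energy (\<lambda>k. a k + b k) \<le> 2 * energy a + 2 * energy b"
proof -
  have summ: "summable (\<lambda>k. 2 * ((cmod (a k))\<^sup>2 * moment k) + 2 * ((cmod (b k))\<^sup>2 * moment k))"
    using a b unfolding finite_energy_def by (intro summable_add summable_mult)
  have le: "(cmod (a k + b k))\<^sup>2 * moment k \<le> 2 * ((cmod (a k))\<^sup>2 * moment k) + 2 * ((cmod (b k))\<^sup>2 * moment k)" for k
  proof -
    have "(cmod (a k + b k))\<^sup>2 \<le> (cmod (a k) + cmod (b k))\<^sup>2"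
      by (intro power_mono norm_triangle_ineq) simp
    also have "\<dots> \<le> 2 * (cmod (a k))\<^sup>2 + 2 * (cmod (b k))\<^sup>2"
      using zero_le_power2 [of "cmod (a k) - cmod (b k)"] by (simp add: power2_eq_square algebra_simps)
    finally have "(cmod (a k + b k))\<^sup>2 * moment k \<le> (2 * (cmod (a k))\<^sup>2 + 2 * (cmod (b k))\<^sup>2) * moment k"
      by (intro mult_right_mono moment_nonneg)
    then show ?thesis by (simp add: distrib_right)
  qed
  show fin: "finite_energy (\<lambda>k. a k + b k)"
    unfolding finite_energy_def
    by (rule summable_comparison_test' [OF summ]) (use le moment_nonneg in auto)
  have "energy (\<lambda>k. a k + b k) \<le> (\<Sum>k. 2 * ((cmod (a k))\<^sup>2 * moment k) + 2 * ((cmod (b k))\<^sup>2 * moment k))"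
    unfolding energy_def using fin summ le unfolding finite_energy_def by (intro suminf_le)
  also have "\<dots> = 2 * energy a + 2 * energy b"
    using a b unfolding finite_energy_def energy_def
    by (simp add: suminf_add [symmetric] suminf_mult summable_mult)
  finally show "energy (\<lambda>k. a k + b k) \<le> 2 * energy a + 2 * energy b" .
qed

lemma bergman_iff:
  assumes "taylor_coeffs a f"
  shows "f \<in> bergman g \<longleftrightarrow> f \<in> extensional (ball 0 1) \<and> finite_energy a"
  using bergman_norm_series(1) [of a f] taylor_coeffs_holomorphic [OF assms] assms
  by (auto simp: bergman_def finite_energy_def taylor_coeffs_def holomorphic_on_imp_continuous_on)

lemma bergman_taylor_coeffs:
  assumes "f \<in> bergman g"
  obtains a where "taylor_coeffs a f" "finite_energy a"
  using assms bergman_iff holomorphic_taylor_coeffs [of f] by (auto simp: bergman_def)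

lemma bergman_dist_energy:
  assumes "taylor_coeffs a f" "taylor_coeffs b h" "finite_energy (\<lambda>k. a k - b k)"
  shows "bergman_dist g f h = sqrt (kappa g * energy (\<lambda>k. a k - b k))"
proof -
  have *: "taylor_coeffs (\<lambda>k. a k - b k) (\<lambda>z. f z - h z)"
    using assms by (intro taylor_coeffs_diff)
  have "continuous_on (ball 0 1) (\<lambda>z. f z - h z)"
    using taylor_coeffs_holomorphic [OF *] by (rule holomorphic_on_imp_continuous_on)
  then show ?thesis
    unfolding bergman_dist_def energy_def
    by (rule bergman_norm_series(2) [rotated]) (use * assms(3) in \<open>auto simp: taylor_coeffs_def finite_energy_def\<close>)
qed

lemma finite_energy_diff:
  "finite_energy a \<Longrightarrow> finite_energy b \<Longrightarrow> finite_energy (\<lambda>k. a k - b k)"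
  using energy_add(1) [of a "\<lambda>k. - b k"] by (simp add: finite_energy_def)

lemma finite_energy_fraction_coeffs:
  "(\<And>k. k < N \<Longrightarrow> cmod (b k) = 1) \<Longrightarrow> finite_energy (fraction_coeffs N b)"
  using norm_fraction_coeffs_le by (rule finite_energy_bounded)

lemma simple_fractions_bergman: "simplest_fractions \<subseteq> bergman g"
proof
  fix f assume "f \<in> simplest_fractions"
  then obtain N :: nat and b where f: "f = (\<lambda>z\<in>ball 0 1. \<Sum>k<N. 1 / (z - b k))" and b: "\<And>k. k < N \<Longrightarrow> cmod (b k) = 1"
    using mem_simplest_fractions_iff [of f] by auto
  show "f \<in> bergman g"
    using bergman_iff [OF taylor_coeffs_fractions [OF b]] finite_energy_fraction_coeffs [OF b] by (simp add: f)
qed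

text \<open>Reduces both halves of the theorem to coefficient sequences; the positive constant
  \<open>kappa g\<close> and the square root are absorbed into the tolerance.\<close>

lemma closure_simplest_fractions_iff:
  assumes f: "f \<in> bergman g" and a: "taylor_coeffs a f" "finite_energy a"
  shows "f \<in> bergman_topology g closure_of simplest_fractions \<longleftrightarrow>
    (\<forall>e>0. \<exists>N b. N \<ge> 1 \<and> (\<forall>k<N. cmod (b k) = 1) \<and> energy (\<lambda>m. a m - fraction_coeffs N b m) < e)"
proof -
  interpret M: Metric_space "bergman g" "bergman_dist g"
    using Metric_space_bergman [OF g_int g_pos] .
  note \<kappa> = kappa_pos [OF g_int g_pos]
  have dist: "bergman_dist g f (\<lambda>z\<in>ball 0 1. \<Sum>k<N. 1 / (z - b k))
      = sqrt (kappa g * energy (\<lambda>m. a m - fraction_coeffs N b m))"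
    if "\<forall>k<N. cmod (b k) = 1" for N b
    using that a by (intro bergman_dist_energy taylor_coeffs_fractions finite_energy_diff finite_energy_fraction_coeffs) auto
  have "f \<in> bergman_topology g closure_of simplest_fractions \<longleftrightarrow>
      (\<forall>r>0. \<exists>h\<in>simplest_fractions. bergman_dist g f h < r)"
    unfolding bergman_topology_def M.metric_closure_of
    using f simple_fractions_bergman by (simp add: M.in_mball) blast
  also have "\<dots> \<longleftrightarrow> (\<forall>r>0. \<exists>(N::nat) b. N \<ge> 1 \<and> (\<forall>k<N. cmod (b k) = 1) \<and>
      bergman_dist g f (\<lambda>z\<in>ball 0 1. \<Sum>k<N. 1 / (z - b k)) < r)"
    unfolding Bex_def mem_simplest_fractions_iff by blast
  also have "\<dots> \<longleftrightarrow> (\<forall>r>0. \<exists>N b. N \<ge> 1 \<and> (\<forall>k<N. cmod (b k) = 1) \<and>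
      sqrt (kappa g * energy (\<lambda>m. a m - fraction_coeffs N b m)) < r)"
    by (simp add: dist cong: conj_cong)
  also have "\<dots> \<longleftrightarrow> (\<forall>e>0. \<exists>N b. N \<ge> 1 \<and> (\<forall>k<N. cmod (b k) = 1) \<and>
      energy (\<lambda>m. a m - fraction_coeffs N b m) < e)" (is "?L \<longleftrightarrow> ?R")
  proof
    assume L: ?L
    show ?R
    proof (intro allI impI)
      fix e :: real assume "e > 0"
      then have "sqrt (kappa g * e) > 0" using \<kappa> by simp
      then obtain N b where "N \<ge> 1" "\<forall>k<N. cmod (b k) = 1"
        "sqrt (kappa g * energy (\<lambda>m. a m - fraction_coeffs N b m)) < sqrt (kappa g * e)"
        using L by blast
      then show "\<exists>N b. N \<ge> 1 \<and> (\<forall>k<N. cmod (b k) = 1) \<and> energy (\<lambda>m. a m - fraction_coeffs N b m) < e"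
        using \<kappa> by auto
    qed
  next
    assume R: ?R
    show ?L
    proof (intro allI impI)
      fix r :: real assume "r > 0"
      then have "r\<^sup>2 / kappa g > 0" using \<kappa> by simp
      then obtain N b where Nb: "N \<ge> 1" "\<forall>k<N. cmod (b k) = 1"
        "energy (\<lambda>m. a m - fraction_coeffs N b m) < r\<^sup>2 / kappa g"
        using R by blast
      then have "kappa g * energy (\<lambda>m. a m - fraction_coeffs N b m) < r\<^sup>2"
        using \<kappa> by (simp add: field_simps)
      then have "sqrt (kappa g * energy (\<lambda>m. a m - fraction_coeffs N b m)) < r"
        using \<open>r > 0\<close> by (metis abs_of_pos real_sqrt_abs real_sqrt_less_iff)
      then show "\<exists>N b. N \<ge> 1 \<and> (\<forall>k<N. cmod (b k) = 1) \<and>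
          sqrt (kappa g * energy (\<lambda>m. a m - fraction_coeffs N b m)) < r"
        using Nb by blast
    qed
  qed
  finally show ?thesis .
qed

end

subsection \<open>Closedness\<close>

text \<open>Sum \<^term>\<open>(cmod (\<Sum>j<M. (b k * cnj (b l)) ^ j))\<^sup>2\<close> over all pairs of indices k, l: the diagonal alone
  contributes \<^term>\<open>real N * (real M)\<^sup>2\<close>.\<close>

lemma power_sums_lower_bound:
  fixes b :: "nat \<Rightarrow> complex"
  assumes b: "\<And>k. k < N \<Longrightarrow> cmod (b k) = 1"
  shows "real N * real M \<le> (real N)\<^sup>2 + 2 * (\<Sum>n\<in>{1..<M}. (cmod (\<Sum>k<N. b k ^ n))\<^sup>2)"
proof (cases "M = 0")
  case True
  then show ?thesis by simp
next
  case False
  define q where "q n = (cmod (\<Sum>k<N. b k ^ n))\<^sup>2" for n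
  \<comment> \<open>Up to conjugation, \<open>P i j\<close> is the power sum of order |i - j|,
    because the points lie on the circle.\<close>
  define P where "P i j = (\<Sum>k<N. b k ^ i * cnj (b k) ^ j)" for i j
  have bb: "b k * cnj (b k) = 1" if "k < N" for k
    using b [OF that] complex_norm_square [of "b k"] by simp
  have P1: "P i j = (\<Sum>k<N. b k ^ (i - j))" if "j \<le> i" for i j
    unfolding P_def
  proof (rule sum.cong)
    fix k assume "k \<in> {..<N}"
    then have "b k ^ i * cnj (b k) ^ j = b k ^ (i - j) * (b k * cnj (b k)) ^ j"
      using \<open>j \<le> i\<close> by (simp add: power_mult_distrib power_add [symmetric] flip: mult.assoc)
    then show "b k ^ i * cnj (b k) ^ j = b k ^ (i - j)"
      using bb \<open>k \<in> {..<N}\<close> by simp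
  qed simp
  have P2: "cmod (P i j) = cmod (P j i)" for i j
  proof -
    have "P j i = cnj (P i j)" by (simp add: P_def mult.commute)
    then show ?thesis by simp
  qed
  have Pq: "(cmod (P i j))\<^sup>2 = q (i - j)" if "j \<le> i" for i j
    using P1 [OF that] by (simp add: q_def)
  \<comment> \<open>In row i every difference n >= 1 occurs at most once on either side of the
    diagonal, and the diagonal entry is N.\<close>
  have row: "(\<Sum>j<M. (cmod (P i j))\<^sup>2) \<le> (real N)\<^sup>2 + 2 * (\<Sum>n\<in>{1..<M}. q n)" if "i < M" for i
  proof -
    have "(\<Sum>j<M. (cmod (P i j))\<^sup>2) = (\<Sum>j\<in>{..<i} \<union> insert i {i<..<M}. (cmod (P i j))\<^sup>2)"
      using that by (intro sum.cong) auto
    also have "\<dots> = (\<Sum>j<i. (cmod (P i j))\<^sup>2) + ((cmod (P i i))\<^sup>2 + (\<Sum>j\<in>{i<..<M}. (cmod (P i j))\<^sup>2))"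
      by (subst sum.union_disjoint) auto
    finally have "(\<Sum>j<M. (cmod (P i j))\<^sup>2)
        = (\<Sum>j<i. (cmod (P i j))\<^sup>2) + ((cmod (P i i))\<^sup>2 + (\<Sum>j\<in>{i<..<M}. (cmod (P i j))\<^sup>2))" .
    moreover have "(\<Sum>j<i. (cmod (P i j))\<^sup>2) \<le> (\<Sum>n\<in>{1..<M}. q n)"
    proof -
      have "(\<Sum>j<i. (cmod (P i j))\<^sup>2) = (\<Sum>j<i. q (i - j))"
        by (intro sum.cong) (auto simp: Pq)
      also have "\<dots> = sum q ((\<lambda>j. i - j) ` {..<i})"
        by (subst sum.reindex) (auto simp: inj_on_def)
      also have "\<dots> \<le> (\<Sum>n\<in>{1..<M}. q n)"
        using that by (intro sum_mono2) (auto simp: q_def)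
      finally show ?thesis .
    qed
    moreover have "(\<Sum>j\<in>{i<..<M}. (cmod (P i j))\<^sup>2) \<le> (\<Sum>n\<in>{1..<M}. q n)"
    proof -
      have "(\<Sum>j\<in>{i<..<M}. (cmod (P i j))\<^sup>2) = (\<Sum>j\<in>{i<..<M}. q (j - i))"
        by (intro sum.cong) (auto simp: Pq P2 [of i])
      also have "\<dots> = sum q ((\<lambda>j. j - i) ` {i<..<M})"
        by (subst sum.reindex) (auto simp: inj_on_def)
      also have "\<dots> \<le> (\<Sum>n\<in>{1..<M}. q n)"
        by (intro sum_mono2) (auto simp: q_def)
      finally show ?thesis .
    qed
    moreover have "(cmod (P i i))\<^sup>2 = (real N)\<^sup>2"
      by (simp add: Pq q_def)
    ultimately show ?thesis by linarith
  qed
  define K where "K k l = (\<Sum>j<M. (b k * cnj (b l)) ^ j)" for k l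
  \<comment> \<open>Expanding the squares and summing over the points k, l first turns the double
    sum over pairs of points into one over pairs of exponents i, j.\<close>
  have "complex_of_real (\<Sum>k<N. \<Sum>l<N. (cmod (K k l))\<^sup>2)
      = (\<Sum>(k, l)\<in>{..<N} \<times> {..<N}. \<Sum>(i, j)\<in>{..<M} \<times> {..<M}.
           b k ^ i * cnj (b l) ^ i * (cnj (b k) ^ j * b l ^ j))"
    by (simp add: sum.cartesian_product [symmetric] K_def complex_norm_square sum_product power_mult_distrib
        del: of_real_power)
  also have "\<dots> = (\<Sum>(i, j)\<in>{..<M} \<times> {..<M}. \<Sum>(k, l)\<in>{..<N} \<times> {..<N}.
           b k ^ i * cnj (b l) ^ i * (cnj (b k) ^ j * b l ^ j))"
    unfolding case_prod_unfold by (rule sum.swap)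
  also have "\<dots> = complex_of_real (\<Sum>i<M. \<Sum>j<M. (cmod (P i j))\<^sup>2)"
    by (simp add: sum.cartesian_product [symmetric] P_def complex_norm_square sum_product power_mult_distrib mult_ac
        del: of_real_power)
  finally have eq: "(\<Sum>k<N. \<Sum>l<N. (cmod (K k l))\<^sup>2) = (\<Sum>i<M. \<Sum>j<M. (cmod (P i j))\<^sup>2)"
    by (simp only: of_real_eq_iff)
  have "real N * (real M)\<^sup>2 = (\<Sum>k<N. (cmod (K k k))\<^sup>2)"
    using bb by (simp add: K_def)
  also have "\<dots> \<le> (\<Sum>k<N. \<Sum>l<N. (cmod (K k l))\<^sup>2)"
    by (intro sum_mono member_le_sum) auto
  also have "\<dots> \<le> (\<Sum>i<M. (real N)\<^sup>2 + 2 * (\<Sum>n\<in>{1..<M}. q n))"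
    unfolding eq using row by (intro sum_mono) auto
  also have "\<dots> = ((real N)\<^sup>2 + 2 * (\<Sum>n\<in>{1..<M}. q n)) * real M"
    by simp
  finally have "(real N * real M) * real M \<le> ((real N)\<^sup>2 + 2 * (\<Sum>n\<in>{1..<M}. q n)) * real M"
    by (simp add: power2_eq_square mult.assoc)
  then show ?thesis
    using False by (simp add: q_def)
qed

text \<open>Compactness of the N-torus, by refining the subsequence one coordinate at a
  time.\<close>

lemma sphere_convergent_subsequence:
  fixes b :: "nat \<Rightarrow> nat \<Rightarrow> complex"
  assumes "\<And>n k. k < N \<Longrightarrow> cmod (b n k) = 1"
  shows "\<exists>r \<beta>. strict_mono (r :: nat \<Rightarrow> nat) \<and> (\<forall>k<N. cmod (\<beta> k) = 1 \<and> (\<lambda>n. b (r n) k) \<longlonglongrightarrow> \<beta> k)"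
  using assms
proof (induction N)
  case 0
  show ?case by (auto intro: exI [of _ id] simp: strict_mono_id)
next
  case (Suc N)
  then obtain r \<beta> where r: "strict_mono (r :: nat \<Rightarrow> nat)"
    and \<beta>: "\<And>k. k < N \<Longrightarrow> cmod (\<beta> k) = 1" "\<And>k. k < N \<Longrightarrow> (\<lambda>n. b (r n) k) \<longlonglongrightarrow> \<beta> k"
    using less_SucI by metis
  have "\<forall>n. b (r n) N \<in> sphere 0 1"
    using Suc.prems by simp
  then obtain l r' where l: "l \<in> sphere (0::complex) 1" "strict_mono (r' :: nat \<Rightarrow> nat)" "(\<lambda>n. b (r (r' n)) N) \<longlonglongrightarrow> l"
    using compact_sphere [of "0::complex" 1, unfolded compact_def, rule_format, of "\<lambda>n. b (r n) N"]
    by (auto simp: o_def)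
  show ?case
  proof (intro exI conjI allI impI)
    show "strict_mono (r \<circ> r')" using r l(2) by (rule strict_mono_o)
    fix k assume "k < Suc N"
    then consider "k = N" | "k < N" by linarith
    then show "cmod ((\<beta>(N := l)) k) = 1" "(\<lambda>n. b ((r \<circ> r') n) k) \<longlonglongrightarrow> (\<beta>(N := l)) k"
      using \<beta> l LIMSEQ_subseq_LIMSEQ [OF \<beta>(2) l(2)] by (cases; simp add: o_def)+
  qed
qed

section \<open>Lower bound for moments, bound on the number of poles, and the limit argument\<close>

context bergman_weight
begin

text \<open>On an interval [\<eta>/2, \<eta>] with \<eta> of order 1/(m + 1), the hypothesis bounds
  g below by a multiple of \<eta>, Bernoulli's inequality gives (1 - t)^m >= 1/2, and the length
  contributes another factor \<eta>/2.\<close>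

lemma moment_lower_bound:
  assumes "(\<lambda>t. t) \<in> O[at_right 0](g)"
  obtains c where "c > 0" "\<And>m. moment m \<ge> c / (real (Suc m))\<^sup>2"
proof -
  obtain C where C: "C > 0" and "eventually (\<lambda>t. norm t \<le> C * norm (g t)) (at_right 0)"
    using assms by (auto elim: landau_o.bigE)
  then obtain d where d: "d > 0" and dC: "\<And>t. 0 < t \<Longrightarrow> t < d \<Longrightarrow> \<bar>t\<bar> \<le> C * \<bar>g t\<bar>"
    by (auto simp: eventually_at_right_field)
  define \<delta> where "\<delta> = min d 1 / 2"
  have \<delta>: "0 < \<delta>" "\<delta> < d" "\<delta> \<le> 1 / 2" using d by (auto simp: \<delta>_def)
  have "moment m \<ge> (\<delta>\<^sup>2 / (32 * C)) / (real (Suc m))\<^sup>2" for m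
  proof -
    define \<eta> where "\<eta> = \<delta> / (2 * real (Suc m))"
    have \<eta>: "0 < \<eta>" "\<eta> \<le> \<delta>"
      using \<delta> by (auto simp: \<eta>_def field_simps)
    have m\<eta>: "real m * \<eta> \<le> 1 / 2"
    proof -
      have "real m * \<eta> \<le> real (Suc m) * \<eta>"
        using \<eta> by (intro mult_right_mono) auto
      also have "\<dots> = \<delta> / 2" by (simp add: \<eta>_def del: of_nat_Suc)
      finally show ?thesis using \<delta> by simp
    qed
    have "(\<delta>\<^sup>2 / (32 * C)) / (real (Suc m))\<^sup>2 = 1 / 2 * (\<eta> / 2 / C) * (\<eta> / 2)"
      using C by (simp add: \<eta>_def power2_eq_square field_simps del: of_nat_Suc)
    also have "\<dots> = (\<integral>t. indicator {\<eta> / 2..\<eta>} t *\<^sub>R (1 / 2 * (\<eta> / 2 / C)) \<partial>lebesgue)"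
      using \<eta> by (simp add: measure_completion)
    also have "\<dots> \<le> moment m"
      unfolding moment_def set_lebesgue_integral_def
    proof (rule integral_mono_AE)
      show "integrable lebesgue (\<lambda>t. indicator {\<eta> / 2..\<eta>} t *\<^sub>R (1 / 2 * (\<eta> / 2 / C)))"
        by (intro integrable_scaleR_left integrable_real_indicator) (auto simp: emeasure_lborel_Icc_eq)
      show "integrable lebesgue (\<lambda>t. indicator {0..1} t *\<^sub>R ((1 - t) ^ m * g t))"
        using moment_integrable by (simp add: set_integrable_def)
      show "AE t in lebesgue. indicator {\<eta> / 2..\<eta>} t *\<^sub>R (1 / 2 * (\<eta> / 2 / C)) \<le> indicator {0..1} t *\<^sub>R ((1 - t) ^ m * g t)"
        using AE_unit_pos
      proof eventually_elim
        case (elim t)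
        show ?case
        proof (cases "t \<in> {\<eta> / 2..\<eta>}")
          case True
          then have t: "0 < t" "\<eta> / 2 \<le> t" "t \<le> \<eta>" "t < 1" "t < d" using \<eta> \<delta> by auto
          have gt: "g t > 0" using t by (intro g_pos) auto
          have "\<eta> / 2 / C \<le> t / C" using t C by (intro divide_right_mono) auto
          also have "\<dots> \<le> g t"
            using dC [of t] t gt C by (simp add: field_simps)
          finally have 1: "\<eta> / 2 / C \<le> g t" .
          have "1 / 2 \<le> 1 - real m * \<eta>" using m\<eta> by simp
          also have "\<dots> \<le> 1 - real m * t" using t by (intro diff_left_mono mult_left_mono) auto
          also have "\<dots> \<le> (1 - t) ^ m"
            using Bernoulli_inequality [of "- t" m] t by simp
          finally have "1 / 2 * (\<eta> / 2 / C) \<le> (1 - t) ^ m * g t"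
            using 1 t \<eta> C by (intro mult_mono) auto
          then show ?thesis using True t by simp
        next
          case False
          then show ?thesis using elim by (auto simp: indicator_def less_imp_le)
        qed
      qed
    qed
    finally show ?thesis .
  qed
  moreover have "\<delta>\<^sup>2 / (32 * C) > 0" using C \<delta> by simp
  ultimately show thesis using that by blast
qed

lemma energy_term_le:
  assumes "finite_energy a"
  shows "(cmod (a m))\<^sup>2 * moment m \<le> energy a"
  using sum_le_suminf [of "\<lambda>k. (cmod (a k))\<^sup>2 * moment k" "{m}"] assms moment_nonneg
  by (simp add: energy_def finite_energy_def)

lemma energy_sum_le:
  assumes "finite_energy a" "finite A"
  shows "(\<Sum>m\<in>A. (cmod (a m))\<^sup>2 * moment m) \<le> energy a"
  using sum_le_suminf [of "\<lambda>k. (cmod (a k))\<^sup>2 * moment k" A] assms moment_nonneg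
  by (simp add: energy_def finite_energy_def)

text \<open>Let s be the coefficients of a nearby fraction with N poles. Those of order below J have
  square sum at most \<open>B\<close>, independent of N. Those from J to 2N have weighted square sum
  at most 4 \<eta>, which the moment bound turns into a small multiple of N^2. This conflicts with
  the power sum inequality for large N.\<close>

lemma degree_bounded:
  assumes c: "c > 0" "\<And>m. moment m \<ge> c / (real (Suc m))\<^sup>2" and a: "finite_energy a"
  obtains N0 :: nat and e where "e > 0"
    "\<And>N b. (\<And>k. k < N \<Longrightarrow> cmod (b k) = 1) \<Longrightarrow> energy (\<lambda>m. a m - fraction_coeffs N b m) < e \<Longrightarrow> N \<le> N0"
proof -
  \<comment> \<open>With this value the bound \<open>high\<close> equals N^2/4, half of the N^2/2
    that the power sums must reach.\<close>
  define \<eta> where "\<eta> = c / 64"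
  have \<eta>: "\<eta> > 0" using c by (simp add: \<eta>_def)
  have "summable (\<lambda>m. (cmod (a m))\<^sup>2 * moment m)" using a by (simp add: finite_energy_def)
  then obtain J where J: "\<And>m n. m \<ge> J \<Longrightarrow> norm (\<Sum>m\<in>{m..<n}. (cmod (a m))\<^sup>2 * moment m) < \<eta>"
    unfolding summable_Cauchy using \<eta> by blast
  define B where "B = (\<Sum>m<J. 2 * (cmod (a m))\<^sup>2 + 2 * (\<eta> * (real (Suc m))\<^sup>2 / c))"
  have bound: "N \<le> nat \<lceil>4 * B\<rceil>" if b: "\<And>k. k < N \<Longrightarrow> cmod (b k) = 1"
    and e: "energy (\<lambda>m. a m - fraction_coeffs N b m) < \<eta>" for N b
  proof -
    define s where "s = fraction_coeffs N b"
    have fin: "finite_energy (\<lambda>m. a m - s m)"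
      unfolding s_def by (intro finite_energy_diff a finite_energy_fraction_coeffs b)
    have sq: "(cmod (s m))\<^sup>2 \<le> 2 * (cmod (a m))\<^sup>2 + 2 * (cmod (a m - s m))\<^sup>2" for m
    proof -
      have "cmod (s m) \<le> cmod (a m) + cmod (a m - s m)"
        by (metis norm_minus_commute norm_triangle_sub)
      then have "(cmod (s m))\<^sup>2 \<le> (cmod (a m) + cmod (a m - s m))\<^sup>2"
        by (rule power_mono) simp
      also have "\<dots> \<le> 2 * (cmod (a m))\<^sup>2 + 2 * (cmod (a m - s m))\<^sup>2"
        using zero_le_power2 [of "cmod (a m) - cmod (a m - s m)"] by (simp add: power2_eq_square algebra_simps)
      finally show ?thesis .
    qed
    have Winv: "x \<le> y * (real (Suc m))\<^sup>2 / c" if "x * moment m \<le> y" "x \<ge> 0" for x y m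
    proof -
      have "x * (c / (real (Suc m))\<^sup>2) \<le> y"
        using c(2) [of m] that by (smt (verit) mult_left_mono)
      then show ?thesis using c(1) by (simp add: field_simps del: of_nat_Suc)
    qed
    have low: "(\<Sum>m<J. (cmod (s m))\<^sup>2) \<le> B"
      unfolding B_def
    proof (rule sum_mono)
      fix m
      have "(cmod (a m - s m))\<^sup>2 * moment m \<le> \<eta>"
        using energy_term_le [OF fin, of m] e by (simp add: s_def)
      then have "(cmod (a m - s m))\<^sup>2 \<le> \<eta> * (real (Suc m))\<^sup>2 / c"
        by (rule Winv) simp
      then show "(cmod (s m))\<^sup>2 \<le> 2 * (cmod (a m))\<^sup>2 + 2 * (\<eta> * (real (Suc m))\<^sup>2 / c)"
        using sq [of m] by linarith
    qed
    have high: "(\<Sum>m\<in>{J..<2 * N}. (cmod (s m))\<^sup>2) \<le> 4 * \<eta> * (2 * real N)\<^sup>2 / c"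
    proof -
      have "(\<Sum>m\<in>{J..<2 * N}. (cmod (s m))\<^sup>2) \<le> (\<Sum>m\<in>{J..<2 * N}. (cmod (s m))\<^sup>2 * moment m * (2 * real N)\<^sup>2 / c)"
      proof (rule sum_mono)
        fix m assume "m \<in> {J..<2 * N}"
        then have m: "real (Suc m) \<le> 2 * real N" by auto
        have "(cmod (s m))\<^sup>2 \<le> (cmod (s m))\<^sup>2 * moment m * (real (Suc m))\<^sup>2 / c"
          by (rule Winv) auto
        also have "\<dots> \<le> (cmod (s m))\<^sup>2 * moment m * (2 * real N)\<^sup>2 / c"
          using c m moment_nonneg by (intro divide_right_mono mult_left_mono power_mono) auto
        finally show "(cmod (s m))\<^sup>2 \<le> (cmod (s m))\<^sup>2 * moment m * (2 * real N)\<^sup>2 / c" .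
      qed
      also have "\<dots> = (\<Sum>m\<in>{J..<2 * N}. (cmod (s m))\<^sup>2 * moment m) * ((2 * real N)\<^sup>2 / c)"
        by (simp add: sum_distrib_right sum_divide_distrib)
      also have "\<dots> \<le> (4 * \<eta>) * ((2 * real N)\<^sup>2 / c)"
      proof (rule mult_right_mono)
        have "(\<Sum>m\<in>{J..<2 * N}. (cmod (s m))\<^sup>2 * moment m)
            \<le> (\<Sum>m\<in>{J..<2 * N}. 2 * ((cmod (a m))\<^sup>2 * moment m) + 2 * ((cmod (a m - s m))\<^sup>2 * moment m))"
        proof (rule sum_mono)
          fix m
          show "(cmod (s m))\<^sup>2 * moment m \<le> 2 * ((cmod (a m))\<^sup>2 * moment m) + 2 * ((cmod (a m - s m))\<^sup>2 * moment m)"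
            using mult_right_mono [OF sq moment_nonneg, of m m] by (simp add: distrib_right mult.assoc)
        qed
        also have "\<dots> = 2 * (\<Sum>m\<in>{J..<2 * N}. (cmod (a m))\<^sup>2 * moment m) + 2 * (\<Sum>m\<in>{J..<2 * N}. (cmod (a m - s m))\<^sup>2 * moment m)"
          by (simp add: sum.distrib sum_distrib_left)
        also have "\<dots> \<le> 4 * \<eta>"
          using J [of J "2 * N"] energy_sum_le [OF fin, of "{J..<2 * N}"] e by (simp add: s_def)
        finally show "(\<Sum>m\<in>{J..<2 * N}. (cmod (s m))\<^sup>2 * moment m) \<le> 4 * \<eta>" .
      qed (use c in auto)
      finally show ?thesis by simp
    qed
    have "cmod (\<Sum>k<N. b k ^ n) = cmod (s (n - 1))" if "n \<ge> 1" for n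
    proof -
      obtain m where m: "n = Suc m" using \<open>n \<ge> 1\<close> by (cases n) auto
      have "s m = - cnj (\<Sum>k<N. b k ^ Suc m)"
        by (simp add: s_def fraction_coeffs_def sum_negf)
      then show ?thesis unfolding m diff_Suc_1 by (simp only: norm_minus_cancel complex_mod_cnj)
    qed
    then have "(\<Sum>n\<in>{1..<2 * N}. (cmod (\<Sum>k<N. b k ^ n))\<^sup>2) = (\<Sum>m<2 * N - 1. (cmod (s m))\<^sup>2)"
      by (intro sum.reindex_bij_witness [of _ Suc "\<lambda>n. n - 1"]) auto
    also have "\<dots> \<le> (\<Sum>m\<in>{..<J} \<union> {J..<2 * N}. (cmod (s m))\<^sup>2)"
      by (intro sum_mono2) auto
    also have "\<dots> \<le> B + (real N)\<^sup>2 / 4"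
      using low high c by (subst sum.union_disjoint) (auto simp: \<eta>_def power_mult_distrib)
    finally have "(\<Sum>n\<in>{1..<2 * N}. (cmod (\<Sum>k<N. b k ^ n))\<^sup>2) \<le> B + (real N)\<^sup>2 / 4" .
    then have "(real N)\<^sup>2 + 2 * (\<Sum>n\<in>{1..<2 * N}. (cmod (\<Sum>k<N. b k ^ n))\<^sup>2) \<le> (real N)\<^sup>2 + 2 * (B + (real N)\<^sup>2 / 4)"
      by (intro add_left_mono mult_left_mono) auto
    \<comment> \<open>Taking M = 2N doubles the N^2 lost on the diagonal, so the square sum is at
      least N^2/2; comparison with B + N^2/4 bounds N.\<close>
    with power_sums_lower_bound [of N b "2 * N", OF b]
    have "real N * real (2 * N) \<le> (real N)\<^sup>2 + 2 * (B + (real N)\<^sup>2 / 4)"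
      by (rule order_trans)
    then have "(real N)\<^sup>2 \<le> 4 * B"
      by (simp add: power2_eq_square)
    moreover have "real N \<le> (real N)\<^sup>2"
      by (cases N) (auto simp: power2_eq_square simp del: of_nat_Suc)
    ultimately show ?thesis by linarith
  qed
  show thesis by (rule that [OF \<eta>]) (rule bound)
qed

text \<open>A bounded number of poles permits a single N for all tolerances; then the poles converge
  along a subsequence, and the coefficients of the limit fraction are those of f.\<close>

theorem simplest_fractions_closed:
  assumes "(\<lambda>t. t) \<in> O[at_right 0](g)"
  shows "bergman_topology g closure_of simplest_fractions = simplest_fractions"
proof
  interpret M: Metric_space "bergman g" "bergman_dist g"
    using Metric_space_bergman [OF g_int g_pos] .
  show "simplest_fractions \<subseteq> bergman_topology g closure_of simplest_fractions"
    unfolding bergman_topology_def using simple_fractions_bergman by (intro closure_of_subset) simp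
  show "bergman_topology g closure_of simplest_fractions \<subseteq> simplest_fractions"
  proof
    fix f assume f: "f \<in> bergman_topology g closure_of simplest_fractions"
    then have fb: "f \<in> bergman g"
      using closure_of_subset_topspace by (fastforce simp: bergman_topology_def)
    then obtain a where a: "taylor_coeffs a f" "finite_energy a"
      by (rule bergman_taylor_coeffs)
    define A where "A N e \<longleftrightarrow> (\<exists>b. (\<forall>k<N. cmod (b k) = 1) \<and> energy (\<lambda>m. a m - fraction_coeffs N b m) < e)" for N e
    have A_mono: "A N e'" if "A N e" "e \<le> e'" for N e e'
      using that unfolding A_def by (meson less_le_trans)
    have appr: "\<exists>N\<ge>1. A N e" if "e > 0" for e
      using f that unfolding closure_simplest_fractions_iff [OF fb a] A_def by blast
    obtain c where c: "c > 0" "\<And>m. moment m \<ge> c / (real (Suc m))\<^sup>2"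
      using moment_lower_bound [OF assms] by blast
    obtain N0 e0 where e0: "e0 > 0" and N0: "\<And>N. A N e0 \<Longrightarrow> N \<le> N0"
      using degree_bounded [OF c a(2)] unfolding A_def by metis
    \<comment> \<open>If every N failed at some tolerance \<open>e N\<close>, then no N could work
      at the minimum of \<open>e0\<close> and the finitely many \<open>e N\<close> with N <=
      \<open>N0\<close>.\<close>
    have "\<exists>N\<ge>1. \<forall>e>0. A N e"
    proof (rule ccontr)
      assume "\<not> ?thesis"
      then obtain e where e: "\<And>N. N \<ge> 1 \<Longrightarrow> e N > 0" "\<And>N. N \<ge> 1 \<Longrightarrow> \<not> A N (e N)"
        by metis
      define e1 where "e1 = Min (insert e0 (e ` {1..N0}))"
      have "e1 > 0" unfolding e1_def using e0 e by auto
      then obtain N where N: "N \<ge> 1" "A N e1" using appr by blast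
      have "e1 \<le> e0" unfolding e1_def by simp
      then have "N \<le> N0" using N0 A_mono N by blast
      then have "e1 \<le> e N" unfolding e1_def using N by (intro Min_le) auto
      then show False using e A_mono N by blast
    qed
    then obtain N where N: "N \<ge> 1" "\<And>e. e > 0 \<Longrightarrow> A N e" by blast
    have "\<forall>n. \<exists>b. (\<forall>k<N. cmod (b k) = 1) \<and> energy (\<lambda>m. a m - fraction_coeffs N b m) < 1 / real (Suc n)"
      using N(2) unfolding A_def by (metis of_nat_0_less_iff zero_less_Suc zero_less_divide_1_iff)
    then obtain b where b: "\<And>n k. k < N \<Longrightarrow> cmod (b n k) = 1"
      and eb: "\<And>n. energy (\<lambda>m. a m - fraction_coeffs N (b n) m) < 1 / real (Suc n)"
      by metis
    obtain r \<beta> where r: "strict_mono (r :: nat \<Rightarrow> nat)"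
      and \<beta>: "\<And>k. k < N \<Longrightarrow> cmod (\<beta> k) = 1" "\<And>k. k < N \<Longrightarrow> (\<lambda>n. b (r n) k) \<longlonglongrightarrow> \<beta> k"
      using sphere_convergent_subsequence [of N b] b by blast
    \<comment> \<open>The energy dominates each of its terms, so convergence in energy forces
      convergence of every coefficient, as each moment is positive.\<close>
    have "a m = fraction_coeffs N \<beta> m" for m
    proof -
      have Wm: "moment m > 0"
        using c(2) [of m] c(1) by (smt (verit) divide_pos_pos of_nat_0_less_iff zero_less_Suc zero_less_power)
      have "(\<lambda>n. a m - fraction_coeffs N (b (r n)) m) \<longlonglongrightarrow> a m - fraction_coeffs N \<beta> m"
        unfolding fraction_coeffs_def using \<beta>(2) by (intro tendsto_intros) auto
      then have "(\<lambda>n. (cmod (a m - fraction_coeffs N (b (r n)) m))\<^sup>2 * moment m) \<longlonglongrightarrow> (cmod (a m - fraction_coeffs N \<beta> m))\<^sup>2 * moment m"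
        by (intro tendsto_mult tendsto_const tendsto_power tendsto_norm)
      moreover have "(\<lambda>n. (cmod (a m - fraction_coeffs N (b (r n)) m))\<^sup>2 * moment m) \<longlonglongrightarrow> 0"
      proof (rule real_tendsto_sandwich)
        show "eventually (\<lambda>n. 0 \<le> (cmod (a m - fraction_coeffs N (b (r n)) m))\<^sup>2 * moment m) sequentially"
          using moment_nonneg by simp
        show "eventually (\<lambda>n. (cmod (a m - fraction_coeffs N (b (r n)) m))\<^sup>2 * moment m \<le> 1 / real (Suc (r n))) sequentially"
        proof (rule always_eventually, rule allI)
          fix n
          show "(cmod (a m - fraction_coeffs N (b (r n)) m))\<^sup>2 * moment m \<le> 1 / real (Suc (r n))"
            using energy_term_le [OF finite_energy_diff [OF a(2) finite_energy_fraction_coeffs [of N "b (r n)", OF b]], of m] eb [of "r n"]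
            by linarith
        qed
        show "(\<lambda>n. 1 / real (Suc (r n))) \<longlonglongrightarrow> 0"
          using LIMSEQ_subseq_LIMSEQ [OF LIMSEQ_inverse_real_of_nat r] by (simp add: o_def inverse_eq_divide)
      qed simp
      ultimately have "(cmod (a m - fraction_coeffs N \<beta> m))\<^sup>2 * moment m = 0"
        by (rule LIMSEQ_unique)
      then show ?thesis using Wm by simp
    qed
    then have "a = fraction_coeffs N \<beta>" by (rule ext)
    with taylor_coeffs_fractions [of N \<beta>] \<beta>(1)
    have h: "taylor_coeffs a (\<lambda>z\<in>ball 0 1. \<Sum>k<N. 1 / (z - \<beta> k))" by simp
    have "f = (\<lambda>z\<in>ball 0 1. \<Sum>k<N. 1 / (z - \<beta> k))"
    proof (rule extensionalityI)
      show "f \<in> extensional (ball 0 1)" using fb by (simp add: bergman_def)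
      show "(\<lambda>z\<in>ball 0 1. \<Sum>k<N. 1 / (z - \<beta> k)) \<in> extensional (ball 0 1)" by simp
      show "f z = (\<lambda>z\<in>ball 0 1. \<Sum>k<N. 1 / (z - \<beta> k)) z" if "z \<in> ball 0 1" for z
      proof (rule sums_unique2)
        show "(\<lambda>k. a k * z ^ k) sums f z"
          using a(1) that unfolding taylor_coeffs_def mem_ball_0 by blast
        show "(\<lambda>k. a k * z ^ k) sums (\<lambda>z\<in>ball 0 1. \<Sum>k<N. 1 / (z - \<beta> k)) z"
          using h that unfolding taylor_coeffs_def mem_ball_0 by blast
      qed
    qed
    then show "f \<in> simplest_fractions"
      unfolding mem_simplest_fractions_iff using N(1) \<beta>(1) by blast
  qed
qed

end

subsection \<open>Density\<close>

definition root_of_one :: "nat \<Rightarrow> int \<Rightarrow> complex" where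
  "root_of_one M n = cis (2 * pi * real_of_int n / real M)"

lemma norm_root_of_one [simp]: "cmod (root_of_one M n) = 1"
  by (simp add: root_of_one_def)

lemma root_of_one_add: "root_of_one M (m + n) = root_of_one M m * root_of_one M n"
  by (simp add: root_of_one_def cis_mult ring_distribs add_divide_distrib)

lemma root_of_one_power: "root_of_one M n ^ k = root_of_one M (n * int k)"
  by (simp add: root_of_one_def Complex.DeMoivre mult_ac)

lemma cnj_root_of_one: "cnj (root_of_one M n) = root_of_one M (- n)"
  by (simp add: root_of_one_def cis_cnj)

lemma root_of_one_eq_1_iff:
  assumes "M > 0"
  shows "root_of_one M n = 1 \<longleftrightarrow> int M dvd n"
proof
  assume "root_of_one M n = 1"
  then have "cos (2 * pi * real_of_int n / real M) = 1"
    unfolding root_of_one_def by (metis cis.sel(1) one_complex.sel(1))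
  then obtain k :: int where "2 * pi * real_of_int n / real M = real_of_int k * 2 * pi"
    by (auto simp: cos_one_2pi_int)
  then have "real_of_int n = real_of_int (int M * k)"
    using assms by (simp add: field_simps)
  then have "n = int M * k" by (simp only: of_int_eq_iff)
  then show "int M dvd n" by simp
next
  assume "int M dvd n"
  then obtain k where "n = int M * k" by auto
  then show "root_of_one M n = 1"
    using assms cis_multiple_2pi [of "real_of_int k"] by (simp add: root_of_one_def mult_ac)
qed

text \<open>Discrete orthogonality: a geometric sum whose ratio has M-th power 1.\<close>

lemma sum_root_of_one:
  assumes "M > 0"
  shows "(\<Sum>j<M. root_of_one M (int j * n)) = (if int M dvd n then of_nat M else 0)"
proof -
  have pow: "root_of_one M (int j * n) = root_of_one M n ^ j" for j
    by (simp add: root_of_one_power mult.commute)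
  have "root_of_one M n ^ M = 1"
    using assms by (simp add: root_of_one_power root_of_one_eq_1_iff)
  then show ?thesis
    using assms root_of_one_eq_1_iff [OF assms, of n] by (simp add: pow sum_gp_strict)
qed

text \<open>The chord, of length 2 |sin(t/2)|, is at most the arc.\<close>

lemma norm_cis_minus_1_le: "cmod (cis t - 1) \<le> \<bar>t\<bar>"
proof -
  have "(cmod (cis t - 1))\<^sup>2 = (cos t - 1)\<^sup>2 + (sin t)\<^sup>2"
    by (simp add: cmod_power2)
  also have "\<dots> = 2 - 2 * cos t"
    using sin_cos_squared_add [of t] by (simp add: power2_diff)
  also have "\<dots> = (2 * sin (t / 2))\<^sup>2"
    using cos_double_sin [of "t / 2"] by (simp add: power_mult_distrib)
  finally have "(cmod (cis t - 1))\<^sup>2 = \<bar>2 * sin (t / 2)\<bar>\<^sup>2" by simp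
  then have "cmod (cis t - 1) = \<bar>2 * sin (t / 2)\<bar>"
    by (rule power2_eq_imp_eq) auto
  then show ?thesis
    using abs_sin_x_le_abs_x [of "t / 2"] by (simp add: abs_mult)
qed

text \<open>Lists each point w i as a pole n i times. Multiplicities of at least 1 give N >= M, so
  the list is nonempty once M > 0.\<close>

lemma fraction_coeffs_multiplicities:
  fixes n :: "nat \<Rightarrow> nat"
  assumes "\<And>i. i < M \<Longrightarrow> cmod (w i) = 1" "\<And>i. i < M \<Longrightarrow> n i \<ge> 1"
  shows "\<exists>N b. N \<ge> M \<and> (\<forall>k<N. cmod (b k) = 1) \<and>
    (\<forall>m. fraction_coeffs N b m = (\<Sum>i<M. of_nat (n i) * - (cnj (w i) ^ Suc m)))"
  using assms
proof (induction M)
  case 0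
  show ?case by (rule exI [of _ 0]) (simp add: fraction_coeffs_def)
next
  case (Suc M)
  have "\<And>i. i < M \<Longrightarrow> cmod (w i) = 1" "\<And>i. i < M \<Longrightarrow> n i \<ge> 1"
    using Suc.prems by auto
  from Suc.IH [OF this] obtain N b where N: "N \<ge> M" and b: "\<forall>k<N. cmod (b k) = 1"
    and coef: "\<And>m. fraction_coeffs N b m = (\<Sum>i<M. of_nat (n i) * - (cnj (w i) ^ Suc m))"
    by blast
  define b' where "b' k = (if k < N then b k else w M)" for k
  show ?case
  proof (intro exI conjI allI impI)
    show "Suc M \<le> N + n M" using N Suc.prems(2) [of M] by simp
    show "cmod (b' k) = 1" if "k < N + n M" for k
      using b Suc.prems(1) [of M] by (simp add: b'_def)
    fix m
    have "fraction_coeffs (N + n M) b' m = (\<Sum>k\<in>{..<N} \<union> {N..<N + n M}. - (cnj (b' k) ^ Suc m))"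
      unfolding fraction_coeffs_def by (intro sum.cong) auto
    also have "\<dots> = (\<Sum>k<N. - (cnj (b' k) ^ Suc m)) + (\<Sum>k\<in>{N..<N + n M}. - (cnj (b' k) ^ Suc m))"
      by (rule sum.union_disjoint) auto
    also have "(\<Sum>k<N. - (cnj (b' k) ^ Suc m)) = fraction_coeffs N b m"
      unfolding fraction_coeffs_def by (intro sum.cong) (auto simp: b'_def)
    also have "(\<Sum>k\<in>{N..<N + n M}. - (cnj (b' k) ^ Suc m)) = (\<Sum>k\<in>{N..<N + n M}. - (cnj (w M) ^ Suc m))"
      by (intro sum.cong) (auto simp: b'_def)
    finally show "fraction_coeffs (N + n M) b' m = (\<Sum>i<Suc M. of_nat (n i) * - (cnj (w i) ^ Suc m))"
      by (simp add: coef)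
  qed
qed

section \<open>Elementary sums and a Beta integral\<close>

lemma inverse_square_telescope: "x > 0 \<Longrightarrow> 1 / (x + 1)\<^sup>2 \<le> 1 / x - 1 / (x + 1)" for x :: real
proof -
  assume x: "x > 0"
  have "1 / (x + 1)\<^sup>2 \<le> 1 / (x * (x + 1))"
    using x by (intro divide_left_mono) (auto simp: power2_eq_square)
  also have "\<dots> = 1 / x - 1 / (x + 1)"
    using x by (simp add: field_simps)
  finally show ?thesis .
qed

lemma sum_inverse_squares_le: "(\<Sum>l=1..n. 1 / (real l)\<^sup>2) \<le> 2"
proof -
  have "(\<Sum>l=1..Suc n. 1 / (real l)\<^sup>2) \<le> 2 - 1 / real (Suc n)" for n
  proof (induction n)
    case (Suc n)
    have "1 / (real (Suc (Suc n)))\<^sup>2 \<le> 1 / real (Suc n) - 1 / real (Suc (Suc n))"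
      using inverse_square_telescope [of "real (Suc n)"] by (simp add: add.commute)
    with Suc show ?case by simp
  qed simp
  moreover have "2 - 1 / real (Suc n) \<le> 2" for n by simp
  ultimately have "(\<Sum>l=1..Suc n. 1 / (real l)\<^sup>2) \<le> 2" for n by (rule order_trans)
  then show ?thesis by (cases n) simp_all
qed

text \<open>The first M terms contribute at most M / M^2; the remaining ones telescope to at most
  1/M.\<close>

lemma sum_min_inverse_squares_le:
  assumes "M > 0"
  shows "(\<Sum>m<n. min (1 / (real M)\<^sup>2) (1 / (real (Suc m))\<^sup>2)) \<le> 2 / real M"
proof -
  let ?v = "\<lambda>m. min (1 / (real M)\<^sup>2) (1 / (real (Suc m))\<^sup>2)"
  have small: "(\<Sum>m<n. ?v m) \<le> 1 / real M" if "n \<le> M" for n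
  proof -
    have "(\<Sum>m<n. ?v m) \<le> (\<Sum>m<n. 1 / (real M)\<^sup>2)" by (intro sum_mono) simp
    also have "\<dots> \<le> real M * (1 / (real M)\<^sup>2)" using that by (simp add: divide_right_mono)
    finally show ?thesis using assms by (simp add: power2_eq_square)
  qed
  have large: "(\<Sum>m<M + k. ?v m) \<le> 2 / real M - 1 / real (M + k)" for k
  proof (induction k)
    case 0
    then show ?case using small [of M] by simp
  next
    case (Suc k)
    have "?v (M + k) \<le> 1 / (real (Suc (M + k)))\<^sup>2" by simp
    also have "\<dots> \<le> 1 / real (M + k) - 1 / real (Suc (M + k))"
      using assms inverse_square_telescope [of "real (M + k)"] by (simp add: add.commute)
    finally have "?v (M + k) \<le> 1 / real (M + k) - 1 / real (M + Suc k)" by simp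
    with Suc show ?case by simp
  qed
  show ?thesis
  proof (cases "n \<le> M")
    case True
    have "1 / real M \<le> 2 / real M" by (simp add: divide_right_mono)
    with small [OF True] show ?thesis by (rule order_trans)
  next
    case False
    then have "(\<Sum>m<n. ?v m) \<le> 2 / real M - 1 / real n" using large [of "n - M"] by simp
    also have "\<dots> \<le> 2 / real M" by simp
    finally show ?thesis .
  qed
qed

text \<open>The Beta integral B(2, m + 1), whose exact value is 1 / ((m + 1)(m + 2)).\<close>

lemma beta_integral: "(\<integral>t. indicator {0..1} t *\<^sub>R ((1 - t) ^ m * t) \<partial>lebesgue) \<le> 1 / (real (Suc m))\<^sup>2"
proof -
  define F where "F t = (1 - t) ^ Suc (Suc m) / real (Suc (Suc m)) - (1 - t) ^ Suc m / real (Suc m)" for t :: real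
  have "(F has_real_derivative (1 - t) ^ m * t) (at t within {0..1})" for t
  proof -
    have "(F has_real_derivative (- ((1 - t) ^ Suc m) + (1 - t) ^ m)) (at t within {0..1})"
      unfolding F_def
      by (rule derivative_eq_intros refl | simp del: of_nat_Suc power_Suc)+
    then show ?thesis by (simp add: algebra_simps)
  qed
  then have "(\<integral>t. indicator {0..1} t *\<^sub>R ((1 - t) ^ m * t) \<partial>lborel) = F 1 - F 0"
    by (intro integral_FTC_atLeastAtMost continuous_intros) (auto simp: has_real_derivative_iff_has_vector_derivative)
  also have "\<dots> = 1 / (real (Suc m) * real (Suc (Suc m)))"
    by (simp add: F_def field_simps)
  also have "\<dots> \<le> 1 / (real (Suc m))\<^sup>2"
    unfolding power2_eq_square by (intro divide_left_mono mult_left_mono) auto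
  finally show ?thesis
    by (subst integral_completion) auto
qed

section \<open>Upper bound for moments and rounding of coefficients\<close>

context bergman_weight
begin

text \<open>Below \<delta> the weight is at most (e/2) t and \<open>beta_integral\<close> yields
  half of the bound; beyond \<delta> the factor (1 - t)^m decays geometrically.\<close>

lemma moment_upper_bound:
  assumes o: "g \<in> o[at_right 0](\<lambda>t. t)" and e: "e > 0"
  shows "\<exists>m0. \<forall>m\<ge>m0. moment m \<le> e / (real (Suc m))\<^sup>2"
proof -
  have "eventually (\<lambda>t. norm (g t) \<le> e / 2 * norm t) (at_right 0)"
    using landau_o.smallD [OF o, of "e / 2"] e by simp
  then obtain d where d: "d > 0" and dC: "\<And>t. 0 < t \<Longrightarrow> t < d \<Longrightarrow> \<bar>g t\<bar> \<le> e / 2 * \<bar>t\<bar>"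
    by (auto simp: eventually_at_right_field)
  define \<delta> where "\<delta> = min d 1 / 2"
  have \<delta>: "0 < \<delta>" "\<delta> < d" "\<delta> \<le> 1 / 2" using d by (auto simp: \<delta>_def)
  have bound: "moment m \<le> e / 2 * (1 / (real (Suc m))\<^sup>2) + (1 - \<delta>) ^ m * moment 0" for m
  proof -
    have int1: "integrable lebesgue (\<lambda>t::real. indicator {0..1} t *\<^sub>R ((1 - t) ^ m * t))"
      by (intro integrable_completion [THEN iffD2] borel_integrable_atLeastAtMost' [unfolded set_integrable_def] continuous_intros) auto
    have int0: "integrable lebesgue (\<lambda>t. indicator {0..1} t *\<^sub>R ((1 - t) ^ 0 * g t))"
      using moment_integrable [of 0] by (simp add: set_integrable_def)
    have "moment m \<le> (\<integral>t. e / 2 * (indicator {0..1} t *\<^sub>R ((1 - t) ^ m * t))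
        + (1 - \<delta>) ^ m * (indicator {0..1} t *\<^sub>R ((1 - t) ^ 0 * g t)) \<partial>lebesgue)"
      unfolding moment_def set_lebesgue_integral_def
    proof (rule integral_mono_AE)
      show "integrable lebesgue (\<lambda>t. indicator {0..1} t *\<^sub>R ((1 - t) ^ m * g t))"
        using moment_integrable by (simp add: set_integrable_def)
      show "integrable lebesgue (\<lambda>t. e / 2 * (indicator {0..1} t *\<^sub>R ((1 - t) ^ m * t))
          + (1 - \<delta>) ^ m * (indicator {0..1} t *\<^sub>R ((1 - t) ^ 0 * g t)))"
        using int1 int0 by (intro Bochner_Integration.integrable_add integrable_mult_right)
      have "AE t in lebesgue. t \<noteq> (0::real)"
        by (intro AE_I [where N = "{0}"]) auto
      then show "AE t in lebesgue. indicator {0..1} t *\<^sub>R ((1 - t) ^ m * g t)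
          \<le> e / 2 * (indicator {0..1} t *\<^sub>R ((1 - t) ^ m * t))
          + (1 - \<delta>) ^ m * (indicator {0..1} t *\<^sub>R ((1 - t) ^ 0 * g t))"
      proof eventually_elim
        case (elim t)
        show ?case
        proof (cases "t \<in> {0..1}")
          case True
          with elim have t: "0 < t" "t \<le> 1" by auto
          have gt: "g t > 0" using t by (intro g_pos) auto
          have p1: "0 \<le> (1 - t) ^ m * t" and p2: "0 \<le> (1 - \<delta>) ^ m * g t"
            using t \<delta> gt by auto
          show ?thesis
          proof (cases "t < \<delta>")
            case True
            then have "g t \<le> e / 2 * t" using dC [of t] t \<delta> by auto
            then have "(1 - t) ^ m * g t \<le> (1 - t) ^ m * (e / 2 * t)"
              using t by (intro mult_left_mono) auto
            also have "\<dots> \<le> e / 2 * ((1 - t) ^ m * t) + (1 - \<delta>) ^ m * g t"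
              using p2 by simp
            finally show ?thesis using \<open>t \<in> {0..1}\<close> by simp
          next
            case False
            then have "(1 - t) ^ m * g t \<le> (1 - \<delta>) ^ m * g t"
              using t gt by (intro mult_right_mono power_mono) auto
            also have "\<dots> \<le> e / 2 * ((1 - t) ^ m * t) + (1 - \<delta>) ^ m * g t"
              using p1 e by (simp add: mult_nonneg_nonneg)
            finally show ?thesis using \<open>t \<in> {0..1}\<close> by simp
          qed
        qed simp
      qed
    qed
    also have "\<dots> = e / 2 * (\<integral>t. indicator {0..1} t *\<^sub>R ((1 - t) ^ m * t) \<partial>lebesgue) + (1 - \<delta>) ^ m * moment 0"
      unfolding moment_def set_lebesgue_integral_def
      by (subst Bochner_Integration.integral_add) (use int1 int0 in \<open>auto intro!: integrable_mult_right\<close>)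
    also have "\<dots> \<le> e / 2 * (1 / (real (Suc m))\<^sup>2) + (1 - \<delta>) ^ m * moment 0"
      using e by (intro add_right_mono mult_left_mono beta_integral) auto
    finally show ?thesis .
  qed
  \<comment> \<open>The square root turns (m + 1)^2 (1 - \<delta>)^m into the square of (m + 1) q^m,
    so that the limit of m q^m applies.\<close>
  define q where "q = sqrt (1 - \<delta>)"
  have q: "0 \<le> q" "q < 1" "q\<^sup>2 = 1 - \<delta>" using \<delta> by (auto simp: q_def)
  have "(\<lambda>m. real m * q ^ m + q ^ m) \<longlonglongrightarrow> 0 + 0"
    using q by (intro tendsto_add powser_times_n_limit_0 LIMSEQ_power_zero) auto
  then have "(\<lambda>m. (real m * q ^ m + q ^ m)\<^sup>2 * moment 0) \<longlonglongrightarrow> (0 + 0)\<^sup>2 * moment 0"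
    by (intro tendsto_mult tendsto_power tendsto_const)
  then have "(\<lambda>m. (real m * q ^ m + q ^ m)\<^sup>2 * moment 0) \<longlonglongrightarrow> 0" by simp
  then have "eventually (\<lambda>m. (real m * q ^ m + q ^ m)\<^sup>2 * moment 0 < e / 2) sequentially"
    using e by (intro order_tendstoD(2)) auto
  then obtain m0 where m0: "\<And>m. m \<ge> m0 \<Longrightarrow> (real m * q ^ m + q ^ m)\<^sup>2 * moment 0 < e / 2"
    by (auto simp: eventually_sequentially)
  have "moment m \<le> e / (real (Suc m))\<^sup>2" if "m \<ge> m0" for m
  proof -
    have "(real m * q ^ m + q ^ m)\<^sup>2 = (real (Suc m))\<^sup>2 * (1 - \<delta>) ^ m"
    proof -
      have "real m * q ^ m + q ^ m = real (Suc m) * q ^ m" by (simp add: algebra_simps)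
      then show ?thesis by (simp only: power_mult_distrib q(3) [symmetric] power_mult [symmetric] mult.commute)
    qed
    then have "(real (Suc m))\<^sup>2 * ((1 - \<delta>) ^ m * moment 0) < e / 2"
      using m0 [OF that] by (simp add: mult.assoc)
    then have "(1 - \<delta>) ^ m * moment 0 \<le> e / 2 * (1 / (real (Suc m))\<^sup>2)"
      by (simp add: field_simps)
    then show ?thesis using bound [of m] by simp
  qed
  then show ?thesis by blast
qed

lemma energy_le:
  assumes "\<And>n. (\<Sum>m<n. (cmod (a m))\<^sup>2 * moment m) \<le> B"
  shows "finite_energy a" "energy a \<le> B"
proof -
  show fin: "finite_energy a"
    unfolding finite_energy_def by (rule summableI_nonneg_bounded [OF _ assms]) (use moment_nonneg in auto)
  show "energy a \<le> B"
    using fin assms unfolding finite_energy_def energy_def by (intro suminf_le_const)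
qed

lemma finite_energy_scale: "finite_energy a \<Longrightarrow> finite_energy (\<lambda>m. c * a m)"
  unfolding finite_energy_def by (simp add: norm_mult power_mult_distrib mult.assoc summable_mult)

lemma energy_scale: "finite_energy a \<Longrightarrow> energy (\<lambda>m. c * a m) = (cmod c)\<^sup>2 * energy a"
  unfolding finite_energy_def energy_def by (simp add: norm_mult power_mult_distrib mult.assoc suminf_mult)

text \<open>Variance identity: adding to u the vector -\<delta> x with probability 1 - \<delta> and
  (1 - \<delta>) x with probability \<delta> is a perturbation of mean zero and variance \<delta>(1
  - \<delta>).\<close>

lemma energy_convex:
  fixes \<delta> :: real
  assumes u: "finite_energy u" and x: "finite_energy x"
  shows "(1 - \<delta>) * energy (\<lambda>m. u m - of_real \<delta> * x m) + \<delta> * energy (\<lambda>m. u m + of_real (1 - \<delta>) * x m)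
     = energy u + \<delta> * (1 - \<delta>) * energy x"
proof -
  have fin: "finite_energy (\<lambda>m. u m - of_real \<delta> * x m)" "finite_energy (\<lambda>m. u m + of_real (1 - \<delta>) * x m)"
    by (intro finite_energy_diff energy_add finite_energy_scale u x)+
  have id: "(1 - \<delta>) * (cmod (v - of_real \<delta> * y))\<^sup>2 + \<delta> * (cmod (v + of_real (1 - \<delta>) * y))\<^sup>2
      = (cmod v)\<^sup>2 + \<delta> * (1 - \<delta>) * (cmod y)\<^sup>2" for v y
    unfolding cmod_power2 by (simp add: power2_eq_square algebra_simps)
  have "(1 - \<delta>) * energy (\<lambda>m. u m - of_real \<delta> * x m) + \<delta> * energy (\<lambda>m. u m + of_real (1 - \<delta>) * x m)
      = (\<Sum>m. (1 - \<delta>) * ((cmod (u m - of_real \<delta> * x m))\<^sup>2 * moment m) + \<delta> * ((cmod (u m + of_real (1 - \<delta>) * x m))\<^sup>2 * moment m))"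
    using fin unfolding finite_energy_def energy_def
    by (simp only: suminf_mult [symmetric] suminf_add summable_mult)
  also have "\<dots> = (\<Sum>m. (cmod (u m))\<^sup>2 * moment m + \<delta> * (1 - \<delta>) * ((cmod (x m))\<^sup>2 * moment m))"
    by (simp only: mult.assoc [symmetric] distrib_right [symmetric] id)
  also have "\<dots> = energy u + \<delta> * (1 - \<delta>) * energy x"
    using u x unfolding finite_energy_def energy_def
    by (simp only: suminf_mult [symmetric] suminf_add summable_mult)
  finally show ?thesis .
qed

lemma finite_energy_sum: "(\<And>j. j \<in> A \<Longrightarrow> finite_energy (x j)) \<Longrightarrow> finite_energy (\<lambda>m. \<Sum>j\<in>A. x j m)"
proof (induction A rule: infinite_finite_induct)
  case (insert j A)
  then show ?case using energy_add(1) [of "x j" "\<lambda>m. \<Sum>j\<in>A. x j m"] by simp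
qed (simp_all add: finite_energy_def)

text \<open>Greedy rounding: by \<open>energy_convex\<close>, one of the two integers next to a real coefficient does
  not raise the energy by more than that of the new vector.\<close>

lemma energy_rounding:
  fixes t :: "nat \<Rightarrow> real"
  assumes x: "\<And>j. finite_energy (x j)"
  shows "\<exists>L :: nat \<Rightarrow> int. (\<forall>j. \<bar>of_int (L j) - t j\<bar> < 1) \<and>
    energy (\<lambda>m. \<Sum>j<n. of_real (of_int (L j) - t j) * x j m) \<le> (\<Sum>j<n. energy (x j))"
proof (induction n)
  case 0
  show ?case
    by (intro exI [of _ "\<lambda>j. \<lfloor>t j\<rfloor>"]) (auto simp: energy_def, linarith)
next
  case (Suc n)
  then obtain L :: "nat \<Rightarrow> int" where L: "\<And>j. \<bar>of_int (L j) - t j\<bar> < 1"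
    and eL: "energy (\<lambda>m. \<Sum>j<n. of_real (of_int (L j) - t j) * x j m) \<le> (\<Sum>j<n. energy (x j))"
    by blast
  define u where "u = (\<lambda>m. \<Sum>j<n. of_real (of_int (L j) - t j) * x j m)"
  have u: "finite_energy u"
    unfolding u_def by (intro finite_energy_sum finite_energy_scale x)
  have step: ?case if k: "\<bar>of_int k - t n\<bar> < 1"
    and ek: "energy (\<lambda>m. u m + of_real (of_int k - t n) * x n m) \<le> energy u + energy (x n)" for k :: int
  proof (intro exI conjI allI)
    let ?L = "L(n := k)"
    show "\<bar>of_int (?L j) - t j\<bar> < 1" for j using L k by simp
    have "(\<Sum>j<n. of_real (of_int (?L j) - t j) * x j m) = u m" for m
      unfolding u_def by (intro sum.cong) auto
    then have "(\<lambda>m. \<Sum>j<Suc n. of_real (of_int (?L j) - t j) * x j m) = (\<lambda>m. u m + of_real (of_int k - t n) * x n m)"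
      by (simp only: sum.lessThan_Suc fun_upd_same)
    then show "energy (\<lambda>m. \<Sum>j<Suc n. of_real (of_int (?L j) - t j) * x j m) \<le> (\<Sum>j<Suc n. energy (x j))"
      using ek eL by (simp add: u_def)
  qed
  \<comment> \<open>Rounding down leaves the error -\<delta>, rounding up the error 1 - \<delta>:
    the two alternatives in \<open>energy_convex\<close>.\<close>
  define \<delta> where "\<delta> = frac (t n)"
  have \<delta>: "0 \<le> \<delta>" "\<delta> < 1" unfolding \<delta>_def by (auto simp: frac_lt_1)
  have lo: "of_int \<lfloor>t n\<rfloor> - t n = - \<delta>" and hi: "of_int (\<lfloor>t n\<rfloor> + 1) - t n = 1 - \<delta>"
    by (auto simp: \<delta>_def frac_def)
  note cvx = energy_convex [OF u x, of \<delta> n]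
  show ?case
  proof (cases "energy (\<lambda>m. u m - of_real \<delta> * x n m) \<le> energy u + energy (x n)")
    case True
    show ?thesis
      by (rule step [of "\<lfloor>t n\<rfloor>"]) (use True \<delta> in \<open>simp_all add: lo del: of_real_diff\<close>)
  next
    case False
    \<comment> \<open>If rounding down costs more than allowed, the weighted mean forces rounding up
      to cost less. Its weight \<delta> is nonzero, for otherwise rounding down would be
      free.\<close>
    have "\<delta> * energy (\<lambda>m. u m + of_real (1 - \<delta>) * x n m) \<le> \<delta> * (energy u + energy (x n))"
    proof -
      have "(1 - \<delta>) * (energy u + energy (x n)) \<le> (1 - \<delta>) * energy (\<lambda>m. u m - of_real \<delta> * x n m)"
        using False \<delta> by (intro mult_left_mono) auto
      moreover have "\<delta> * (1 - \<delta>) * energy (x n) \<le> 1 * energy (x n)"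
        using \<delta> energy_nonneg [OF x] by (intro mult_right_mono mult_le_one) auto
      ultimately show ?thesis using cvx by (simp add: algebra_simps)
    qed
    moreover have "\<delta> \<noteq> 0"
    proof
      assume "\<delta> = 0"
      then show False using False energy_nonneg [OF x, of n] by simp
    qed
    ultimately have le: "energy (\<lambda>m. u m + of_real (1 - \<delta>) * x n m) \<le> energy u + energy (x n)"
      using \<delta> by simp
    show ?thesis
    proof (rule step [of "\<lfloor>t n\<rfloor> + 1"])
      show "\<bar>of_int (\<lfloor>t n\<rfloor> + 1) - t n\<bar> < 1"
        unfolding hi using \<delta> \<open>\<delta> \<noteq> 0\<close> by simp
      show "energy (\<lambda>m. u m + of_real (of_int (\<lfloor>t n\<rfloor> + 1) - t n) * x n m) \<le> energy u + energy (x n)"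
        unfolding hi by (rule le)
    qed
  qed
qed

end

section \<open>Fractions at the roots of unity and the discretized Taylor polynomial\<close>

definition root_fraction_coeffs :: "nat \<Rightarrow> nat \<Rightarrow> nat \<Rightarrow> complex" where
  "root_fraction_coeffs M j m = - (cnj (root_of_one M (int j)) ^ Suc m)"

lemma root_fraction_coeffs_altdef:
  "root_fraction_coeffs M j m = - root_of_one M (int j * - int (Suc m))"
  by (simp only: root_fraction_coeffs_def cnj_root_of_one root_of_one_power mult_minus_left mult_minus_right)

lemma norm_root_fraction_coeffs [simp]: "cmod (root_fraction_coeffs M j m) = 1"
  by (simp add: root_fraction_coeffs_altdef)

lemma sum_root_fraction_coeffs:
  "M > 0 \<Longrightarrow> (\<Sum>j<M. root_fraction_coeffs M j m) = (if M dvd Suc m then - of_nat M else 0)"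
  using sum_root_of_one [of M "- int (Suc m)"] int_dvd_int_iff [of M "Suc m"]
  unfolding root_fraction_coeffs_altdef sum_negf by (simp only: dvd_minus_iff) simp

text \<open>Neighbouring coefficients differ by a factor z of modulus 1 with |z - 1| at most 2 and
  at most 2 pi (m + 1)/M; the constant 4 pi^2 covers both squares. For j = 0 truncated subtraction
  makes the difference vanish.\<close>

lemma norm_root_fraction_coeffs_diff:
  assumes "M > 0"
  shows "(cmod (root_fraction_coeffs M j m - root_fraction_coeffs M (j - 1) m))\<^sup>2
     \<le> 4 * pi\<^sup>2 * min 1 ((real (Suc m) / real M)\<^sup>2)"
proof (cases j)
  case 0
  then show ?thesis by simp
next
  case (Suc i)
  define z where "z = root_of_one M (- int (Suc m))"
  have "root_fraction_coeffs M (Suc i) m = root_fraction_coeffs M i m * z"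
    by (simp only: root_fraction_coeffs_altdef z_def mult_minus_left root_of_one_add [symmetric])
      (simp add: algebra_simps)
  then have "root_fraction_coeffs M j m - root_fraction_coeffs M (j - 1) m = root_fraction_coeffs M i m * (z - 1)"
    by (simp add: Suc algebra_simps)
  then have eq: "cmod (root_fraction_coeffs M j m - root_fraction_coeffs M (j - 1) m) = cmod (z - 1)"
    by (simp add: norm_mult)
  have "cmod (z - 1) \<le> cmod z + cmod 1" by (rule norm_triangle_ineq4)
  also have "\<dots> \<le> 2 * pi" using pi_ge_two by (simp add: z_def)
  finally have "(cmod (z - 1))\<^sup>2 \<le> (2 * pi)\<^sup>2" by (intro power_mono) auto
  then have 1: "(cmod (z - 1))\<^sup>2 \<le> 4 * pi\<^sup>2 * 1" by (simp add: power_mult_distrib)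
  define r where "r = real (Suc m) / real M"
  have "cmod (z - 1) \<le> 2 * pi * r"
    using norm_cis_minus_1_le [of "2 * pi * real_of_int (- int (Suc m)) / real M"]
    by (simp add: z_def r_def root_of_one_def abs_mult add.commute)
  then have "(cmod (z - 1))\<^sup>2 \<le> (2 * pi * r)\<^sup>2" by (intro power_mono) auto
  then have 2: "(cmod (z - 1))\<^sup>2 \<le> 4 * pi\<^sup>2 * r\<^sup>2" by (simp add: power_mult_distrib)
  show ?thesis
    unfolding eq r_def [symmetric] min_def using 1 2 by (cases "1 \<le> r\<^sup>2") (simp_all only: if_True if_False)
qed

text \<open>Summation by parts; the zeros of D at both ends remove the boundary terms. In the sum on
  the right the terms j = 0 and j = M vanish, so truncation in \<open>j - 1\<close> is
  harmless.\<close>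

lemma abel_summation:
  fixes D \<gamma> :: "nat \<Rightarrow> complex"
  assumes "D 0 = 0" "D M = 0"
  shows "(\<Sum>i<M. (D (Suc i) - D i) * \<gamma> i) = - (\<Sum>j<Suc M. D j * (\<gamma> j - \<gamma> (j - 1)))"
proof -
  have "(\<Sum>i<n. (D (Suc i) - D i) * \<gamma> i) + (\<Sum>i<n. D (Suc i) * (\<gamma> (Suc i) - \<gamma> i)) = D n * \<gamma> n" for n
    by (induction n) (simp_all add: assms(1) algebra_simps)
  from this [of M] have "(\<Sum>i<M. (D (Suc i) - D i) * \<gamma> i) = - (\<Sum>i<M. D (Suc i) * (\<gamma> (Suc i) - \<gamma> i))"
    by (simp add: assms(2) eq_neg_iff_add_eq_0)
  then show ?thesis
    unfolding sum.lessThan_Suc_shift by (simp add: assms(1))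
qed

text \<open>Without the real part, the weights would reproduce the Taylor polynomial with coefficients c up to
  aliasing modulo M. Taking the real part only adds the conjugate, negative frequencies, which are
  aliased to Taylor coefficients of order about M.\<close>

definition target_weight :: "(nat \<Rightarrow> complex) \<Rightarrow> nat \<Rightarrow> nat \<Rightarrow> nat \<Rightarrow> real" where
  "target_weight c d M j = - (2 / real M) * Re (\<Sum>k<d. c k * root_of_one M (int j * int (Suc k)))"

lemma target_weight_le:
  "\<bar>target_weight c d M j\<bar> \<le> 2 / real M * (\<Sum>k<d. cmod (c k))"
proof -
  have "\<bar>Re (\<Sum>k<d. c k * root_of_one M (int j * int (Suc k)))\<bar> \<le> (\<Sum>k<d. cmod (c k))"
    by (rule order_trans [OF abs_Re_le_cmod], rule sum_norm_le) (simp add: norm_mult)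
  then show ?thesis
    unfolding target_weight_def abs_mult by (intro mult_mono) auto
qed

text \<open>The frequencies 1, ..., d are not multiples of M. Total 0 lets the partial sums of the
  weights return to 0, as \<open>abel_summation\<close> demands at the end point.\<close>

lemma sum_target_weight:
  assumes "d < M"
  shows "(\<Sum>j<M. target_weight c d M j) = 0"
proof -
  have "\<not> int M dvd int (Suc k)" if "k < d" for k
    using that assms int_dvd_int_iff [of M "Suc k"] by (auto dest: dvd_imp_le simp del: of_nat_Suc)
  then have "(\<Sum>k<d. c k * (\<Sum>j<M. root_of_one M (int j * int (Suc k)))) = 0"
    using assms by (intro sum.neutral) (simp add: sum_root_of_one del: of_nat_Suc)
  then have "(\<Sum>j<M. \<Sum>k<d. c k * root_of_one M (int j * int (Suc k))) = 0"
    unfolding sum_distrib_left by (subst sum.swap)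
  then have "Re (\<Sum>j<M. \<Sum>k<d. c k * root_of_one M (int j * int (Suc k))) = 0"
    by (simp only: zero_complex.sel)
  then show ?thesis
    unfolding target_weight_def sum_distrib_left [symmetric] Re_sum by simp
qed

text \<open>Uniform in m and M; it controls the high orders, where aliasing spoils the exact formula
  \<open>target_weight_coeffs\<close>.\<close>

lemma target_weight_coeffs_le:
  assumes "M > 0"
  shows "cmod (\<Sum>j<M. of_real (target_weight c d M j) * root_fraction_coeffs M j m) \<le> 2 * (\<Sum>k<d. cmod (c k))"
proof -
  have "cmod (\<Sum>j<M. of_real (target_weight c d M j) * root_fraction_coeffs M j m)
      \<le> (\<Sum>j<M. 2 / real M * (\<Sum>k<d. cmod (c k)))"
    by (rule sum_norm_le) (use target_weight_le in \<open>simp add: norm_mult\<close>)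
  then show ?thesis using assms by simp
qed

text \<open>Against coefficient m the weights have frequencies k - m and, from the conjugate part,
  -(k + m + 2). For k < d and m + d + 1 < M the first is a multiple of M only when k = m, the second
  never, as 0 < k + m + 2 < M.\<close>

lemma target_weight_coeffs:
  assumes M: "m + d + 1 < M" and c: "\<And>k. k \<ge> d \<Longrightarrow> c k = 0"
  shows "(\<Sum>j<M. of_real (target_weight c d M j) * root_fraction_coeffs M j m) = c m"
proof -
  \<comment> \<open>The factor -2 in \<open>target_weight\<close> offsets this 1/2 and the minus
    sign in \<open>root_fraction_coeffs_altdef\<close>.\<close>
  have Re: "complex_of_real (Re z) = (z + cnj z) / 2" for z
    by (simp add: complex_eq_iff)
  have "of_real (target_weight c d M j) * root_fraction_coeffs M j m
      = (\<Sum>k<d. c k / of_nat M * root_of_one M (int j * (int k - int m))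
          + cnj (c k) / of_nat M * root_of_one M (int j * - (int k + int m + 2)))" for j
  proof -
    have a: "root_of_one M (int j * int (Suc k)) * root_of_one M (int j * - int (Suc m)) = root_of_one M (int j * (int k - int m))" for k
      unfolding root_of_one_add [symmetric]
      by (rule arg_cong [of _ _ "root_of_one M"]) (simp add: algebra_simps)
    have b: "cnj (root_of_one M (int j * int (Suc k))) * root_of_one M (int j * - int (Suc m)) = root_of_one M (int j * - (int k + int m + 2))" for k
      unfolding root_of_one_add [symmetric] cnj_root_of_one
      by (rule arg_cong [of _ _ "root_of_one M"]) (simp add: algebra_simps)
    have scale: "of_real (- (2 / real M)) * ((A + B) / 2) * - R = (1 / of_nat M) * (A + B) * R" for A B R :: complex
      using M by (simp add: field_simps)
    have "of_real (target_weight c d M j) * root_fraction_coeffs M j m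
      = (1 / of_nat M) * ((\<Sum>k<d. c k * root_of_one M (int j * int (Suc k))) + (\<Sum>k<d. cnj (c k) * cnj (root_of_one M (int j * int (Suc k)))))
          * root_of_one M (int j * - int (Suc m))"
      unfolding target_weight_def root_fraction_coeffs_altdef of_real_mult Re cnj_sum complex_cnj_mult by (rule scale)
    also have "\<dots> = (\<Sum>k<d. c k / of_nat M * (root_of_one M (int j * int (Suc k)) * root_of_one M (int j * - int (Suc m)))
          + cnj (c k) / of_nat M * (cnj (root_of_one M (int j * int (Suc k))) * root_of_one M (int j * - int (Suc m))))"
      unfolding sum.distrib [symmetric] sum_distrib_left sum_distrib_right
      by (intro sum.cong refl) (simp add: add_divide_distrib ring_distribs mult_ac del: of_nat_Suc mult_minus_right)
    finally show ?thesis unfolding a b .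
  qed
  then have "(\<Sum>j<M. of_real (target_weight c d M j) * root_fraction_coeffs M j m)
      = (\<Sum>k<d. \<Sum>j<M. c k / of_nat M * root_of_one M (int j * (int k - int m))
          + cnj (c k) / of_nat M * root_of_one M (int j * - (int k + int m + 2)))"
    by (subst sum.swap) (intro sum.cong refl)
  also have "\<dots> = (\<Sum>k<d. if k = m then c k else 0)"
  proof (rule sum.cong)
    fix k assume "k \<in> {..<d}"
    then have k: "k < d" by simp
    have 1: "int M dvd int k - int m \<longleftrightarrow> k = m"
    proof
      assume dvd: "int M dvd int k - int m"
      show "k = m"
      proof (rule ccontr)
        assume "k \<noteq> m"
        then have "int k - int m \<noteq> 0" by simp
        with dvd have "\<bar>int M\<bar> \<le> \<bar>int k - int m\<bar>" by (rule dvd_imp_le_int [rotated])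
        then show False using k M by linarith
      qed
    qed simp
    have 2: "\<not> int M dvd - (int k + int m + 2)"
      unfolding dvd_minus_iff using k M by (intro zdvd_not_zless) linarith+
    show "(\<Sum>j<M. c k / of_nat M * root_of_one M (int j * (int k - int m))
          + cnj (c k) / of_nat M * root_of_one M (int j * - (int k + int m + 2))) = (if k = m then c k else 0)"
      unfolding sum.distrib sum_distrib_left [symmetric]
      using M 1 2 by (subst (1 2) sum_root_of_one) (auto simp del: minus_add_distrib)
  qed simp
  also have "\<dots> = c m" using c by (simp add: sum.delta)
  finally show ?thesis .
qed

section \<open>Energy estimates at the roots of unity and approximation\<close>

context bergman_weight
begin

text \<open>Finitely many orders below m0 contribute at most A/M^2. Beyond m0 the bound (e/4)/(m +
  1)^2 on the moment reduces the sum to \<open>sum_min_inverse_squares_le\<close>.\<close>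

lemma moment_kernel_sum:
  assumes o: "g \<in> o[at_right 0](\<lambda>t. t)" and e: "e > 0"
  shows "\<exists>M0>0. \<forall>M\<ge>M0. \<forall>n. real M * (\<Sum>m<n. moment m * min 1 ((real (Suc m) / real M)\<^sup>2)) \<le> e"
proof -
  obtain m0 where m0: "\<And>m. m \<ge> m0 \<Longrightarrow> moment m \<le> (e / 4) / (real (Suc m))\<^sup>2"
    using moment_upper_bound [OF o, of "e / 4"] e by auto
  define f where "f m = moment m * (real (Suc m))\<^sup>2" for m
  define A where "A = (\<Sum>m<m0. f m)"
  have A: "A \<ge> 0" unfolding A_def f_def using moment_nonneg by (intro sum_nonneg) auto
  \<comment> \<open>Ensures A/M <= e/2 for M >= M0; the other orders account for the remaining
    e/2.\<close>
  define M0 where "M0 = nat \<lceil>2 * A / e\<rceil> + 1"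
  have "real M * (\<Sum>m<n. moment m * min 1 ((real (Suc m) / real M)\<^sup>2)) \<le> e" if "M \<ge> M0" for M n
  proof -
    have M: "M > 0" "2 * A / e \<le> real M" using that unfolding M0_def by linarith+
    have "(\<Sum>m<n. moment m * min 1 ((real (Suc m) / real M)\<^sup>2))
        \<le> (\<Sum>m<n. (if m < m0 then f m / (real M)\<^sup>2 else 0) + e / 4 * min (1 / (real M)\<^sup>2) (1 / (real (Suc m))\<^sup>2))"
    proof (rule sum_mono)
      fix m
      show "moment m * min 1 ((real (Suc m) / real M)\<^sup>2)
         \<le> (if m < m0 then f m / (real M)\<^sup>2 else 0) + e / 4 * min (1 / (real M)\<^sup>2) (1 / (real (Suc m))\<^sup>2)"
      proof (cases "m < m0")
        case True
        have "moment m * min 1 ((real (Suc m) / real M)\<^sup>2) \<le> moment m * (real (Suc m) / real M)\<^sup>2"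
          using moment_nonneg by (intro mult_left_mono) auto
        moreover have "e / 4 * min (1 / (real M)\<^sup>2) (1 / (real (Suc m))\<^sup>2) \<ge> 0" using e by simp
        ultimately show ?thesis using True by (simp add: f_def power_divide)
      next
        case False
        have "moment m * min 1 ((real (Suc m) / real M)\<^sup>2) \<le> (e / 4) / (real (Suc m))\<^sup>2 * min 1 ((real (Suc m) / real M)\<^sup>2)"
          using m0 False by (intro mult_right_mono) auto
        also have "\<dots> = e / 4 * min (1 / (real M)\<^sup>2) (1 / (real (Suc m))\<^sup>2)"
        proof -
          have "1 / (real (Suc m))\<^sup>2 * min 1 ((real (Suc m) / real M)\<^sup>2)
              = min (1 / (real (Suc m))\<^sup>2 * 1) (1 / (real (Suc m))\<^sup>2 * (real (Suc m) / real M)\<^sup>2)"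
            by (rule min_mult_distrib_left [THEN trans]) simp
          also have "\<dots> = min (1 / (real M)\<^sup>2) (1 / (real (Suc m))\<^sup>2)"
            by (simp add: power_divide min.commute del: of_nat_Suc)
          finally show ?thesis by (simp add: field_simps del: of_nat_Suc)
        qed
        finally show ?thesis using False by simp
      qed
    qed
    also have "\<dots> = (\<Sum>m<n. if m < m0 then f m / (real M)\<^sup>2 else 0) + e / 4 * (\<Sum>m<n. min (1 / (real M)\<^sup>2) (1 / (real (Suc m))\<^sup>2))"
      by (simp add: sum.distrib sum_distrib_left)
    also have "\<dots> \<le> A / (real M)\<^sup>2 + e / 4 * (2 / real M)"
    proof (intro add_mono mult_left_mono sum_min_inverse_squares_le M)
      have "(\<Sum>m<n. if m < m0 then f m / (real M)\<^sup>2 else 0) = (\<Sum>m\<in>{..<n} \<inter> {m. m < m0}. f m / (real M)\<^sup>2)"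
        by (subst sum.If_cases) auto
      also have "\<dots> \<le> (\<Sum>m<m0. f m / (real M)\<^sup>2)"
        using moment_nonneg by (intro sum_mono2) (auto simp: f_def)
      finally show "(\<Sum>m<n. if m < m0 then f m / (real M)\<^sup>2 else 0) \<le> A / (real M)\<^sup>2"
        by (simp add: A_def sum_divide_distrib)
    qed (use e in auto)
    finally have "real M * (\<Sum>m<n. moment m * min 1 ((real (Suc m) / real M)\<^sup>2)) \<le> real M * (A / (real M)\<^sup>2 + e / 4 * (2 / real M))"
      by (intro mult_left_mono) auto
    also have "\<dots> = A / real M + e / 2"
      using M by (simp add: power2_eq_square field_simps)
    also have "\<dots> \<le> e"
      using M e by (simp add: field_simps)
    finally show ?thesis .
  qed
  moreover have "M0 > 0" by (simp add: M0_def)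
  ultimately show ?thesis by blast
qed

text \<open>Only orders with m + 1 = l M survive, each with coefficient of modulus M and moment at
  most (e/2)/(l M)^2. The energy is at most e/2 times the sum of 1/l^2.\<close>

lemma energy_all_roots:
  assumes o: "g \<in> o[at_right 0](\<lambda>t. t)" and e: "e > 0"
  shows "\<exists>M0>0. \<forall>M\<ge>M0. finite_energy (\<lambda>m. \<Sum>j<M. root_fraction_coeffs M j m) \<and>
    energy (\<lambda>m. \<Sum>j<M. root_fraction_coeffs M j m) \<le> e"
proof -
  obtain m0 where m0: "\<And>m. m \<ge> m0 \<Longrightarrow> moment m \<le> (e / 2) / (real (Suc m))\<^sup>2"
    using moment_upper_bound [OF o, of "e / 2"] e by auto
  have "finite_energy (\<lambda>m. \<Sum>j<M. root_fraction_coeffs M j m) \<and>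
    energy (\<lambda>m. \<Sum>j<M. root_fraction_coeffs M j m) \<le> e" if M: "M \<ge> Suc m0" for M
  proof -
    have le: "(\<Sum>m<n. (cmod (\<Sum>j<M. root_fraction_coeffs M j m))\<^sup>2 * moment m) \<le> e" for n
    proof -
      have "(\<Sum>m<n. (cmod (\<Sum>j<M. root_fraction_coeffs M j m))\<^sup>2 * moment m)
          = (\<Sum>m<n. if M dvd Suc m then (real M)\<^sup>2 * moment m else 0)"
        using M by (intro sum.cong) (auto simp: sum_root_fraction_coeffs)
      also have "\<dots> = (\<Sum>m\<in>{m\<in>{..<n}. M dvd Suc m}. (real M)\<^sup>2 * moment m)"
        by (rule sum.inter_filter [symmetric]) simp
      also have "\<dots> \<le> (\<Sum>m\<in>{m\<in>{..<n}. M dvd Suc m}. e / 2 * ((real M)\<^sup>2 / (real (Suc m))\<^sup>2))"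
      proof (rule sum_mono)
        fix m assume "m \<in> {m\<in>{..<n}. M dvd Suc m}"
        then have "M \<le> Suc m" by (auto dest: dvd_imp_le)
        then have "(real M)\<^sup>2 * moment m \<le> (real M)\<^sup>2 * ((e / 2) / (real (Suc m))\<^sup>2)"
          using M by (intro mult_left_mono m0) auto
        then show "(real M)\<^sup>2 * moment m \<le> e / 2 * ((real M)\<^sup>2 / (real (Suc m))\<^sup>2)"
          by (simp add: mult.commute del: of_nat_Suc)
      qed
      also have "\<dots> \<le> (\<Sum>m\<in>(\<lambda>l. l * M - 1) ` {1..n}. e / 2 * ((real M)\<^sup>2 / (real (Suc m))\<^sup>2))"
      proof (rule sum_mono2)
        show "{m\<in>{..<n}. M dvd Suc m} \<subseteq> (\<lambda>l. l * M - 1) ` {1..n}"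
        proof
          fix m assume "m \<in> {m\<in>{..<n}. M dvd Suc m}"
          then obtain l where m: "m < n" "Suc m = M * l" by auto
          then have "l \<ge> 1" by (cases l) auto
          moreover have "l \<le> n"
          proof -
            have "l \<le> M * l" using M by simp
            then show ?thesis using m by linarith
          qed
          moreover have "m = l * M - 1" using m by (simp add: mult.commute flip: m(2))
          ultimately show "m \<in> (\<lambda>l. l * M - 1) ` {1..n}" by auto
        qed
      qed (use e in auto)
      also have "\<dots> \<le> (\<Sum>l\<in>{1..n}. e / 2 * ((real M)\<^sup>2 / (real (Suc (l * M - 1)))\<^sup>2))"
        using e by (intro sum_image_le [of _ _ "\<lambda>l. l * M - 1", unfolded o_def]) auto
      also have "\<dots> = (\<Sum>l\<in>{1..n}. e / 2 * (1 / (real l)\<^sup>2))"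
      proof (rule sum.cong)
        fix l assume "l \<in> {1..n}"
        then have "Suc (l * M - 1) = l * M" using M by simp
        then show "e / 2 * ((real M)\<^sup>2 / (real (Suc (l * M - 1)))\<^sup>2) = e / 2 * (1 / (real l)\<^sup>2)"
          using M by (simp only: of_nat_mult power_mult_distrib) simp
      qed simp
      also have "\<dots> \<le> e / 2 * 2"
        unfolding sum_distrib_left [symmetric] using e by (intro mult_left_mono sum_inverse_squares_le) auto
      finally show ?thesis by simp
    qed
    show ?thesis by (rule conjI [OF energy_le(1) [OF le] energy_le(2) [OF le]])
  qed
  then show ?thesis by blast
qed

text \<open>By \<open>moment_kernel_sum\<close> each difference has energy O(e'/M), and there are M
  + 1 <= 2M of them.\<close>

lemma energy_root_differences:
  assumes o: "g \<in> o[at_right 0](\<lambda>t. t)" and e: "e > 0"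
  shows "\<exists>M0>0. \<forall>M\<ge>M0.
    (\<Sum>j<Suc M. energy (\<lambda>m. root_fraction_coeffs M j m - root_fraction_coeffs M (j - 1) m)) \<le> e"
proof -
  define e' where "e' = e / (8 * pi\<^sup>2)"
  have e': "e' > 0" using e by (simp add: e'_def)
  obtain M0 where M0: "M0 > 0"
    and K: "\<And>M n. M \<ge> M0 \<Longrightarrow> real M * (\<Sum>m<n. moment m * min 1 ((real (Suc m) / real M)\<^sup>2)) \<le> e'"
    using moment_kernel_sum [OF o e'] by blast
  have "(\<Sum>j<Suc M. energy (\<lambda>m. root_fraction_coeffs M j m - root_fraction_coeffs M (j - 1) m)) \<le> e" if "M \<ge> M0" for M
  proof -
    have M: "M > 0" using that M0 by simp
    have "energy (\<lambda>m. root_fraction_coeffs M j m - root_fraction_coeffs M (j - 1) m) \<le> 4 * pi\<^sup>2 * (e' / real M)" for j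
    proof (rule energy_le)
      fix n
      have "(\<Sum>m<n. (cmod (root_fraction_coeffs M j m - root_fraction_coeffs M (j - 1) m))\<^sup>2 * moment m)
          \<le> (\<Sum>m<n. (4 * pi\<^sup>2 * min 1 ((real (Suc m) / real M)\<^sup>2)) * moment m)"
        using M by (intro sum_mono mult_right_mono norm_root_fraction_coeffs_diff moment_nonneg)
      also have "\<dots> = 4 * pi\<^sup>2 * (\<Sum>m<n. moment m * min 1 ((real (Suc m) / real M)\<^sup>2))"
        by (simp add: sum_distrib_left mult_ac)
      also have "\<dots> \<le> 4 * pi\<^sup>2 * (e' / real M)"
        using K [OF that, of n] M by (intro mult_left_mono) (auto simp: field_simps)
      finally show "(\<Sum>m<n. (cmod (root_fraction_coeffs M j m - root_fraction_coeffs M (j - 1) m))\<^sup>2 * moment m) \<le> 4 * pi\<^sup>2 * (e' / real M)" .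
    qed
    then have "(\<Sum>j<Suc M. energy (\<lambda>m. root_fraction_coeffs M j m - root_fraction_coeffs M (j - 1) m))
        \<le> (\<Sum>j<Suc M. 4 * pi\<^sup>2 * (e' / real M))"
      by (intro sum_mono)
    also have "\<dots> = real (Suc M) * (4 * pi\<^sup>2 * (e' / real M))" by simp
    also have "\<dots> \<le> (2 * real M) * (4 * pi\<^sup>2 * (e' / real M))"
      using M e' by (intro mult_right_mono) auto
    also have "\<dots> = e" using M by (simp add: e'_def)
    finally show ?thesis .
  qed
  then show ?thesis using M0 by blast
qed

text \<open>Orders below J are reproduced exactly; from J on the errors are bounded by 3C and meet a
  small tail of the summable moments.\<close>

lemma energy_target_error:
  assumes e: "e > 0" and c: "\<And>k. k \<ge> d \<Longrightarrow> c k = 0"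
  shows "\<exists>M0>0. \<forall>M\<ge>M0.
    finite_energy (\<lambda>m. c m - (\<Sum>j<M. of_real (target_weight c d M j) * root_fraction_coeffs M j m)) \<and>
    energy (\<lambda>m. c m - (\<Sum>j<M. of_real (target_weight c d M j) * root_fraction_coeffs M j m)) \<le> e"
proof -
  define C where "C = (\<Sum>k<d. cmod (c k))"
  have C: "C \<ge> 0" unfolding C_def by (intro sum_nonneg) auto
  have cC: "cmod (c m) \<le> C" for m
    using c [of m] C member_le_sum [of m "{..<d}" "\<lambda>k. cmod (c k)"] by (cases "m < d") (auto simp: C_def)
  \<comment> \<open>9 C^2 is the square of C + 2C, from the polynomial and its discretization;
    adding 1 keeps the denominator positive when C = 0.\<close>
  define e' where "e' = e / (9 * C\<^sup>2 + 1)"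
  have pos: "9 * C\<^sup>2 + 1 > 0" using zero_le_power2 [of C] by linarith
  then have e': "e' > 0" "9 * C\<^sup>2 * e' \<le> e" using e by (auto simp: e'_def field_simps)
  obtain J where J: "\<And>m n. m \<ge> J \<Longrightarrow> norm (\<Sum>m\<in>{m..<n}. moment m) < e'"
    using summable_moment e'(1) unfolding summable_Cauchy by blast
  let ?V = "\<lambda>M m. \<Sum>j<M. complex_of_real (target_weight c d M j) * root_fraction_coeffs M j m"
  have "finite_energy (\<lambda>m. c m - ?V M m) \<and> energy (\<lambda>m. c m - ?V M m) \<le> e" if M: "M \<ge> J + d + 1" for M
  proof -
    have le: "(\<Sum>m<n. (cmod (c m - ?V M m))\<^sup>2 * moment m) \<le> e" for n
    proof -
      have zero: "c m - ?V M m = 0" if "m < J" for m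
        using target_weight_coeffs [of m d M c] c that M by simp
      have bound: "(cmod (c m - ?V M m))\<^sup>2 \<le> 9 * C\<^sup>2" for m
      proof -
        have "cmod (c m - ?V M m) \<le> cmod (c m) + cmod (?V M m)" by (rule norm_triangle_ineq4)
        also have "\<dots> \<le> 3 * C"
          using cC [of m] target_weight_coeffs_le [of M c d m] M by (simp add: C_def)
        finally have "(cmod (c m - ?V M m))\<^sup>2 \<le> (3 * C)\<^sup>2" by (intro power_mono) auto
        then show ?thesis by (simp add: power_mult_distrib)
      qed
      have "(\<Sum>m<n. (cmod (c m - ?V M m))\<^sup>2 * moment m) \<le> (\<Sum>m\<in>{..<J} \<union> {J..<n}. (cmod (c m - ?V M m))\<^sup>2 * moment m)"
        using moment_nonneg by (intro sum_mono2) auto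
      also have "\<dots> = (\<Sum>m<J. (cmod (c m - ?V M m))\<^sup>2 * moment m) + (\<Sum>m\<in>{J..<n}. (cmod (c m - ?V M m))\<^sup>2 * moment m)"
        by (rule sum.union_disjoint) auto
      also have "(\<Sum>m<J. (cmod (c m - ?V M m))\<^sup>2 * moment m) = 0"
        by (intro sum.neutral) (use zero in auto)
      also have "(\<Sum>m\<in>{J..<n}. (cmod (c m - ?V M m))\<^sup>2 * moment m) \<le> (\<Sum>m\<in>{J..<n}. 9 * C\<^sup>2 * moment m)"
        by (intro sum_mono mult_right_mono bound moment_nonneg)
      also have "\<dots> = 9 * C\<^sup>2 * (\<Sum>m\<in>{J..<n}. moment m)" by (simp add: sum_distrib_left)
      also have "\<dots> \<le> 9 * C\<^sup>2 * e'"
        using J [of J n] by (intro mult_left_mono) auto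
      finally show ?thesis using e'(2) by simp
    qed
    show ?thesis by (rule conjI [OF energy_le(1) [OF le] energy_le(2) [OF le]])
  qed
  then show ?thesis by (intro exI [of _ "J + d + 1"]) auto
qed

text \<open>The multiplicities are target weight plus increment of the rounding error plus K. The
  error splits into discretization c - V, rounding Y, and the shift -K \<Gamma>.\<close>

lemma polynomial_approximation:
  assumes o: "g \<in> o[at_right 0](\<lambda>t. t)" and e: "e > 0" and c: "\<And>k. k \<ge> d \<Longrightarrow> c k = 0"
  shows "\<exists>N b. N \<ge> 1 \<and> (\<forall>k<N. cmod (b k) = 1) \<and> finite_energy (\<lambda>m. c m - fraction_coeffs N b m) \<and>
    energy (\<lambda>m. c m - fraction_coeffs N b m) < e"
proof -
  define C where "C = (\<Sum>k<d. cmod (c k))"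
  have C: "C \<ge> 0" unfolding C_def by (intro sum_nonneg) auto
  \<comment> \<open>Each weight is at least -2C and the two rounding errors cost less than 2, so
    adding K makes every multiplicity positive. K does not depend on M, so M can be chosen after
    it.\<close>
  define K where "K = nat \<lceil>2 * C\<rceil> + 3"
  have K: "real K \<ge> 2 * C + 3" unfolding K_def using C by linarith
  \<comment> \<open>Two applications of \<open>energy_add\<close> turn these budgets into 2 (e/8 + 2
    (e/16 + e/16)) = 3e/4.\<close>
  have pos: "e / 8 > 0" "e / 16 > 0" "e / (16 * (real K)\<^sup>2) > 0"
    using e K C by auto
  obtain M1 where M1: "\<And>M. M \<ge> M1 \<Longrightarrow>
      finite_energy (\<lambda>m. c m - (\<Sum>j<M. of_real (target_weight c d M j) * root_fraction_coeffs M j m)) \<and>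
      energy (\<lambda>m. c m - (\<Sum>j<M. of_real (target_weight c d M j) * root_fraction_coeffs M j m)) \<le> e / 8"
    using energy_target_error [of "e / 8" d c, OF pos(1) c] by blast
  obtain M2 where M2: "\<And>M. M \<ge> M2 \<Longrightarrow>
      (\<Sum>j<Suc M. energy (\<lambda>m. root_fraction_coeffs M j m - root_fraction_coeffs M (j - 1) m)) \<le> e / 16"
    using energy_root_differences [OF o pos(2)] by blast
  obtain M3 where M3: "\<And>M. M \<ge> M3 \<Longrightarrow> finite_energy (\<lambda>m. \<Sum>j<M. root_fraction_coeffs M j m) \<and>
      energy (\<lambda>m. \<Sum>j<M. root_fraction_coeffs M j m) \<le> e / (16 * (real K)\<^sup>2)"
    using energy_all_roots [OF o pos(3)] by blast
  define M where "M = M1 + M2 + M3 + d + 1"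
  have M: "M > 0" "d < M" by (auto simp: M_def)
  define \<gamma> where "\<gamma> = root_fraction_coeffs M"
  define \<mu> where "\<mu> = target_weight c d M"
  define V where "V m = (\<Sum>j<M. of_real (\<mu> j) * \<gamma> j m)" for m
  define \<Gamma> where "\<Gamma> m = (\<Sum>j<M. \<gamma> j m)" for m
  define x where "x j m = \<gamma> j m - \<gamma> (j - 1) m" for j m
  have EV: "finite_energy (\<lambda>m. c m - V m)" "energy (\<lambda>m. c m - V m) \<le> e / 8"
    using M1 [of M] by (auto simp: V_def \<mu>_def \<gamma>_def M_def)
  have EG: "finite_energy \<Gamma>" "energy \<Gamma> \<le> e / (16 * (real K)\<^sup>2)"
    using M3 [of M] by (auto simp: \<Gamma>_def [abs_def] \<gamma>_def M_def)
  have finx: "finite_energy (x j)" for j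
  proof (rule finite_energy_bounded)
    show "cmod (x j m) \<le> 2" for m
      unfolding x_def by (rule order_trans [OF norm_triangle_ineq4]) (simp add: \<gamma>_def)
  qed
  define S where "S j = (\<Sum>i<j. \<mu> i)" for j
  have S0: "S 0 = 0" and SM: "S M = 0"
    using sum_target_weight [OF M(2), of c] by (auto simp: S_def \<mu>_def)
  obtain L :: "nat \<Rightarrow> int" where L: "\<And>j. \<bar>of_int (L j) - S j\<bar> < 1"
    and EL: "energy (\<lambda>m. \<Sum>j<Suc M. of_real (of_int (L j) - S j) * x j m) \<le> (\<Sum>j<Suc M. energy (x j))"
    using energy_rounding [of x S "Suc M", OF finx] by blast
  \<comment> \<open>An integer at distance less than 1 from 0 is 0, so the rounding error D vanishes
    at both ends and Abel summation applies.\<close>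
  have L0: "L 0 = 0" and LM: "L M = 0"
    using L [of 0] L [of M] by (auto simp: S0 SM)
  define D where "D j = complex_of_real (of_int (L j) - S j)" for j
  define Y where "Y m = (\<Sum>j<Suc M. D j * x j m)" for m
  have EY: "finite_energy Y" "energy Y \<le> e / 16"
  proof -
    show "finite_energy Y"
      unfolding Y_def [abs_def] by (intro finite_energy_sum finite_energy_scale finx)
    show "energy Y \<le> e / 16"
      using EL M2 [of M] unfolding Y_def [abs_def] D_def x_def [abs_def] \<gamma>_def by (simp add: M_def)
  qed
  \<comment> \<open>Rounding acts on the partial sums S rather than on the weights, since the small
    vectors are the differences x j; the multiplicities are recovered as increments of L.\<close>
  define n where "n i = nat (L (Suc i) - L i + int K)" for i
  have \<mu>_le: "\<bar>\<mu> i\<bar> \<le> 2 * C" for i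
  proof -
    have "\<bar>\<mu> i\<bar> \<le> 2 / real M * C"
      unfolding \<mu>_def C_def by (rule target_weight_le)
    also have "\<dots> \<le> 2 * C"
      using M C by (intro mult_right_mono) (auto simp: field_simps)
    finally show ?thesis .
  qed
  have n_pos: "L (Suc i) - L i + int K \<ge> 1" for i
  proof -
    have "S (Suc i) = S i + \<mu> i" by (simp add: S_def)
    then have "real_of_int (L (Suc i) - L i + int K) > 0"
      using L [of i] L [of "Suc i"] \<mu>_le [of i] K by simp
    then have "0 < L (Suc i) - L i + int K" by (simp only: of_int_0_less_iff)
    then show ?thesis by simp
  qed
  have n_eq: "of_nat (n i) = complex_of_real (\<mu> i) + (D (Suc i) - D i) + of_nat K" for i
  proof -
    have "int (n i) = L (Suc i) - L i + int K" using n_pos [of i] by (simp add: n_def)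
    then have "real (n i) = of_int (L (Suc i)) - of_int (L i) + real K"
      by (metis of_int_add of_int_diff of_int_of_nat_eq)
    then have "real (n i) = \<mu> i + ((of_int (L (Suc i)) - S (Suc i)) - (of_int (L i) - S i)) + real K"
      by (simp add: S_def)
    then have "complex_of_real (real (n i)) = complex_of_real (\<mu> i + ((of_int (L (Suc i)) - S (Suc i)) - (of_int (L i) - S i)) + real K)"
      by (rule arg_cong)
    then show ?thesis by (simp add: D_def)
  qed
  obtain N b where N: "N \<ge> M" and b: "\<forall>k<N. cmod (b k) = 1"
    and coef: "\<And>m. fraction_coeffs N b m = (\<Sum>i<M. of_nat (n i) * - (cnj (root_of_one M (int i)) ^ Suc m))"
  proof -
    have "n i \<ge> 1" for i using n_pos [of i] by (simp add: n_def)
    then show thesis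
      using that fraction_coeffs_multiplicities [of M "\<lambda>i. root_of_one M (int i)" n] by auto
  qed
  have split: "c m - fraction_coeffs N b m = (c m - V m) + (Y m + (- of_nat K) * \<Gamma> m)" for m
  proof -
    have "fraction_coeffs N b m = (\<Sum>i<M. of_nat (n i) * \<gamma> i m)"
      unfolding coef \<gamma>_def root_fraction_coeffs_def ..
    also have "\<dots> = V m + (\<Sum>i<M. (D (Suc i) - D i) * \<gamma> i m) + of_nat K * \<Gamma> m"
      unfolding n_eq V_def \<Gamma>_def by (simp add: distrib_right sum.distrib sum_distrib_left)
    also have "(\<Sum>i<M. (D (Suc i) - D i) * \<gamma> i m) = - Y m"
      unfolding Y_def x_def by (rule abel_summation) (simp_all add: D_def S0 SM L0 LM)
    finally show ?thesis by simp
  qed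
  have EKG: "finite_energy (\<lambda>m. (- of_nat K) * \<Gamma> m)" "energy (\<lambda>m. (- of_nat K) * \<Gamma> m) \<le> e / 16"
  proof -
    show "finite_energy (\<lambda>m. (- of_nat K) * \<Gamma> m)" by (intro finite_energy_scale EG)
    have "energy (\<lambda>m. (- of_nat K) * \<Gamma> m) = (real K)\<^sup>2 * energy \<Gamma>"
      using energy_scale [OF EG(1), of "- of_nat K"] by simp
    also have "\<dots> \<le> (real K)\<^sup>2 * (e / (16 * (real K)\<^sup>2))"
      by (intro mult_left_mono EG) simp
    also have "\<dots> = e / 16" using K C by simp
    finally show "energy (\<lambda>m. (- of_nat K) * \<Gamma> m) \<le> e / 16" .
  qed
  have Z: "finite_energy (\<lambda>m. Y m + (- of_nat K) * \<Gamma> m)" "energy (\<lambda>m. Y m + (- of_nat K) * \<Gamma> m) \<le> e / 4"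
    using energy_add [OF EY(1) EKG(1)] EY(2) EKG(2) by auto
  have "finite_energy (\<lambda>m. c m - fraction_coeffs N b m)" "energy (\<lambda>m. c m - fraction_coeffs N b m) \<le> 3 * e / 4"
    unfolding split using energy_add [OF EV(1) Z(1)] EV(2) Z(2) by auto
  moreover have "3 * e / 4 < e" using e by simp
  moreover have "N \<ge> 1" using N M by simp
  ultimately show ?thesis using b by (meson le_less_trans)
qed

text \<open>A Taylor polynomial is within energy e/4 of f and a fraction is within less than e/4 of
  that polynomial; \<open>energy_add\<close> combines these to less than e.\<close>

theorem simplest_fractions_dense:
  assumes o: "g \<in> o[at_right 0](\<lambda>t. t)"
  shows "bergman_topology g closure_of simplest_fractions = bergman g"
proof
  interpret M: Metric_space "bergman g" "bergman_dist g"
    using Metric_space_bergman [OF g_int g_pos] .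
  show "bergman_topology g closure_of simplest_fractions \<subseteq> bergman g"
    unfolding bergman_topology_def using closure_of_subset_topspace [of M.mtopology] by simp
  show "bergman g \<subseteq> bergman_topology g closure_of simplest_fractions"
  proof
    fix f assume f: "f \<in> bergman g"
    then obtain a where a: "taylor_coeffs a f" "finite_energy a"
      by (rule bergman_taylor_coeffs)
    show "f \<in> bergman_topology g closure_of simplest_fractions"
      unfolding closure_simplest_fractions_iff [OF f a]
    proof (intro allI impI)
      fix e :: real assume e: "e > 0"
      have "summable (\<lambda>m. (cmod (a m))\<^sup>2 * moment m)" using a(2) by (simp add: finite_energy_def)
      moreover have "e / 4 > 0" using e by simp
      ultimately obtain d where d: "\<And>m n. m \<ge> d \<Longrightarrow> norm (\<Sum>m\<in>{m..<n}. (cmod (a m))\<^sup>2 * moment m) < e / 4"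
        unfolding summable_Cauchy by blast
      define c where "c m = (if m < d then a m else 0)" for m
      have "(\<Sum>m<n. (cmod (a m - c m))\<^sup>2 * moment m) \<le> e / 4" for n
      proof -
        have "(\<Sum>m<n. (cmod (a m - c m))\<^sup>2 * moment m) = (\<Sum>m\<in>{d..<n}. (cmod (a m))\<^sup>2 * moment m)"
          by (rule sum.mono_neutral_cong_right) (auto simp: c_def)
        then show ?thesis using d [of d n] by simp
      qed
      then have ac: "finite_energy (\<lambda>m. a m - c m)" "energy (\<lambda>m. a m - c m) \<le> e / 4"
        by (rule energy_le)+
      obtain N b where N: "N \<ge> 1" "\<forall>k<N. cmod (b k) = 1"
        and cs: "finite_energy (\<lambda>m. c m - fraction_coeffs N b m)" "energy (\<lambda>m. c m - fraction_coeffs N b m) < e / 4"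
        using polynomial_approximation [OF o, of "e / 4" d c] e by (auto simp: c_def)
      have "energy (\<lambda>m. a m - fraction_coeffs N b m) < e"
        using energy_add(2) [OF ac(1) cs(1)] ac(2) cs(2) by simp
      then show "\<exists>N b. N \<ge> 1 \<and> (\<forall>k<N. cmod (b k) = 1) \<and> energy (\<lambda>m. a m - fraction_coeffs N b m) < e"
        using N by blast
    qed
  qed
qed

end

theorem theorem7:
  fixes g :: "real \<Rightarrow> real"
  assumes g_int: "set_integrable lebesgue {0..1} g"
    and g_nonzero: "\<exists>t\<in>{0..1}. g t \<noteq> 0"
    and g_pos: "\<And>t. t \<in> {0<..1} \<Longrightarrow> g t > 0"
    and g_div: "set_integrable lebesgue {0..1} (\<lambda>s. g s / s)"
  shows "((\<lambda>t. t) \<in> O[at_right 0](g) \<longrightarrow>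
            bergman_topology g closure_of simplest_fractions = simplest_fractions) \<and>
         (g \<in> o[at_right 0](\<lambda>t. t) \<longrightarrow>
            bergman_topology g closure_of simplest_fractions = bergman g)"
proof -
  interpret bergman_weight g
    by unfold_locales (use g_int g_pos g_div in auto)
  show ?thesis
    using simplest_fractions_closed simplest_fractions_dense by blast
qed

end
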